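(* Let $X$ be an oriented Riemannian four-manifold. The Levi-Civita connection on $\Lambda^+$ is definite if and only if the endomorphism of $\Lambda^+$ given by $$\mathcal{D}=\left(W^++\frac{s}{12}\right)^2-\mathrm{Ric}_0^*\,\mathrm{Ric}_0$$ is definite. Moreover: 1. If $\mathcal{D}$ is positive definite then the connection induces the original orientation on $X$. In this case the sign of the connection agrees with the sign of $\det\left(W^++\frac{s}{12}\right)$. 2. If $\mathcal{D}$ is negative definite then the connection induces the opposite orientation on $X$. In this case the sign of the connection agrees with the sign of $\det\mathrm{Ric}_0$.
   Context: $\Lambda^2=\Lambda^+\oplus\Lambda^-$ is the splitting into self-dual and anti-self-dual 2-forms; if $e_i$ is an orthonormal coframe then $\{e_i\wedge e_j\}_{i<j}$ is orthonormal in $\Lambda^2$. The curvature operator $\mathrm{Rm}\colon\Lambda^2\to\Lambda^2$ decomposes as $$\mathrm{Rm}=\begin{pmatrix}W^++\frac{s}{12}&\mathrm{Ric}_0^*\\ \mathrm{Ric}_0&W^-+\frac{s}{12}\end{pmatrix},$$ where $W^\pm\colon\Lambda^\pm\to\Lambda^\pm$ are the self-dual/anti-self-dual Weyl curvatures, $s$ is the scalar curvature, and $\mathrm{Ric}_0\colon\Lambda^+\to\Lambda^-$ is the trace-free Ricci operator, given by $\mathrm{Ric}_0(a\wedge b)=\frac12(\mathrm{ric}_0(a)\wedge b+a\wedge\mathrm{ric}_0(b))$ with $\mathrm{ric}_0\colon T^*X\to T^*X$ the trace-free Ricci curvature. Signs are such that the round sphere has $s>0$. Under the natural identification $\Lambda^+\cong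 so(\Lambda^+)^*$ (from metric and orientation) the curvature of the Levi-Civita connection on $\Lambda^+$ is the map $F=(W^++\frac{s}{12})\oplus\mathrm{Ric}_0\colon\Lambda^+\to\Lambda^+\oplus\Lambda^-$. A metric connection on an $SO(3)$-bundle $E\to X^4$, with curvature $F\colon so(E)^*\to\Lambda^2T^*X$, is called definite if at each point the image of $F$ is a maximal definite (3-dimensional definite) subspace for the wedge product $\Lambda^2\times\Lambda^2\to\Lambda^4$; equivalently, the curvature on every two-plane in $TX$ is non-zero. A definite connection induces the orientation on $X$ for which the wedge product is positive definite on the image of $F$, and the conformal structure for which the image of $F$ is the bundle of self-dual forms. $so(3)$ is canonically oriented (by bases with $[\epsilon_1,\epsilon_2]=\epsilon_3$ and cyclic permutations), so $so(E)^*$ is oriented; the bundle of self-dual (or anti-self-dual) 2-forms is oriented as an $so(3)$ summand of $\Lambda^2\cong so(TX)=so(3)\oplus so(3)$. The sign of a definite connection is positive if $F$ is orientation preserving from $so(E)^*$ onto its image (the self-dual forms of the induced orientation and conformal structure) and negative if orientation reversing; sign conventions are such that the Levi-Civita connection on $\Lambda^+$ of the round $S^4$ is positive. The sign of $\det\mathrm{Ric}_0$ is taken with respect to the orientations of $\Lambda^\pm$. *)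

theory Defs
  imports "HOL-Analysis.Analysis"
begin

section \<open>Smooth functions on open subsets of \<open>\<real>\<^sup>4\<close>\<close>

definition pd :: "4 \<Rightarrow> (real^4 \<Rightarrow> 'b::real_normed_vector) \<Rightarrow> real^4 \<Rightarrow> 'b" where
  "pd i f x = frechet_derivative f (at x) (axis i 1)"

primrec Ck_on :: "nat \<Rightarrow> (real^4 \<Rightarrow> 'b::real_normed_vector) \<Rightarrow> (real^4) set \<Rightarrow> bool" where
  "Ck_on 0 f S \<longleftrightarrow> continuous_on S f"
| "Ck_on (Suc k) f S \<longleftrightarrow> f differentiable_on S \<and> (\<forall>i. Ck_on k (pd i f) S)"

definition smooth_on :: "(real^4 \<Rightarrow> 'b::real_normed_vector) \<Rightarrow> (real^4) set \<Rightarrow> bool" where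
  "smooth_on f S \<longleftrightarrow> (\<forall>k. Ck_on k f S)"


section \<open>Oriented Riemannian four-manifolds\<close>

type_synonym 'a chart = "'a set \<times> ('a \<Rightarrow> real^4)"

definition is_chart :: "'a::topological_space chart \<Rightarrow> bool" where
  "is_chart c \<longleftrightarrow> open (fst c) \<and> open (snd c ` fst c) \<and>
     (\<exists>\<psi>. homeomorphism (fst c) (snd c ` fst c) (snd c) \<psi>)"

definition transition :: "'a chart \<Rightarrow> 'a chart \<Rightarrow> real^4 \<Rightarrow> real^4" where
  "transition c d = snd d \<circ> inv_into (fst c) (snd c)"

definition oriented_smooth_atlas :: "'a::topological_space chart set \<Rightarrow> bool" where
  "oriented_smooth_atlas A \<longleftrightarrow>
     (\<forall>c\<in>A. is_chart c) \<and> (\<Union>c\<in>A. fst c) = UNIV \<and>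
     (\<forall>c\<in>A. \<forall>d\<in>A.
        smooth_on (transition c d) (snd c ` (fst c \<inter> fst d)) \<and>
        (\<forall>x\<in>snd c ` (fst c \<inter> fst d). det (jacobian (transition c d) (at x)) > 0))"

definition metric_matrix :: "real^4^4 \<Rightarrow> bool" where
  "metric_matrix h \<longleftrightarrow> transpose h = h \<and> (\<forall>v. v \<noteq> 0 \<longrightarrow> v \<bullet> (h *v v) > 0)"

text \<open>A metric is given by its coefficient matrices in the charts: \<open>g c x $ i $ j\<close> is
  \<open>g(\<partial>\<^sub>i, \<partial>\<^sub>j)\<close> at the point with coordinates \<open>x\<close> in the chart \<open>c\<close>.\<close>

definition riemannian_metric ::
    "'a::topological_space chart set \<Rightarrow> ('a chart \<Rightarrow> real^4 \<Rightarrow> real^4^4) \<Rightarrow> bool" where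
  "riemannian_metric A g \<longleftrightarrow>
     (\<forall>c\<in>A. smooth_on (g c) (snd c ` fst c) \<and> (\<forall>x\<in>snd c ` fst c. metric_matrix (g c x))) \<and>
     (\<forall>c\<in>A. \<forall>d\<in>A. \<forall>x\<in>snd c ` (fst c \<inter> fst d).
        let J = jacobian (transition c d) (at x)
        in g c x = transpose J ** g d (transition c d x) ** J)"

definition oriented_riemannian_4manifold ::
    "'a::{t2_space, second_countable_topology} chart set \<Rightarrow>
     ('a chart \<Rightarrow> real^4 \<Rightarrow> real^4^4) \<Rightarrow> bool" where
  "oriented_riemannian_4manifold A g \<longleftrightarrow> oriented_smooth_atlas A \<and> riemannian_metric A g"


section \<open>Two-forms on an oriented four-dimensional vector space\<close>

text \<open>A covector is its vector of coefficients, and a two-form \<open>\<omega>\<close> is the antisymmetric matrix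
  \<open>\<omega> $ i $ j = \<omega>(\<partial>\<^sub>i, \<partial>\<^sub>j)\<close>. The inner product is given by the matrix \<open>h\<close> in a basis that is
  positively oriented for the original orientation.\<close>

definition forms2 :: "(real^4^4) set" where
  "forms2 = {\<omega>. transpose \<omega> = - \<omega>}"

definition wedge11 :: "real^4 \<Rightarrow> real^4 \<Rightarrow> real^4^4" where
  "wedge11 a b = (\<chi> i j. a$i * b$j - a$j * b$i)"

text \<open>The coefficient of \<open>\<omega> \<and> \<eta>\<close> with respect to \<open>dx\<^sub>1 \<and> dx\<^sub>2 \<and> dx\<^sub>3 \<and> dx\<^sub>4\<close>.\<close>

definition wedge22 :: "real^4^4 \<Rightarrow> real^4^4 \<Rightarrow> real" where
  "wedge22 \<omega> \<eta> =
     \<omega>$1$2 * \<eta>$3$4 - \<omega>$1$3 * \<eta>$2$4 + \<omega>$1$4 * \<eta>$2$3 +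
     \<omega>$2$3 * \<eta>$1$4 - \<omega>$2$4 * \<eta>$1$3 + \<omega>$3$4 * \<eta>$1$2"

definition raise2 :: "real^4^4 \<Rightarrow> real^4^4 \<Rightarrow> real^4^4" where
  "raise2 h \<omega> = matrix_inv h ** \<omega> ** transpose (matrix_inv h)"

text \<open>The factor \<open>1/2\<close> makes \<open>e\<^sub>i \<and> e\<^sub>j\<close>, \<open>i < j\<close>, orthonormal for an orthonormal coframe \<open>e\<close>.\<close>

definition form_inner :: "real^4^4 \<Rightarrow> real^4^4 \<Rightarrow> real^4^4 \<Rightarrow> real" where
  "form_inner h \<omega> \<eta> = (1/2) * (\<Sum>k\<in>UNIV. \<Sum>l\<in>UNIV. raise2 h \<omega> $ k $ l * \<eta> $ k $ l)"

text \<open>The orientation is \<open>\<sigma> = 1\<close> (the original one) or \<open>\<sigma> = - 1\<close> (the opposite one), with volume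
  form \<open>\<sigma> * sqrt (det h)\<close>. As \<open>\<eta> \<and> *\<omega> = \<langle>\<eta>, \<omega>\<rangle> vol\<close> for all \<open>\<eta>\<close>, the condition is
  \<open>*\<omega> = \<omega>\<close>. The anti-self-dual forms are \<open>self_dual (- 1) h\<close>.\<close>

definition self_dual :: "real \<Rightarrow> real^4^4 \<Rightarrow> (real^4^4) set" where
  "self_dual \<sigma> h =
     {\<omega>\<in>forms2. \<forall>\<eta>\<in>forms2. wedge22 \<eta> \<omega> = \<sigma> * sqrt (det h) * form_inner h \<eta> \<omega>}"

text \<open>The Lie bracket of \<open>so(T)\<close> transported to two-forms by the identification of \<open>\<omega>\<close> with the
  skew endomorphism \<open>matrix_inv h ** \<omega>\<close>, so that \<open>a \<and> b\<close> corresponds to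
  \<open>v \<mapsto> b(v) a\<^sup>\<sharp> - a(v) b\<^sup>\<sharp>\<close>. The opposite identification would reverse the orientations of both
  \<open>\<Lambda>\<^sup>+\<close> and \<open>\<Lambda>\<^sup>-\<close>; this is the one for which the Levi-Civita connection on \<open>\<Lambda>\<^sup>+\<close> of the round
  sphere is positive.\<close>

definition form_bracket :: "real^4^4 \<Rightarrow> real^4^4 \<Rightarrow> real^4^4 \<Rightarrow> real^4^4" where
  "form_bracket h \<omega> \<eta> = \<omega> ** matrix_inv h ** \<eta> - \<eta> ** matrix_inv h ** \<omega>"


section \<open>Bases, orientations and determinants of three-dimensional spaces\<close>

definition basis3 :: "'v::real_vector set \<Rightarrow> (3 \<Rightarrow> 'v) \<Rightarrow> bool" where
  "basis3 V b \<longleftrightarrow> inj b \<and> independent (range b) \<and> span (range b) = V"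

definition so3_basis :: "('v \<Rightarrow> 'v \<Rightarrow> 'v) \<Rightarrow> 'v::real_vector set \<Rightarrow> (3 \<Rightarrow> 'v) \<Rightarrow> bool" where
  "so3_basis br V b \<longleftrightarrow>
     basis3 V b \<and> br (b 1) (b 2) = b 3 \<and> br (b 2) (b 3) = b 1 \<and> br (b 3) (b 1) = b 2"

definition so3 :: "(real^3^3) set" where
  "so3 = {M. transpose M = - M}"

definition commutator :: "real^3^3 \<Rightarrow> real^3^3 \<Rightarrow> real^3^3" where
  "commutator M N = M ** N - N ** M"

text \<open>The determinant of the linear map sending the basis of the source to the family \<open>w\<close>, with
  respect to the basis \<open>c\<close> of the target.\<close>

definition det_in_basis :: "(3 \<Rightarrow> 'v::real_vector) \<Rightarrow> (3 \<Rightarrow> 'v) \<Rightarrow> real" where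
  "det_in_basis c w = det (\<chi> i j. representation (range c) (w j) (c i) :: real^3^3)"

text \<open>Two bases satisfying the bracket relations differ by an element of \<open>SO(3)\<close>, so the
  determinants below do not depend on the choices made by \<open>SOME\<close>. For \<open>\<sigma> = \<tau>\<close> one gets the
  usual determinant of an endomorphism.\<close>

definition oriented_basis :: "real \<Rightarrow> real^4^4 \<Rightarrow> 3 \<Rightarrow> real^4^4" where
  "oriented_basis \<sigma> h = (SOME b. so3_basis (form_bracket h) (self_dual \<sigma> h) b)"

definition form_det :: "real^4^4 \<Rightarrow> real \<Rightarrow> real \<Rightarrow> (real^4^4 \<Rightarrow> real^4^4) \<Rightarrow> real" where
  "form_det h \<sigma> \<tau> T = det_in_basis (oriented_basis \<tau> h) (\<lambda>j. T (oriented_basis \<sigma> h j))"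


section \<open>Definite connections on \<open>SO(3)\<close>-bundles\<close>

text \<open>The curvature at a point of a metric connection on an \<open>SO(3)\<close>-bundle \<open>E\<close> is given, in an
  orthonormal frame of the fibre, by the matrices \<open>\<Omega> k l \<in> so(3)\<close> of the endomorphisms
  \<open>R\<^sup>E(\<partial>\<^sub>k, \<partial>\<^sub>l)\<close>. The map \<open>F : so(E)\<^sup>* \<rightarrow> \<Lambda>\<^sup>2\<close> sends \<open>\<phi>\<close> to the two-form
  \<open>\<phi>(R\<^sup>E(\<cdot>, \<cdot>))\<close>.\<close>

definition curvature_map :: "(4 \<Rightarrow> 4 \<Rightarrow> real^3^3) \<Rightarrow> (real^3^3 \<Rightarrow> real) \<Rightarrow> real^4^4" where
  "curvature_map \<Omega> \<phi> = (\<chi> k l. \<phi> (\<Omega> k l))"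

text \<open>Every linear functional on \<open>so3\<close> is the restriction of one on all matrices.\<close>

definition curvature_image :: "(4 \<Rightarrow> 4 \<Rightarrow> real^3^3) \<Rightarrow> (real^4^4) set" where
  "curvature_image \<Omega> = {curvature_map \<Omega> \<phi> | \<phi>. linear \<phi>}"

definition induces_orientation :: "(4 \<Rightarrow> 4 \<Rightarrow> real^3^3) \<Rightarrow> real \<Rightarrow> bool" where
  "induces_orientation \<Omega> \<sigma> \<longleftrightarrow>
     (\<forall>\<omega>\<in>curvature_image \<Omega>. \<omega> \<noteq> 0 \<longrightarrow> \<sigma> * wedge22 \<omega> \<omega> > 0)"

definition definite_curvature :: "(4 \<Rightarrow> 4 \<Rightarrow> real^3^3) \<Rightarrow> bool" where
  "definite_curvature \<Omega> \<longleftrightarrow>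
     dim (curvature_image \<Omega>) = 3 \<and> (induces_orientation \<Omega> 1 \<or> induces_orientation \<Omega> (- 1))"

text \<open>The matrix \<open>h\<close> represents the conformal structure for which, together with the orientation
  \<open>\<sigma>\<close>, the image of the curvature consists of the self-dual forms.\<close>

definition induced_structure :: "(4 \<Rightarrow> 4 \<Rightarrow> real^3^3) \<Rightarrow> real \<Rightarrow> real^4^4 \<Rightarrow> bool" where
  "induced_structure \<Omega> \<sigma> h \<longleftrightarrow>
     \<sigma> \<in> {1, - 1} \<and> induces_orientation \<Omega> \<sigma> \<and>
     metric_matrix h \<and> self_dual \<sigma> h = curvature_image \<Omega>"

text \<open>Here \<open>\<lambda>M. representation (range \<epsilon>) M (\<epsilon> j)\<close> is the basis of \<open>so(3)\<^sup>*\<close> dual to \<open>\<epsilon>\<close>. The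
  result is \<open>1\<close> if \<open>F\<close> preserves and \<open>- 1\<close> if it reverses orientation; \<open>\<sigma>\<close> and the conformal
  class of \<open>h\<close> are determined by a definite \<open>\<Omega>\<close>.\<close>

definition connection_sign :: "(4 \<Rightarrow> 4 \<Rightarrow> real^3^3) \<Rightarrow> real" where
  "connection_sign \<Omega> =
     (let (\<sigma>, h) = (SOME (\<sigma>, h). induced_structure \<Omega> \<sigma> h);
          \<epsilon> = (SOME \<epsilon>. so3_basis commutator so3 \<epsilon>)
      in sgn (det_in_basis (oriented_basis \<sigma> h)
                (\<lambda>j. curvature_map \<Omega> (\<lambda>M. representation (range \<epsilon>) M (\<epsilon> j)))))"


section \<open>The Levi-Civita connection and its curvature\<close>

text \<open>In this and the next section \<open>g\<close> is the coefficient matrix of a metric on an open subset of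
  \<open>\<real>\<^sup>4\<close>. \<open>christoffel g x k $ m $ i\<close> is \<open>\<Gamma>\<^sup>m\<^sub>k\<^sub>i\<close>, so \<open>\<nabla>\<^sub>k \<partial>\<^sub>i = \<Gamma>\<^sup>m\<^sub>k\<^sub>i \<partial>\<^sub>m\<close>.\<close>

type_synonym metric_field = "real^4 \<Rightarrow> real^4^4"

definition christoffel :: "metric_field \<Rightarrow> real^4 \<Rightarrow> 4 \<Rightarrow> real^4^4" where
  "christoffel g x k = (\<chi> m i. (1/2) * (\<Sum>n\<in>UNIV. matrix_inv (g x) $ m $ n *
     (pd k g x $ n $ i + pd i g x $ n $ k - pd n g x $ k $ i)))"

definition cov_vector :: "metric_field \<Rightarrow> 4 \<Rightarrow> (real^4 \<Rightarrow> real^4) \<Rightarrow> real^4 \<Rightarrow> real^4" where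
  "cov_vector g k Y x = pd k Y x + christoffel g x k *v Y x"

text \<open>\<open>(\<nabla>\<^sub>k \<omega>)\<^sub>i\<^sub>j = \<partial>\<^sub>k \<omega>\<^sub>i\<^sub>j - \<Gamma>\<^sup>m\<^sub>k\<^sub>i \<omega>\<^sub>m\<^sub>j - \<Gamma>\<^sup>m\<^sub>k\<^sub>j \<omega>\<^sub>i\<^sub>m\<close>, the induced connection on two-forms.\<close>

definition cov_form :: "metric_field \<Rightarrow> 4 \<Rightarrow> (real^4 \<Rightarrow> real^4^4) \<Rightarrow> real^4 \<Rightarrow> real^4^4" where
  "cov_form g k \<omega> x =
     pd k \<omega> x - (transpose (christoffel g x k) ** \<omega> x + \<omega> x ** christoffel g x k)"

text \<open>Curvatures are \<open>\<nabla>\<^sub>k \<nabla>\<^sub>l - \<nabla>\<^sub>l \<nabla>\<^sub>k\<close>. They are tensorial, so they may be computed on the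
  extension with constant coefficients, which for a self-dual \<open>\<omega>\<close> need not be self-dual
  elsewhere: \<open>\<Lambda>\<^sup>+\<close> is a parallel subbundle, and its curvature is the restriction of that of
  \<open>\<Lambda>\<^sup>2\<close>.\<close>

definition form_curvature :: "metric_field \<Rightarrow> real^4 \<Rightarrow> 4 \<Rightarrow> 4 \<Rightarrow> real^4^4 \<Rightarrow> real^4^4" where
  "form_curvature g x k l \<omega> =
     cov_form g k (cov_form g l (\<lambda>_. \<omega>)) x - cov_form g l (cov_form g k (\<lambda>_. \<omega>)) x"

definition form_frame :: "real^4^4 \<Rightarrow> 3 \<Rightarrow> real^4^4" where
  "form_frame h = (SOME b. basis3 (self_dual 1 h) b \<and>
     (\<forall>i j. form_inner h (b i) (b j) = (if i = j then 1 else 0)))"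

text \<open>The curvature of the Levi-Civita connection on \<open>\<Lambda>\<^sup>+\<close>. Another orthonormal frame of
  \<open>\<Lambda>\<^sup>+\<close> conjugates all the matrices by one element of \<open>O(3)\<close>, which acts on \<open>so3\<close> by an
  automorphism of Lie algebras; image and sign are unaffected.\<close>

definition lc_curvature :: "metric_field \<Rightarrow> real^4 \<Rightarrow> 4 \<Rightarrow> 4 \<Rightarrow> real^3^3" where
  "lc_curvature g x k l = (\<chi> a b. form_inner (g x) (form_frame (g x) a)
     (form_curvature g x k l (form_frame (g x) b)))"


section \<open>Ricci and Weyl curvature\<close>

text \<open>\<open>riemann_up g x k l $ i $ j\<close> is \<open>R\<^sup>i\<^sub>j\<^sub>k\<^sub>l\<close>, where \<open>R(\<partial>\<^sub>k, \<partial>\<^sub>l) \<partial>\<^sub>j = R\<^sup>i\<^sub>j\<^sub>k\<^sub>l \<partial>\<^sub>i\<close>.\<close>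

definition riemann_up :: "metric_field \<Rightarrow> real^4 \<Rightarrow> 4 \<Rightarrow> 4 \<Rightarrow> real^4^4" where
  "riemann_up g x k l = (\<chi> i j.
     (cov_vector g k (cov_vector g l (\<lambda>_. axis j 1)) x
      - cov_vector g l (cov_vector g k (\<lambda>_. axis j 1)) x) $ i)"

definition riemann :: "metric_field \<Rightarrow> real^4 \<Rightarrow> 4 \<Rightarrow> 4 \<Rightarrow> 4 \<Rightarrow> 4 \<Rightarrow> real" where
  "riemann g x i j k l = (g x ** riemann_up g x k l) $ i $ j"

definition ricci :: "metric_field \<Rightarrow> real^4 \<Rightarrow> real^4^4" where
  "ricci g x = (\<chi> j l. \<Sum>i\<in>UNIV. riemann_up g x i l $ i $ j)"

definition scalar_curvature :: "metric_field \<Rightarrow> real^4 \<Rightarrow> real" where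
  "scalar_curvature g x = trace (matrix_inv (g x) ** ricci g x)"

definition weyl :: "metric_field \<Rightarrow> real^4 \<Rightarrow> 4 \<Rightarrow> 4 \<Rightarrow> 4 \<Rightarrow> 4 \<Rightarrow> real" where
  "weyl g x i j k l =
     riemann g x i j k l
     - (1/2) * (ricci g x $ i $ k * g x $ j $ l - ricci g x $ i $ l * g x $ j $ k
              + ricci g x $ j $ l * g x $ i $ k - ricci g x $ j $ k * g x $ i $ l)
     + scalar_curvature g x / 6 * (g x $ i $ k * g x $ j $ l - g x $ i $ l * g x $ j $ k)"

text \<open>The Weyl tensor acting on two-forms, normalised like a curvature operator that is the
  identity on the unit sphere. It preserves \<open>\<Lambda>\<^sup>+\<close> and \<open>\<Lambda>\<^sup>-\<close>; \<open>W\<^sup>+\<close> is its restriction to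
  \<open>\<Lambda>\<^sup>+\<close>.\<close>

definition weyl_op :: "metric_field \<Rightarrow> real^4 \<Rightarrow> real^4^4 \<Rightarrow> real^4^4" where
  "weyl_op g x \<omega> =
     (\<chi> i j. (1/2) * (\<Sum>k\<in>UNIV. \<Sum>l\<in>UNIV. weyl g x i j k l * raise2 (g x) \<omega> $ k $ l))"

text \<open>The matrix of the trace-free Ricci curvature as an endomorphism of covectors.\<close>

definition ric0 :: "metric_field \<Rightarrow> real^4 \<Rightarrow> real^4^4" where
  "ric0 g x = ricci g x ** matrix_inv (g x) - mat (scalar_curvature g x / 4)"

definition Ric0 :: "metric_field \<Rightarrow> real^4 \<Rightarrow> real^4^4 \<Rightarrow> real^4^4" where
  "Ric0 g x \<omega> = (1/2) *\<^sub>R (ric0 g x ** \<omega> + \<omega> ** transpose (ric0 g x))"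

lemma Ric0_wedge11:
  "Ric0 g x (wedge11 a b) = (1/2) *\<^sub>R (wedge11 (ric0 g x *v a) b + wedge11 a (ric0 g x *v b))"
  by (simp add: Ric0_def wedge11_def vec_eq_iff matrix_matrix_mult_def matrix_vector_mult_def
      transpose_def sum_distrib_left sum_distrib_right algebra_simps sum.distrib sum_subtractf)

text \<open>The adjoint \<open>\<Lambda>\<^sup>- \<rightarrow> \<Lambda>\<^sup>+\<close> of \<open>Ric0 : \<Lambda>\<^sup>+ \<rightarrow> \<Lambda>\<^sup>-\<close>.\<close>

definition Ric0_adj :: "metric_field \<Rightarrow> real^4 \<Rightarrow> real^4^4 \<Rightarrow> real^4^4" where
  "Ric0_adj g x \<omega> = (THE \<eta>. \<eta> \<in> self_dual 1 (g x) \<and>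
     (\<forall>\<zeta>\<in>self_dual 1 (g x). form_inner (g x) \<eta> \<zeta> = form_inner (g x) \<omega> (Ric0 g x \<zeta>)))"

definition weyl_scalar_op :: "metric_field \<Rightarrow> real^4 \<Rightarrow> real^4^4 \<Rightarrow> real^4^4" where
  "weyl_scalar_op g x \<omega> = weyl_op g x \<omega> + (scalar_curvature g x / 12) *\<^sub>R \<omega>"

definition D_op :: "metric_field \<Rightarrow> real^4 \<Rightarrow> real^4^4 \<Rightarrow> real^4^4" where
  "D_op g x \<omega> = weyl_scalar_op g x (weyl_scalar_op g x \<omega>) - Ric0_adj g x (Ric0 g x \<omega>)"

definition pos_def_sd :: "real^4^4 \<Rightarrow> (real^4^4 \<Rightarrow> real^4^4) \<Rightarrow> bool" where
  "pos_def_sd h T \<longleftrightarrow> (\<forall>\<omega>\<in>self_dual 1 h. \<omega> \<noteq> 0 \<longrightarrow> form_inner h (T \<omega>) \<omega> > 0)"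

definition neg_def_sd :: "real^4^4 \<Rightarrow> (real^4^4 \<Rightarrow> real^4^4) \<Rightarrow> bool" where
  "neg_def_sd h T \<longleftrightarrow> (\<forall>\<omega>\<in>self_dual 1 h. \<omega> \<noteq> 0 \<longrightarrow> form_inner h (T \<omega>) \<omega> < 0)"


section \<open>Pointwise conditions on the manifold\<close>

text \<open>A condition on the metric at a point, written in coordinates, is required at every point
  and in every chart of the atlas around it.\<close>

definition everywhere ::
    "'a chart set \<Rightarrow> ('a chart \<Rightarrow> metric_field) \<Rightarrow> (metric_field \<Rightarrow> real^4 \<Rightarrow> bool) \<Rightarrow> bool" where
  "everywhere A g P \<longleftrightarrow> (\<forall>c\<in>A. \<forall>p\<in>fst c. P (g c) (snd c p))"

end

theory Submission
  imports Defs
begin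

text \<open>
  All conditions are pointwise, so fix a point of a chart. The curvature
  \<open>R(\<partial>\<^sub>k, \<partial>\<^sub>l)\<close> acts on two-forms by the bracket with the two-form \<open>\<rho> k l\<close> obtained by lowering an
  index. As the bracket of \<open>\<Lambda>\<^sup>+\<close> is, in an orthonormal frame, a multiple of the cross product, the
  curvature of \<open>\<Lambda>\<^sup>+\<close> pairs the frame with the two-forms \<open>\<rho> k l\<close>, and by the symmetry
  \<open>R\<^sub>i\<^sub>j\<^sub>k\<^sub>l = R\<^sub>k\<^sub>l\<^sub>i\<^sub>j\<close> its image is the image of \<open>\<Lambda>\<^sup>+\<close> under the curvature operator \<open>Rm\<close>
  (\<open>frame_curvature_eq\<close>). There \<open>Rm = A + B\<close> with \<open>A = W\<^sup>+ + s/12\<close> mapping to \<open>\<Lambda>\<^sup>+\<close> and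
  \<open>B = Ric\<^sub>0\<close> mapping to \<open>\<Lambda>\<^sup>-\<close> (\<open>A_self_dual\<close>, \<open>B_self_dual\<close>).

  The wedge product is positive on \<open>\<Lambda>\<^sup>+\<close>, negative on \<open>\<Lambda>\<^sup>-\<close>, and the two are orthogonal, so
  \<open>Rm \<omega> \<and> Rm \<omega> = (|A \<omega>|\<^sup>2 - |B \<omega>|\<^sup>2) vol = \<langle>D_op \<omega>, \<omega>\<rangle> vol\<close>. Hence the image is a definite subspace of
  dimension three exactly if \<open>D_op\<close> is definite, and the sign of \<open>D_op\<close> tells which orientation is
  induced (\<open>definite_curvature_iff\<close>).

  For the sign of the connection, join \<open>Rm\<close> to its dominant block: if \<open>D_op\<close> is positive, then
  \<open>A + t B\<close>, for \<open>t\<close> between 0 and 1, has positive definite image throughout, so \<open>Rm\<close> orients its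
  image as \<open>A\<close> does, which is the sign of \<open>det A\<close>; if \<open>D_op\<close> is negative, the same holds for \<open>t A + B\<close>
  and \<open>B\<close> (\<open>connection_sign_pos\<close>, \<open>connection_sign_neg\<close>). To compare orientations of different
  definite subspaces, each being the self-dual forms of its own conformal structure, one needs a
  description of the orientation that varies continuously. It is provided by \<open>triple_form\<close>, a
  cubic expression in three two-forms that involves no metric: it does not vanish on a basis of a
  definite subspace (\<open>triple_form_nonzero\<close>), and its sign on such a basis decides whether the basis
  is positively oriented (\<open>sgn_det_in_so3_basis\<close>). The same cubic expression, as a quadratic form
  in the tangent vector, is up to sign a metric for which the given definite subspace consists of the
  self-dual forms (\<open>metric_of_orthonormal_triple\<close>), so the conformal structure in the definition of
  the sign exists.\<close>

section \<open>Partial derivatives and their symmetry\<close>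

text \<open>Derivatives along a coordinate axis reduce statements about \<open>pd\<close> to one-variable calculus.\<close>

lemma has_real_derivative_along_axis:
  fixes f :: "real^4 \<Rightarrow> real"
  assumes "f differentiable at (z + p *\<^sub>R axis i 1)"
  shows "((\<lambda>t. f (z + t *\<^sub>R axis i 1)) has_real_derivative pd i f (z + p *\<^sub>R axis i 1)) (at p)"
proof -
  let ?D = "frechet_derivative f (at (z + p *\<^sub>R axis i 1))"
  have D: "(f has_derivative ?D) (at (z + p *\<^sub>R axis i 1))"
    using assms frechet_derivative_works by blast
  have "((\<lambda>t. z + t *\<^sub>R axis i 1) has_derivative (\<lambda>t. t *\<^sub>R axis i 1)) (at p)"
    by (auto intro!: derivative_eq_intros)
  from has_derivative_compose[OF this D]
  have "((\<lambda>t. f (z + t *\<^sub>R axis i 1)) has_derivative (\<lambda>t. ?D (t *\<^sub>R axis i 1))) (at p)" .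
  moreover have "(\<lambda>t. ?D (t *\<^sub>R axis i 1)) = (*) (pd i f (z + p *\<^sub>R axis i 1))"
    using linear_cmul[OF has_derivative_linear[OF D]] by (auto simp: pd_def)
  ultimately show ?thesis by (simp add: has_field_derivative_def)
qed

text \<open>The mean value theorem applied twice: first to the increment in direction \<open>j\<close>, as a function
  of the displacement in direction \<open>i\<close>, and then to \<open>pd i f\<close> in direction \<open>j\<close>.\<close>

lemma double_mean_value:
  fixes f :: "real^4 \<Rightarrow> real"
  assumes s: "0 < s"
    and inU: "\<And>p q. 0 \<le> p \<Longrightarrow> p \<le> s \<Longrightarrow> 0 \<le> q \<Longrightarrow> q \<le> s \<Longrightarrow> x + p *\<^sub>R axis i 1 + q *\<^sub>R axis j 1 \<in> U"
    and f: "\<And>y. y \<in> U \<Longrightarrow> f differentiable at y"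
    and f': "\<And>y. y \<in> U \<Longrightarrow> pd i f differentiable at y"
  obtains p q where "0 \<le> p" "p \<le> s" "0 \<le> q" "q \<le> s"
    "f (x + s *\<^sub>R axis i 1 + s *\<^sub>R axis j 1) - f (x + s *\<^sub>R axis i 1) - f (x + s *\<^sub>R axis j 1) + f x
      = s * s * pd j (pd i f) (x + p *\<^sub>R axis i 1 + q *\<^sub>R axis j 1)"
proof -
  let ?G = "\<lambda>t. f ((x + s *\<^sub>R axis j 1) + t *\<^sub>R axis i 1) - f (x + t *\<^sub>R axis i 1)"
  let ?G' = "\<lambda>t. pd i f ((x + s *\<^sub>R axis j 1) + t *\<^sub>R axis i 1) - pd i f (x + t *\<^sub>R axis i 1)"
  have "(?G has_real_derivative ?G' t) (at t)" if "0 \<le> t" "t \<le> s" for t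
    by (intro DERIV_diff has_real_derivative_along_axis f)
      (use inU[of t s] inU[of t 0] that s in \<open>simp_all add: algebra_simps\<close>)
  from MVT2[OF s this] obtain p where p: "0 < p" "p < s" "?G s - ?G 0 = (s - 0) * ?G' p"
    by blast
  let ?H = "\<lambda>t. pd i f ((x + p *\<^sub>R axis i 1) + t *\<^sub>R axis j 1)"
  have "(?H has_real_derivative pd j (pd i f) ((x + p *\<^sub>R axis i 1) + t *\<^sub>R axis j 1)) (at t)"
    if "0 \<le> t" "t \<le> s" for t
    by (intro has_real_derivative_along_axis f') (use inU[of p t] that p in simp)
  from MVT2[OF s this] obtain q where q: "0 < q" "q < s"
    "?H s - ?H 0 = (s - 0) * pd j (pd i f) ((x + p *\<^sub>R axis i 1) + q *\<^sub>R axis j 1)"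
    by blast
  have "?G' p = ?H s - ?H 0" by (simp add: algebra_simps)
  then have "?G s - ?G 0 = s * s * pd j (pd i f) (x + p *\<^sub>R axis i 1 + q *\<^sub>R axis j 1)"
    using p(3) q(3) by simp
  moreover have "?G s - ?G 0 = f (x + s *\<^sub>R axis i 1 + s *\<^sub>R axis j 1) - f (x + s *\<^sub>R axis i 1) - f
      (x + s *\<^sub>R axis j 1) + f x"
    by (simp add: algebra_simps)
  ultimately show ?thesis using p q that[of p q] by simp
qed

text \<open>Symmetry of second derivatives. The second difference over a small square is symmetric in
  \<open>i\<close> and \<open>j\<close>, so a value of \<open>pd j (pd i f)\<close> at one nearby point equals a value of
  \<open>pd i (pd j f)\<close> at another; continuity moves both to \<open>x\<close>.\<close>

lemma pd_commute_real:
  fixes f :: "real^4 \<Rightarrow> real"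
  assumes U: "open U" "x \<in> U"
    and f: "\<And>y. y \<in> U \<Longrightarrow> f differentiable at y"
    and f': "\<And>k y. y \<in> U \<Longrightarrow> pd k f differentiable at y"
    and c: "\<And>k l. continuous_on U (pd k (pd l f))"
  shows "pd i (pd j f) x = pd j (pd i f) x"
proof -
  have "\<bar>pd i (pd j f) x - pd j (pd i f) x\<bar> \<le> e" if e: "e > 0" for e :: real
  proof -
    have *: "\<exists>d>0. \<forall>y. dist y x < d \<longrightarrow> y \<in> U \<and> \<bar>pd k (pd l f) y - pd k (pd l f) x\<bar> < e/2" for k l
    proof -
      obtain d1 where d1: "d1 > 0" "ball x d1 \<subseteq> U" using U open_contains_ball by blast
      have "isCont (pd k (pd l f)) x" using c U continuous_on_eq_continuous_at by blast
      then obtain d2 where d2: "d2 > 0" "\<And>y. dist y x < d2 \<Longrightarrow> dist (pd k (pd l f) y) (pd k (pd l f)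
          x) < e/2"
        unfolding continuous_at_eps_delta using e by (meson half_gt_zero)
      have "\<forall>y. dist y x < min d1 d2 \<longrightarrow> y \<in> U \<and> \<bar>pd k (pd l f) y - pd k (pd l f) x\<bar> < e/2"
        using d1 d2 by (auto simp: subset_iff dist_commute dist_real_def)
      then show ?thesis using d1(1) d2(1) by (metis min_less_iff_conj)
    qed
    obtain d1 where d1: "d1 > 0" "\<And>y. dist y x < d1 \<Longrightarrow> y \<in> U \<and> \<bar>pd i (pd j f) y - pd i (pd j f) x\<bar> < e/2"
      using *[of i j] by blast
    obtain d2 where d2: "d2 > 0" "\<And>y. dist y x < d2 \<Longrightarrow> y \<in> U \<and> \<bar>pd j (pd i f) y - pd j (pd i f) x\<bar> < e/2"
      using *[of j i] by blast
    \<comment> \<open>A square of side \<open>s\<close> has diameter at most \<open>2 * s\<close>, which must stay below both radii.\<close>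
    define s where "s = min d1 d2 / 4"
    have s: "s > 0" using d1 d2 by (simp add: s_def)
    have near: "dist (x + p *\<^sub>R axis k 1 + q *\<^sub>R axis l 1) x < min d1 d2"
      if "0 \<le> p" "p \<le> s" "0 \<le> q" "q \<le> s" for p q and k l :: 4
    proof -
      have "dist (x + p *\<^sub>R axis k 1 + q *\<^sub>R axis l 1) x = norm (p *\<^sub>R axis k 1 + q *\<^sub>R (axis l 1 ::
          real^4))"
        by (simp add: dist_norm)
      also have "\<dots> \<le> p + q" using norm_triangle_ineq[of "p *\<^sub>R axis k 1" "q *\<^sub>R (axis l 1 ::
          real^4)"] that
        by (simp add: norm_axis_1)
      also have "\<dots> < min d1 d2" using that s by (simp add: s_def)
      finally show ?thesis .
    qed
    have inU: "x + p *\<^sub>R axis k 1 + q *\<^sub>R axis l 1 \<in> U"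
      if "0 \<le> p" "p \<le> s" "0 \<le> q" "q \<le> s" for p q and k l :: 4
      using d1(2) near[OF that] by simp
    obtain p q where pq: "0 \<le> p" "p \<le> s" "0 \<le> q" "q \<le> s"
      "f (x + s *\<^sub>R axis i 1 + s *\<^sub>R axis j 1) - f (x + s *\<^sub>R axis i 1) - f (x + s *\<^sub>R axis j 1) + f x
        = s * s * pd j (pd i f) (x + p *\<^sub>R axis i 1 + q *\<^sub>R axis j 1)"
      using double_mean_value[OF s inU f f', of i j] by blast
    obtain p' q' where pq': "0 \<le> p'" "p' \<le> s" "0 \<le> q'" "q' \<le> s"
      "f (x + s *\<^sub>R axis j 1 + s *\<^sub>R axis i 1) - f (x + s *\<^sub>R axis j 1) - f (x + s *\<^sub>R axis i 1) + f x
        = s * s * pd i (pd j f) (x + p' *\<^sub>R axis j 1 + q' *\<^sub>R axis i 1)"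
      using double_mean_value[OF s inU f f', of j i] by blast
    have "s * s * pd j (pd i f) (x + p *\<^sub>R axis i 1 + q *\<^sub>R axis j 1)
        = s * s * pd i (pd j f) (x + p' *\<^sub>R axis j 1 + q' *\<^sub>R axis i 1)"
      using pq(5) pq'(5) add.commute[of "s *\<^sub>R axis j 1" "s *\<^sub>R axis i 1 :: real^4"]
      by (simp only: add.assoc)
    then have eq: "pd j (pd i f) (x + p *\<^sub>R axis i 1 + q *\<^sub>R axis j 1)
        = pd i (pd j f) (x + p' *\<^sub>R axis j 1 + q' *\<^sub>R axis i 1)"
      using s by simp
    have "\<bar>pd j (pd i f) (x + p *\<^sub>R axis i 1 + q *\<^sub>R axis j 1) - pd j (pd i f) x\<bar> < e/2"
      using d2(2) near[OF pq(1-4)] by simp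
    moreover have "\<bar>pd i (pd j f) (x + p' *\<^sub>R axis j 1 + q' *\<^sub>R axis i 1) - pd i (pd j f) x\<bar> < e/2"
      using d1(2) near[OF pq'(1-4)] by simp
    ultimately show ?thesis using eq by linarith
  qed
  then have "\<bar>pd i (pd j f) x - pd j (pd i f) x\<bar> \<le> 0"
    by (meson dense_ge)
  then show ?thesis by simp
qed

lemma pd_eqI: "(f has_derivative D) (at x) \<Longrightarrow> pd i f x = D (axis i 1)"
  unfolding pd_def by (metis frechet_derivative_at)

lemma has_derivative_pd: "f differentiable at x \<Longrightarrow> (f has_derivative frechet_derivative f (at x)) (at x)"
  using frechet_derivative_works by blast

lemma pd_const [simp]: "pd i (\<lambda>_. c) x = 0"
  by (simp add: pd_def)

lemma pd_add:
  assumes "f differentiable at x" "g differentiable at x"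
  shows "pd i (\<lambda>y. f y + g y) x = pd i f x + pd i g x"
  using pd_eqI[OF has_derivative_add[OF assms[THEN has_derivative_pd]]] by (simp add: pd_def)

lemma pd_minus:
  assumes "f differentiable at x"
  shows "pd i (\<lambda>y. - f y) x = - pd i f x"
  using pd_eqI[OF has_derivative_minus[OF assms[THEN has_derivative_pd]]] by (simp add: pd_def)

lemma pd_linear:
  assumes "bounded_linear L" "f differentiable at x"
  shows "pd i (\<lambda>y. L (f y)) x = L (pd i f x)"
  using pd_eqI[OF bounded_linear.has_derivative[OF assms(1) has_derivative_pd[OF assms(2)]]] by
      (simp add: pd_def)

lemma pd_bilinear:
  assumes "bounded_bilinear m" "f differentiable at x" "g differentiable at x"
  shows "pd i (\<lambda>y. m (f y) (g y)) x = m (f x) (pd i g x) + m (pd i f x) (g x)"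
  using pd_eqI[OF bounded_bilinear.FDERIV[OF assms(1) assms(2,3)[THEN has_derivative_pd]]] by
      (simp add: pd_def)

lemma pd_cong:
  assumes "f differentiable at x" "open U" "x \<in> U" "\<And>y. y \<in> U \<Longrightarrow> f y = g y"
  shows "pd i f x = pd i g x"
  unfolding pd_def using frechet_derivative_transform_within_open[OF assms] by simp

lemma differentiable_cong_open:
  assumes "f differentiable at x" "open U" "x \<in> U" "\<And>y. y \<in> U \<Longrightarrow> f y = g y"
  shows "g differentiable at x"
  using has_derivative_transform_within_open[OF has_derivative_pd[OF assms(1)] assms(2-4)]
  by (rule differentiableI)

lemma differentiable_linear:
  assumes "bounded_linear L" "f differentiable at x"
  shows "(\<lambda>y. L (f y)) differentiable at x"
  using bounded_linear.has_derivative[OF assms(1) has_derivative_pd[OF assms(2)]] by (rule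
      differentiableI)

lemma differentiable_bilinear:
  assumes "bounded_bilinear m" "f differentiable at x" "g differentiable at x"
  shows "(\<lambda>y. m (f y) (g y)) differentiable at x"
  using bounded_bilinear.FDERIV[OF assms(1) assms(2,3)[THEN has_derivative_pd]] by (rule
      differentiableI)

section \<open>Differentiation of matrix-valued functions\<close>

lemma bounded_bilinear_matrix_mult: "bounded_bilinear ((**) :: real^4^4 \<Rightarrow> real^4^4 \<Rightarrow> real^4^4)"
  unfolding bilinear_conv_bounded_bilinear[symmetric]
  by (auto simp: bilinear_def matrix_matrix_mult_def vec_eq_iff algebra_simps sum.distrib
      sum_distrib_left intro!: linearI)

lemma bounded_linear_entry: "bounded_linear (\<lambda>A::real^4^4. A $ i $ j)"
  using bounded_linear_compose[OF bounded_linear_vec_nth bounded_linear_vec_nth] .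

lemma bounded_linear_transpose: "bounded_linear (transpose :: real^4^4 \<Rightarrow> real^4^4)"
  unfolding linear_conv_bounded_linear[symmetric]
  by (rule linearI) (simp_all add: transpose_def vec_eq_iff)

lemma bounded_linear_mult_vector: "bounded_linear (\<lambda>A::real^4^4. A *v v)"
  unfolding linear_conv_bounded_linear[symmetric]
  by (rule linearI) (simp_all add: matrix_vector_mult_add_rdistrib scaleR_matrix_vector_assoc)

lemma differentiable_matrixI:
  fixes f :: "real^4 \<Rightarrow> real^4^4"
  assumes "\<And>i j. (\<lambda>y. f y $ i $ j) differentiable at x"
  shows "f differentiable at x"
proof -
  have "bounded_linear (\<lambda>t. t *\<^sub>R axis i (axis j 1 :: real^4))" for i j :: 4
    by (simp add: bounded_linear_scaleR_left)
  then have "(\<lambda>y. (f y $ i $ j) *\<^sub>R axis i (axis j 1 :: real^4)) differentiable at x" for i j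
    using assms differentiable_linear by blast
  then have "(\<lambda>y. \<Sum>i\<in>UNIV. \<Sum>j\<in>UNIV. (f y $ i $ j) *\<^sub>R axis i (axis j 1 :: real^4)) differentiable at x"
    by (intro differentiable_sum) auto
  moreover have "(\<lambda>y. \<Sum>i\<in>UNIV. \<Sum>j\<in>UNIV. (f y $ i $ j) *\<^sub>R axis i (axis j 1 :: real^4)) = f"
    by (simp add: fun_eq_iff vec_eq_iff axis_def forall_4 sum_4)
  ultimately show ?thesis by simp
qed

lemma matrix_inv_both:
  fixes A :: "real^'n^'n"
  assumes "invertible A" shows "A ** matrix_inv A = mat 1" "matrix_inv A ** A = mat 1"
  using someI_ex[OF assms[unfolded invertible_def]] by (auto simp: matrix_inv_def)

text \<open>Cramer's rule writes the entries of the inverse as quotients of determinants, which is how the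
  inverse metric and hence the Christoffel symbols are seen to be differentiable.\<close>

lemma matrix_inv_cramer:
  fixes A :: "real^'n^'n"
  assumes "det A \<noteq> 0"
  shows "matrix_inv A $ k $ l = det (\<chi> i j. if j = k then axis l 1 $ i else A $ i $ j) / det A"
proof -
  have "A *v (matrix_inv A *v axis l 1) = axis l 1"
    using matrix_inv_both(1)[of A] assms by (simp add: matrix_vector_mul_assoc invertible_det_nz)
  then have "matrix_inv A *v axis l 1 = (\<chi> k. det (\<chi> i j. if j = k then axis l 1 $ i else A $ i $
      j) / det A)"
    by (rule iffD1[OF cramer[OF assms]])
  then have "(matrix_inv A *v axis l 1) $ k = det (\<chi> i j. if j = k then axis l 1 $ i else A $ i $
      j) / det A"
    by simp
  then show ?thesis by (simp add: matrix_vector_mult_basis column_def)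
qed

lemma differentiable_det:
  fixes f :: "real^4 \<Rightarrow> real^4^4"
  assumes "\<And>i j. (\<lambda>y. f y $ i $ j) differentiable at x"
  shows "(\<lambda>y. det (f y)) differentiable at x"
proof -
  have "(\<lambda>y. \<Prod>i\<in>UNIV. f y $ i $ p i) differentiable at x" for p
    by (rule differentiableI, rule has_derivative_prod, rule has_derivative_pd, rule assms)
  then show ?thesis unfolding det_def by (intro differentiable_sum differentiable_mult) auto
qed

lemma differentiable_matrix_inv:
  fixes f :: "real^4 \<Rightarrow> real^4^4"
  assumes f: "f differentiable at x" and U: "open U" "x \<in> U" "\<And>y. y \<in> U \<Longrightarrow> det (f y) \<noteq> 0"
  shows "(\<lambda>y. matrix_inv (f y)) differentiable at x"
proof (rule differentiable_matrixI)
  fix k l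
  have e: "(\<lambda>y. f y $ i $ j) differentiable at x" for i j
    by (rule differentiable_linear[OF bounded_linear_entry f])
  have "(\<lambda>y. det (\<chi> i j. if j = k then axis l 1 $ i else f y $ i $ j) / det (f y)) differentiable at x"
  proof (rule differentiable_divide)
    show "(\<lambda>y. det (\<chi> i j. if j = k then axis l 1 $ i else f y $ i $ j)) differentiable at x"
    proof (rule differentiable_det)
      fix i j show "(\<lambda>y. (\<chi> i j. if j = k then axis l 1 $ i else f y $ i $ j) $ i $ j)
          differentiable at x"
        using e by (cases "j = k") auto
    qed
    show "(\<lambda>y. det (f y)) differentiable at x" by (rule differentiable_det[OF e])
  qed (use U in auto)
  then show "(\<lambda>y. matrix_inv (f y) $ k $ l) differentiable at x"
    by (rule differentiable_cong_open[OF _ U(1,2)]) (simp add: matrix_inv_cramer U(3))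
qed

text \<open>Together these rules bring polynomial expressions in matrices to a normal form.\<close>

lemma matrix_mult_distribs:
  fixes A B C :: "real^'n^'n"
  shows "A ** (B + C) = A ** B + A ** C" "(A + B) ** C = A ** C + B ** C"
    "A ** (B - C) = A ** B - A ** C" "(A - B) ** C = A ** C - B ** C"
    "A ** (- B) = - (A ** B)" "(- A) ** B = - (A ** B)"
    "A ** (c *\<^sub>R B) = c *\<^sub>R (A ** B)" "(c *\<^sub>R A) ** B = c *\<^sub>R (A ** B)"
    "A ** 0 = 0" "0 ** A = 0"
  by (simp_all add: vec_eq_iff matrix_matrix_mult_def sum_negf sum_subtractf sum.distrib
      sum_distrib_left algebra_simps)

lemma transpose_distribs:
  fixes A B :: "real^'n^'n"
  shows "transpose (A + B) = transpose A + transpose B" "transpose (A - B) = transpose A - transpose B"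
    "transpose (- A) = - transpose A" "transpose (c *\<^sub>R A) = c *\<^sub>R transpose A"
    "transpose (A ** B) = transpose B ** transpose A" "transpose (0 :: real^'n^'n) = 0"
  by (simp_all add: vec_eq_iff transpose_def matrix_matrix_mult_def algebra_simps)

lemmas matrix_ring = matrix_mult_distribs transpose_distribs matrix_mul_assoc

section \<open>Symmetries of the Riemann tensor\<close>

lemma metric_matrix_invertible:
  assumes "metric_matrix h" shows "invertible h"
proof -
  have "inj ((*v) h)"
    unfolding linear_injective_0[OF matrix_vector_mul_linear]
    using assms by (auto simp: metric_matrix_def)
  then show ?thesis
    using invertible_left_inverse matrix_left_invertible_injective by blast
qed

text \<open>The Christoffel symbols of the first kind, \<open>\<Gamma>\<^sub>n\<^sub>,\<^sub>k\<^sub>i\<close>; metric compatibility and the absence of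
  torsion are visible on them before an index is raised.\<close>

definition christoffel1 :: "metric_field \<Rightarrow> 4 \<Rightarrow> real^4 \<Rightarrow> real^4^4" where
  "christoffel1 g k x = (\<chi> n i. (1/2) * (pd k g x $ n $ i + pd i g x $ n $ k - pd n g x $ k $ i))"

lemma christoffel_raise: "christoffel g x k = matrix_inv (g x) ** christoffel1 g k x"
  by (simp add: christoffel_def christoffel1_def matrix_matrix_mult_def vec_eq_iff
      sum_distrib_left algebra_simps)

text \<open>A metric in the coordinates of one chart.\<close>

locale local_metric =
  fixes g :: metric_field and U :: "(real^4) set"
  assumes open_U: "open U" and smooth: "smooth_on g U"
    and metric: "y \<in> U \<Longrightarrow> metric_matrix (g y)"
begin

lemma metric_Ck: "Ck_on n g U" using smooth by (simp add: smooth_on_def)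

lemma metric_differentiable: "y \<in> U \<Longrightarrow> g differentiable at y"
  using metric_Ck[of 1] open_U by (simp add: differentiable_on_eq_differentiable_at)

lemma pd_metric_differentiable: "y \<in> U \<Longrightarrow> pd k g differentiable at y"
  using metric_Ck[of 2] open_U by (simp add: differentiable_on_eq_differentiable_at numeral_2_eq_2)

lemma continuous_pd_pd_metric: "continuous_on U (pd k (pd l g))"
  using metric_Ck[of 2] by (simp add: numeral_2_eq_2)

lemma pd_entry: "y \<in> U \<Longrightarrow> pd k (\<lambda>z. g z $ a $ b) y = pd k g y $ a $ b"
  by (rule pd_linear[OF bounded_linear_entry metric_differentiable])

lemma pd_pd_entry:
  assumes "y \<in> U" shows "pd l (pd k (\<lambda>z. g z $ a $ b)) y = pd l (pd k g) y $ a $ b"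
proof -
  have "(\<lambda>z. pd k g z $ a $ b) differentiable at y"
    by (rule differentiable_linear[OF bounded_linear_entry pd_metric_differentiable[OF assms]])
  from pd_cong[OF this open_U assms, of "pd k (\<lambda>z. g z $ a $ b)" l] pd_entry
  show ?thesis by (simp add: pd_linear[OF bounded_linear_entry pd_metric_differentiable[OF assms]])
qed

lemma pd_pd_commute:
  assumes x: "x \<in> U" shows "pd l (pd k g) x = pd k (pd l g) x"
proof -
  have "pd l (pd k (\<lambda>z. g z $ a $ b)) x = pd k (pd l (\<lambda>z. g z $ a $ b)) x" for a b
  proof (rule pd_commute_real[OF open_U x])
    fix y assume y: "y \<in> U"
    show "(\<lambda>z. g z $ a $ b) differentiable at y"
      by (rule differentiable_linear[OF bounded_linear_entry metric_differentiable[OF y]])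
    show "pd k (\<lambda>z. g z $ a $ b) differentiable at y" for k
      by (rule differentiable_cong_open[OF differentiable_linear[OF bounded_linear_entry
          pd_metric_differentiable[OF y]] open_U y])
        (simp add: pd_entry)
  next
    fix k l
    have "continuous_on U (\<lambda>y. pd k (pd l g) y $ a $ b)"
      by (intro continuous_intros continuous_pd_pd_metric)
    then show "continuous_on U (pd k (pd l (\<lambda>z. g z $ a $ b)))"
      by (rule continuous_on_eq) (simp add: pd_pd_entry)
  qed
  then show ?thesis using x by (simp add: vec_eq_iff pd_pd_entry)
qed

lemma pd_sym:
  assumes "y \<in> U" shows "pd k g y $ b $ a = pd k g y $ a $ b"
proof -
  have "g z $ b $ a = g z $ a $ b" if "z \<in> U" for z
    using arg_cong[of _ _ "\<lambda>A. A $ a $ b", OF conjunct1[OF metric[OF that, unfolded metric_matrix_def]]]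
    by (simp add: transpose_def)
  then show ?thesis
    using pd_cong[OF differentiable_linear[OF bounded_linear_entry metric_differentiable[OF
        assms]] open_U assms, of b a "\<lambda>z. g z $ a $ b" k]
    by (simp add: pd_entry assms)
qed

lemma metric_invertible: "y \<in> U \<Longrightarrow> invertible (g y)"
  using metric metric_matrix_invertible by blast

lemma lower_christoffel: "y \<in> U \<Longrightarrow> g y ** christoffel g y k = christoffel1 g k y"
  by (simp add: christoffel_raise matrix_mul_assoc matrix_inv_both metric_invertible)

lemma christoffel_differentiable:
  assumes "y \<in> U" shows "(\<lambda>z. christoffel g z k) differentiable at y"
  unfolding christoffel_raise
proof (rule differentiable_bilinear[OF bounded_bilinear_matrix_mult])
  show "(\<lambda>z. matrix_inv (g z)) differentiable at y"
    by (rule differentiable_matrix_inv[OF metric_differentiable[OF assms] open_U assms]) (use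
        metric_invertible invertible_det_nz in blast)
  have e: "(\<lambda>z. pd a g z $ b $ c) differentiable at y" for a b c
    by (rule differentiable_linear[OF bounded_linear_entry pd_metric_differentiable[OF assms]])
  show "(\<lambda>z. christoffel1 g k z) differentiable at y"
    by (rule differentiable_matrixI) (auto simp: christoffel1_def intro!: differentiable_divide
        differentiable_diff differentiable_add e)
qed

lemma transpose_metric: "y \<in> U \<Longrightarrow> transpose (g y) = g y"
  using metric by (simp add: metric_matrix_def)

lemma metric_compatible:
  assumes "y \<in> U"
  shows "pd k g y = transpose (christoffel g y k) ** g y + g y ** christoffel g y k"
proof -
  have "transpose (christoffel g y k) ** g y = transpose (christoffel1 g k y)"
    using transpose_metric[OF assms] lower_christoffel[OF assms, of k] by (metis matrix_transpose_mul)
  then show ?thesis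
    unfolding lower_christoffel[OF assms]
    by (simp add: christoffel1_def vec_eq_iff transpose_def pd_sym[OF assms, of _ _ k] field_simps)
      (metis pd_sym[OF assms])
qed

lemma torsion_free:
  assumes "y \<in> U" shows "christoffel g y k *v axis i 1 = christoffel g y i *v axis k 1"
proof -
  have "christoffel1 g k y *v axis i 1 = christoffel1 g i y *v axis k 1"
    by (simp add: matrix_vector_mult_basis column_def christoffel1_def pd_sym[OF assms, of _ k i]
        algebra_simps)
  then show ?thesis by (simp add: christoffel_raise matrix_vector_mul_assoc[symmetric])
qed

abbreviation "\<Gamma> k y \<equiv> christoffel g y k"

text \<open>The usual \<open>R\<^sub>k\<^sub>l = \<partial>\<^sub>k \<Gamma>\<^sub>l - \<partial>\<^sub>l \<Gamma>\<^sub>k + [\<Gamma>\<^sub>k, \<Gamma>\<^sub>l]\<close>.\<close>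

lemma riemann_up_eq:
  assumes x: "x \<in> U"
  shows "riemann_up g x k l = pd k (\<Gamma> l) x - pd l (\<Gamma> k) x + \<Gamma> k x ** \<Gamma> l x - \<Gamma> l x ** \<Gamma> k x"
proof -
  have "cov_vector g k (cov_vector g l (\<lambda>_. axis j 1)) x = (pd k (\<Gamma> l) x + \<Gamma> k x ** \<Gamma> l x) *v axis
      j 1" for k l j
  proof -
    have "cov_vector g l (\<lambda>_. axis j 1) = (\<lambda>y. \<Gamma> l y *v axis j 1)"
      by (simp add: cov_vector_def fun_eq_iff)
    then show ?thesis
      by (simp add: cov_vector_def pd_linear[OF bounded_linear_mult_vector
          christoffel_differentiable[OF x]]
          matrix_vector_mult_add_rdistrib matrix_vector_mul_assoc)
  qed
  then show ?thesis
    by (simp add: riemann_up_def vec_eq_iff matrix_vector_mult_basis column_def)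
qed

text \<open>Two-forms carry the representation induced from tangent vectors, so the curvature acts on them
  by minus the derivation extending the transposed endomorphism.\<close>

lemma form_curvature_riemann_up:
  assumes x: "x \<in> U"
  shows "form_curvature g x k l \<omega> = - (transpose (riemann_up g x k l) ** \<omega> + \<omega> ** riemann_up g x k l)"
proof -
  let ?G = "\<lambda>l y. transpose (\<Gamma> l y) ** \<omega> + \<omega> ** \<Gamma> l y"
  have lin: "bounded_linear (\<lambda>A. transpose A ** \<omega> + \<omega> ** A)"
    by (intro bounded_linear_add bounded_linear_compose[OF _ bounded_linear_transpose]
       bounded_bilinear.bounded_linear_left[OF bounded_bilinear_matrix_mult]
       bounded_bilinear.bounded_linear_right[OF bounded_bilinear_matrix_mult])
  have d: "?G l differentiable at x" for l
    by (rule differentiable_linear[OF lin christoffel_differentiable[OF x]])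
  have "cov_form g k (cov_form g l (\<lambda>_. \<omega>)) x =
     - (transpose (pd k (\<Gamma> l) x) ** \<omega> + \<omega> ** pd k (\<Gamma> l) x) + (transpose (\<Gamma> k x) ** ?G l x + ?G l x
         ** \<Gamma> k x)" for k l
  proof -
    have "cov_form g l (\<lambda>_. \<omega>) = (\<lambda>y. - ?G l y)"
      by (simp add: cov_form_def fun_eq_iff)
    moreover have "pd k (\<lambda>y. - ?G l y) x = - (transpose (pd k (\<Gamma> l) x) ** \<omega> + \<omega> ** pd k (\<Gamma> l) x)"
      by (simp only: pd_minus[OF d] pd_linear[OF lin christoffel_differentiable[OF x]])
    ultimately have "cov_form g k (cov_form g l (\<lambda>_. \<omega>)) x =
      - (transpose (pd k (\<Gamma> l) x) ** \<omega> + \<omega> ** pd k (\<Gamma> l) x)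
      - (transpose (\<Gamma> k x) ** (- ?G l x) + (- ?G l x) ** \<Gamma> k x)"
      by (simp only: cov_form_def[of g k])
    then show ?thesis
      by (simp only: matrix_mult_distribs(5,6) minus_add_distrib[symmetric] diff_minus_eq_add)
  qed
  then show ?thesis
    by (simp add: form_curvature_def riemann_up_eq[OF x])
      (simp add: matrix_ring)
qed

text \<open>Differentiating \<open>\<partial>\<^sub>l g = \<Gamma>\<^sub>l\<^sup>T g + g \<Gamma>\<^sub>l\<close> in direction \<open>k\<close> and antisymmetrising: the left side
  vanishes because second derivatives of \<open>g\<close> commute, and the right side is
  \<open>R\<^sub>k\<^sub>l\<^sup>T g + g R\<^sub>k\<^sub>l\<close>.\<close>

lemma riemann_skew12:
  assumes x: "x \<in> U"
  shows "transpose (g x ** riemann_up g x k l) = - (g x ** riemann_up g x k l)"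
proof -
  note bb = bounded_bilinear_matrix_mult
  note dG = christoffel_differentiable[OF x] and dg = metric_differentiable[OF x]
  have dT: "(\<lambda>y. transpose (\<Gamma> l y)) differentiable at x" for l
    by (rule differentiable_linear[OF bounded_linear_transpose dG])
  have "pd k (pd l g) x = transpose (\<Gamma> l x) ** pd k g x + transpose (pd k (\<Gamma> l) x) ** g x
       + (g x ** pd k (\<Gamma> l) x + pd k g x ** \<Gamma> l x)" for k l
  proof -
    have "pd k (pd l g) x = pd k (\<lambda>y. transpose (\<Gamma> l y) ** g y + g y ** \<Gamma> l y) x"
      by (rule pd_cong[OF pd_metric_differentiable[OF x] open_U x]) (rule metric_compatible)
    also have "\<dots> = pd k (\<lambda>y. transpose (\<Gamma> l y) ** g y) x + pd k (\<lambda>y. g y ** \<Gamma> l y) x"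
      by (rule pd_add) (intro differentiable_bilinear[OF bb] dT dg dG)+
    finally show ?thesis
      by (simp add: pd_bilinear[OF bb dT dg] pd_bilinear[OF bb dg dG] pd_linear[OF
          bounded_linear_transpose dG])
  qed
  from this[of k l] this[of l k] pd_pd_commute[OF x, of k l]
  have "transpose (\<Gamma> l x) ** pd k g x + transpose (pd k (\<Gamma> l) x) ** g x + (g x ** pd k (\<Gamma> l) x +
      pd k g x ** \<Gamma> l x)
     = transpose (\<Gamma> k x) ** pd l g x + transpose (pd l (\<Gamma> k) x) ** g x + (g x ** pd l (\<Gamma> k) x + pd
         l g x ** \<Gamma> k x)"
    by simp
  then have "transpose (riemann_up g x k l) ** g x + g x ** riemann_up g x k l = 0"
    unfolding riemann_up_eq[OF x] metric_compatible[OF x]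
    by (simp add: matrix_ring algebra_simps)
  then show ?thesis using transpose_metric[OF x] by (simp add: matrix_transpose_mul eq_neg_iff_add_eq_0)
qed

text \<open>Each term of the cyclic sum cancels against another one after \<open>\<Gamma>\<^sub>k \<partial>\<^sub>i = \<Gamma>\<^sub>i \<partial>\<^sub>k\<close> is used,
  both for \<open>\<Gamma>\<close> and for its derivatives.\<close>

lemma bianchi:
  assumes x: "x \<in> U"
  shows "riemann_up g x k l *v axis j 1 + riemann_up g x l j *v axis k 1 + riemann_up g x j k *v
      axis l 1 = 0"
proof -
  have *: "pd k (\<Gamma> l) x *v axis j 1 = pd k (\<Gamma> j) x *v axis l 1" for k l j
  proof -
    have "pd k (\<lambda>y. \<Gamma> l y *v axis j 1) x = pd k (\<lambda>y. \<Gamma> j y *v axis l 1) x"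
      by (rule pd_cong[OF differentiable_linear[OF bounded_linear_mult_vector
          christoffel_differentiable[OF x]] open_U x])
        (rule torsion_free)
    then show ?thesis
      by (simp add: pd_linear[OF bounded_linear_mult_vector christoffel_differentiable[OF x]])
  qed
  show ?thesis
    unfolding riemann_up_eq[OF x]
    by (simp add: matrix_vector_mult_add_rdistrib matrix_vector_mult_diff_rdistrib
        matrix_vector_mul_assoc[symmetric]
       torsion_free[OF x, of l j] torsion_free[OF x, of k j] torsion_free[OF x, of k l]
       *[of k l j] *[of l k j] *[of j k l])
qed

end

section \<open>Two-forms and the Clifford relations\<close>

lemma forms2_iff: "\<omega> \<in> forms2 \<longleftrightarrow> (\<forall>i j. \<omega> $ j $ i = - \<omega> $ i $ j)"
  by (simp add: forms2_def vec_eq_iff transpose_def)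

lemma forms2_lower:
  assumes "\<omega> \<in> forms2"
  shows "\<omega> $ 2 $ 1 = - \<omega> $ 1 $ 2" "\<omega> $ 3 $ 1 = - \<omega> $ 1 $ 3" "\<omega> $ 4 $ 1 = - \<omega> $ 1 $ 4"
    "\<omega> $ 3 $ 2 = - \<omega> $ 2 $ 3" "\<omega> $ 4 $ 2 = - \<omega> $ 2 $ 4" "\<omega> $ 4 $ 3 = - \<omega> $ 3 $ 4" "\<omega> $ i $ i = 0"
proof -
  have *: "\<omega> $ j $ i = - \<omega> $ i $ j" for i j
    using assms unfolding forms2_iff by blast
  show "\<omega> $ 2 $ 1 = - \<omega> $ 1 $ 2" "\<omega> $ 3 $ 1 = - \<omega> $ 1 $ 3" "\<omega> $ 4 $ 1 = - \<omega> $ 1 $ 4"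
    "\<omega> $ 3 $ 2 = - \<omega> $ 2 $ 3" "\<omega> $ 4 $ 2 = - \<omega> $ 2 $ 4" "\<omega> $ 4 $ 3 = - \<omega> $ 3 $ 4"
    by (rule *)+
  show "\<omega> $ i $ i = 0" using *[of i i] by simp
qed

lemma subspace_forms2: "subspace forms2"
  by (simp add: subspace_def forms2_def transpose_distribs)

lemma wedge11_forms2: "wedge11 a b \<in> forms2"
  by (simp add: forms2_iff wedge11_def)

text \<open>The matrix for which \<open>wedge22 \<omega> \<eta>\<close> is the Euclidean pairing of \<open>wedge_dual \<omega>\<close> with \<open>\<eta>\<close>. It
  is the Hodge star of the Euclidean metric, but it is used here for arbitrary metrics: it needs
  only the volume form \<open>dx\<^sub>1 \<and> dx\<^sub>2 \<and> dx\<^sub>3 \<and> dx\<^sub>4\<close> and maps two-forms to bivectors.\<close>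

definition wedge_dual :: "real^4^4 \<Rightarrow> real^4^4" where
  "wedge_dual \<omega> = (\<chi> i j. wedge22 \<omega> (wedge11 (axis i 1) (axis j 1)))"

lemma wedge_dual_nth:
  "wedge_dual \<omega> $ 1 $ 2 = \<omega> $ 3 $ 4" "wedge_dual \<omega> $ 1 $ 3 = - \<omega> $ 2 $ 4" "wedge_dual \<omega> $ 1 $ 4 =
      \<omega> $ 2 $ 3"
  "wedge_dual \<omega> $ 2 $ 3 = \<omega> $ 1 $ 4" "wedge_dual \<omega> $ 2 $ 4 = - \<omega> $ 1 $ 3" "wedge_dual \<omega> $ 3 $ 4 =
      \<omega> $ 1 $ 2"
  by (simp_all add: wedge_dual_def wedge22_def wedge11_def axis_def)

lemma wedge22_linear [simp]:
  "wedge22 (a + b) c = wedge22 a c + wedge22 b c" "wedge22 c (a + b) = wedge22 c a + wedge22 c b"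
  "wedge22 (r *\<^sub>R a) c = r * wedge22 a c" "wedge22 c (r *\<^sub>R a) = r * wedge22 c a"
  "wedge22 (- a) c = - wedge22 a c" "wedge22 c (- a) = - wedge22 c a"
  "wedge22 0 c = 0" "wedge22 c 0 = 0"
  by (simp_all add: wedge22_def algebra_simps)

lemma wedge22_commute: "wedge22 a b = wedge22 b a"
  by (simp add: wedge22_def)

lemma wedge_dual_linear [simp]:
  "wedge_dual (a + b) = wedge_dual a + wedge_dual b" "wedge_dual (r *\<^sub>R a) = r *\<^sub>R wedge_dual a"
  "wedge_dual (- a) = - wedge_dual a" "wedge_dual 0 = 0"
  by (simp_all add: wedge_dual_def vec_eq_iff)

lemma wedge_dual_forms2: "wedge_dual \<omega> \<in> forms2"
  unfolding forms2_iff wedge_dual_def by (simp add: wedge22_def wedge11_def algebra_simps)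

lemma wedge22_eq_sum:
  assumes "\<eta> \<in> forms2"
  shows "wedge22 \<eta> \<omega> = (1/2) * (\<Sum>k\<in>UNIV. \<Sum>l\<in>UNIV. wedge_dual \<omega> $ k $ l * \<eta> $ k $ l)"
  by (simp add: sum_4 wedge22_def wedge_dual_nth forms2_lower[OF assms] forms2_lower[OF
      wedge_dual_forms2])

text \<open>A two-form \<open>\<omega>\<close> and its dual act like a pair of half-spin Clifford multiplications for the
  quadratic form \<open>wedge22\<close> of signature \<open>(3, 3)\<close>. For \<open>\<eta> = \<omega>\<close> this says that the dual is, up to
  minus the Pfaffian, the inverse matrix.\<close>

lemma clifford:
  assumes "\<omega> \<in> forms2" "\<eta> \<in> forms2"
  shows "\<omega> ** wedge_dual \<eta> + \<eta> ** wedge_dual \<omega> = - wedge22 \<omega> \<eta> *\<^sub>R mat 1"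
  by (simp add: vec_eq_iff forall_4 matrix_matrix_mult_def sum_4 mat_def wedge_dual_nth wedge22_def
    forms2_lower[OF assms(1)] forms2_lower[OF assms(2)] forms2_lower[OF wedge_dual_forms2])

lemma forms2_transpose: "\<omega> \<in> forms2 \<Longrightarrow> transpose \<omega> = - \<omega>"
  by (simp add: forms2_def)

lemma clifford_dual:
  assumes "\<omega> \<in> forms2" "\<eta> \<in> forms2"
  shows "wedge_dual \<omega> ** \<eta> + wedge_dual \<eta> ** \<omega> = - wedge22 \<omega> \<eta> *\<^sub>R mat 1"
  using arg_cong[OF clifford[OF assms], of transpose]
  by (simp add: transpose_distribs forms2_transpose assms wedge_dual_forms2 matrix_mult_distribs
      add.commute)

lemma clifford_square:
  assumes "\<omega> \<in> forms2"
  shows "\<omega> ** wedge_dual \<omega> = - (wedge22 \<omega> \<omega> / 2) *\<^sub>R mat 1" "wedge_dual \<omega> ** \<omega> = - (wedge22 \<omega> \<omega> /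
      2) *\<^sub>R mat 1"
proof -
  have half: "A = (r / 2) *\<^sub>R B" if "A + A = r *\<^sub>R B" for A B :: "real^4^4" and r
    using arg_cong[OF that, of "\<lambda>C. (1/2) *\<^sub>R C"] by (simp only: scaleR_half_double) simp
  show "\<omega> ** wedge_dual \<omega> = - (wedge22 \<omega> \<omega> / 2) *\<^sub>R mat 1" "wedge_dual \<omega> ** \<omega> = - (wedge22 \<omega> \<omega> / 2)
      *\<^sub>R mat 1"
    using half[OF clifford[OF assms assms]] half[OF clifford_dual[OF assms assms]] by simp_all
qed

section \<open>Two-forms under change of coframe\<close>

lemma det_4:
  "det (A::'a::comm_ring_1^4^4) =
    A$1$1 * A$2$2 * A$3$3 * A$4$4 - A$1$1 * A$2$2 * A$3$4 * A$4$3 - A$1$1 * A$2$3 * A$3$2 * A$4$4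
  + A$1$1 * A$2$3 * A$3$4 * A$4$2 + A$1$1 * A$2$4 * A$3$2 * A$4$3 - A$1$1 * A$2$4 * A$3$3 * A$4$2
  - A$1$2 * A$2$1 * A$3$3 * A$4$4 + A$1$2 * A$2$1 * A$3$4 * A$4$3 + A$1$2 * A$2$3 * A$3$1 * A$4$4
  - A$1$2 * A$2$3 * A$3$4 * A$4$1 - A$1$2 * A$2$4 * A$3$1 * A$4$3 + A$1$2 * A$2$4 * A$3$3 * A$4$1
  + A$1$3 * A$2$1 * A$3$2 * A$4$4 - A$1$3 * A$2$1 * A$3$4 * A$4$2 - A$1$3 * A$2$2 * A$3$1 * A$4$4
  + A$1$3 * A$2$2 * A$3$4 * A$4$1 + A$1$3 * A$2$4 * A$3$1 * A$4$2 - A$1$3 * A$2$4 * A$3$2 * A$4$1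
  - A$1$4 * A$2$1 * A$3$2 * A$4$3 + A$1$4 * A$2$1 * A$3$3 * A$4$2 + A$1$4 * A$2$2 * A$3$1 * A$4$3
  - A$1$4 * A$2$2 * A$3$3 * A$4$1 - A$1$4 * A$2$3 * A$3$1 * A$4$2 + A$1$4 * A$2$3 * A$3$2 * A$4$1"
proof -
  have f1234: "finite {2::4, 3, 4}" "1 \<notin> {2::4, 3, 4}" by auto
  have f234: "finite {3::4, 4}" "2 \<notin> {3::4, 4}" by auto
  have f34: "finite {4::4}" "3 \<notin> {4::4}" by auto
  show ?thesis
    unfolding det_def UNIV_4
    unfolding sum_over_permutations_insert[OF f1234]
    unfolding sum_over_permutations_insert[OF f234]
    unfolding sum_over_permutations_insert[OF f34]
    unfolding permutes_sing
    by (simp add: sign_swap_id permutation_swap_id sign_compose sign_id swap_id_eq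
        permutation_compose transpose_def)
qed

text \<open>The rows of \<open>P\<close> are the new coframe.\<close>

lemma two_form_expand:
  assumes "\<omega> \<in> forms2"
  shows "transpose P ** \<omega> ** P =
    \<omega>$1$2 *\<^sub>R wedge11 (P$1) (P$2) + \<omega>$1$3 *\<^sub>R wedge11 (P$1) (P$3) + \<omega>$1$4 *\<^sub>R wedge11 (P$1) (P$4)
  + \<omega>$2$3 *\<^sub>R wedge11 (P$2) (P$3) + \<omega>$2$4 *\<^sub>R wedge11 (P$2) (P$4) + \<omega>$3$4 *\<^sub>R wedge11 (P$3) (P$4)"
  by (simp add: vec_eq_iff matrix_matrix_mult_def sum_4 wedge11_def
      Finite_Cartesian_Product.transpose_def
    forms2_lower[OF assms] algebra_simps)

lemma wedge22_decomposable_zero: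
  "wedge22 (wedge11 a b) (wedge11 a c) = 0" "wedge22 (wedge11 a b) (wedge11 c a) = 0"
  "wedge22 (wedge11 b a) (wedge11 a c) = 0" "wedge22 (wedge11 b a) (wedge11 c a) = 0"
  by (simp_all add: wedge22_def wedge11_def algebra_simps)

lemma wedge22_rows:
  "wedge22 (wedge11 (P$1) (P$2)) (wedge11 (P$3) (P$4)) = det P"
  "wedge22 (wedge11 (P$1) (P$3)) (wedge11 (P$2) (P$4)) = - det P"
  "wedge22 (wedge11 (P$1) (P$4)) (wedge11 (P$2) (P$3)) = det P"
  "wedge22 (wedge11 (P$2) (P$3)) (wedge11 (P$1) (P$4)) = det P"
  "wedge22 (wedge11 (P$2) (P$4)) (wedge11 (P$1) (P$3)) = - det P"
  "wedge22 (wedge11 (P$3) (P$4)) (wedge11 (P$1) (P$2)) = det P"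
  by (simp_all add: det_4 wedge22_def wedge11_def algebra_simps)

text \<open>A four-form is multiplied by the determinant under a change of coframe. By bilinearity it is
  enough to look at products of decomposable forms built from rows of \<open>P\<close>, which vanish when a
  row is repeated and are \<open>\<plusminus>det P\<close> otherwise.\<close>

lemma wedge22_congruence:
  assumes "\<omega> \<in> forms2" "\<eta> \<in> forms2"
  shows "wedge22 (transpose P ** \<omega> ** P) (transpose P ** \<eta> ** P) = det P * wedge22 \<omega> \<eta>"
  unfolding two_form_expand[OF assms(1)] two_form_expand[OF assms(2)]
  by (simp add: wedge22_rows wedge22_decomposable_zero) (simp add: wedge22_def algebra_simps)

section \<open>Orthonormal frames and self-duality\<close>

text \<open>Gram-Schmidt for the inner product \<open>h\<close>: the next vector is chosen Euclidean-orthogonal to the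
  vectors \<open>h *v v i\<close> found so far.\<close>

lemma orthonormal_vectors:
  assumes h: "metric_matrix h" and "k \<le> 4"
  shows "\<exists>v::nat \<Rightarrow> real^4. \<forall>i<k. \<forall>j<k. v i \<bullet> (h *v v j) = (if i = j then 1 else 0)"
  using \<open>k \<le> 4\<close>
proof (induction k)
  case (Suc k)
  then obtain v :: "nat \<Rightarrow> real^4" where v: "\<forall>i<k. \<forall>j<k. v i \<bullet> (h *v v j) = (if i = j then 1 else
      0)" by auto
  have sym: "a \<bullet> (h *v b) = b \<bullet> (h *v a)" for a b
    using h by (simp add: metric_matrix_def dot_lmul_matrix[symmetric] vector_transpose_matrix
        inner_commute)
      (metis dot_lmul_matrix inner_commute vector_transpose_matrix)
  have "dim ((\<lambda>i. h *v v i) ` {..<k}) \<le> card ((\<lambda>i. h *v v i) ` {..<k})"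
    by (rule dim_le_card') simp
  also have "\<dots> \<le> k" using card_image_le[of "{..<k}"] by simp
  finally obtain x where x: "x \<noteq> 0" "\<And>y. y \<in> span ((\<lambda>i. h *v v i) ` {..<k}) \<Longrightarrow> orthogonal x y"
    using orthogonal_to_subspace_exists[of "(\<lambda>i. h *v v i) ` {..<k}"] Suc.prems by auto
  have o: "x \<bullet> (h *v v i) = 0" if "i < k" for i
    using x(2)[of "h *v v i"] that by (auto simp: orthogonal_def intro: span_base)
  have pos: "x \<bullet> (h *v x) > 0" using h x(1) by (simp add: metric_matrix_def)
  define u where "u = (1 / sqrt (x \<bullet> (h *v x))) *\<^sub>R x"
  have "u \<bullet> (h *v u) = 1" using pos
    by (simp add: u_def matrix_vector_mult_scaleR real_sqrt_mult_self field_simps)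
  moreover have "u \<bullet> (h *v v i) = 0" "v i \<bullet> (h *v u) = 0" if "i < k" for i
    using o[OF that] sym[of x "v i"] by (simp_all add: u_def matrix_vector_mult_scaleR)
  ultimately have "\<forall>i<Suc k. \<forall>j<Suc k. (v(k:=u)) i \<bullet> (h *v (v(k:=u)) j) = (if i = j then 1 else 0)"
    using v by (auto simp: less_Suc_eq)
  then show ?case by blast
qed simp

lemma metric_eq_transpose_mult:
  assumes h: "metric_matrix h"
  obtains P :: "real^4^4" where "det P > 0" "h = transpose P ** P"
proof -
  obtain v :: "nat \<Rightarrow> real^4" where v: "\<forall>i<4. \<forall>j<4. v i \<bullet> (h *v v j) = (if i = j then 1 else 0)"
    using orthonormal_vectors[OF h order.refl] by blast
  define n :: "4 \<Rightarrow> nat" where "n i = (if i = 1 then 0 else if i = 2 then 1 else if i = 3 then 2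
      else 3)" for i
  have n: "n i < 4" "n i = n j \<longleftrightarrow> i = j" for i j
    using exhaust_4[of i] exhaust_4[of j] by (auto simp: n_def)
  define Q :: "real^4^4" where "Q = (\<chi> i j. v (n j) $ i)"
  have "(transpose Q ** (h ** Q)) $ i $ j = v (n i) \<bullet> (h *v v (n j))" for i j
    by (simp add: Q_def matrix_matrix_mult_def transpose_def inner_vec_def matrix_vector_mult_def)
  then have Q: "transpose Q ** (h ** Q) = mat 1"
    using v n by (simp add: vec_eq_iff mat_def)
  then have inv: "invertible Q"
    using invertible_right_inverse[of "transpose Q"] transpose_invertible by fastforce
  define R where "R = matrix_inv Q"
  have R: "Q ** R = mat 1" "R ** Q = mat 1" using matrix_inv_both[OF inv] by (simp_all add: R_def)
  have "transpose R ** (transpose Q ** (h ** Q)) ** R = transpose R ** R" by (simp add: Q)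
  moreover have "transpose R ** (transpose Q ** (h ** Q)) ** R = transpose (Q ** R) ** (h ** (Q ** R))"
    by (simp add: matrix_ring)
  ultimately have hR: "h = transpose R ** R" by (simp add: R)
  have dR: "det R \<noteq> 0" using R(1) by (metis det_I det_mul mult_zero_right zero_neq_one)
  \<comment> \<open>Reversing the first vector of the frame if necessary makes it positively oriented.\<close>
  define D :: "real^4^4" where "D = (\<chi> i j. if i = j then (if i = 1 then sgn (det R) else 1) else 0)"
  have "det D = sgn (det R)"
    by (simp add: D_def det_diagonal)
  moreover have "transpose D ** D = mat 1"
    using dR by (simp add: D_def vec_eq_iff forall_4 sum_4 matrix_matrix_mult_def transpose_def
        mat_def sgn_if)
  moreover have "transpose (D ** R) ** (D ** R) = transpose R ** (transpose D ** D) ** R"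
    by (simp add: transpose_distribs matrix_mul_assoc)
  ultimately show ?thesis using that[of "D ** R"] hR dR by (simp add: det_mul sgn_if)
qed

lemma det_metric_pos: "metric_matrix h \<Longrightarrow> det h > 0"
  by (erule metric_eq_transpose_mult) (simp add: det_mul)

lemma matrix_inverse_unique:
  fixes A B C :: "real^'n^'n"
  assumes "C ** A = mat 1" "A ** B = mat 1" shows "C = B"
proof -
  have "C = C ** (A ** B)" by (simp only: assms matrix_mul_rid)
  also have "\<dots> = (C ** A) ** B" by (rule matrix_mul_assoc)
  also have "\<dots> = B" by (simp only: assms matrix_mul_lid)
  finally show ?thesis .
qed

lemma metric_inverse:
  assumes "metric_matrix h"
  shows "h ** matrix_inv h = mat 1" "matrix_inv h ** h = mat 1" "transpose (matrix_inv h) =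
      matrix_inv h" "transpose h = h"
proof -
  show 1: "h ** matrix_inv h = mat 1" "matrix_inv h ** h = mat 1"
    using matrix_inv_both[OF metric_matrix_invertible[OF assms]] .
  show t: "transpose h = h" using assms by (simp add: metric_matrix_def)
  have "transpose (matrix_inv h) ** h = mat 1" using arg_cong[OF 1(1), of transpose] by (simp add:
      transpose_distribs t)
  then show "transpose (matrix_inv h) = matrix_inv h"
    by (rule matrix_inverse_unique[OF _ 1(1)])
qed

lemma metric_frame_inverse:
  assumes h: "metric_matrix h"
  obtains P Q :: "real^4^4" where "det P > 0" "h = transpose P ** P"
    "P ** Q = mat 1" "Q ** P = mat 1" "matrix_inv h = Q ** transpose Q"
proof -
  obtain P where P: "det P > 0" "h = transpose P ** P" using metric_eq_transpose_mult[OF h] by blast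
  then have "invertible P" by (simp add: invertible_det_nz)
  note inv = matrix_inv_both[OF this]
  define Q where "Q = matrix_inv P"
  have PQ: "P ** Q = mat 1" "Q ** P = mat 1" using inv by (simp_all add: Q_def)
  have "h ** (Q ** transpose Q) = transpose P ** (P ** Q) ** transpose Q" by (simp add: P
      matrix_mul_assoc)
  also have "\<dots> = transpose (Q ** P)" by (simp only: PQ(1) transpose_distribs matrix_mul_rid)
  finally have "h ** (Q ** transpose Q) = mat 1" by (simp add: PQ)
  then have "matrix_inv h = Q ** transpose Q" by (rule matrix_inverse_unique[OF
      metric_inverse(2)[OF h]])
  then show ?thesis using that P PQ by blast
qed

lemma raise2_eq: "metric_matrix h \<Longrightarrow> raise2 h \<omega> = matrix_inv h ** \<omega> ** matrix_inv h"
  by (simp add: raise2_def metric_inverse)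

lemma raise2_forms2: "\<omega> \<in> forms2 \<Longrightarrow> raise2 h \<omega> \<in> forms2"
  by (simp add: raise2_def forms2_def transpose_distribs matrix_mul_assoc matrix_mult_distribs)

lemma raise2_linear [simp]: "raise2 h (a + b) = raise2 h a + raise2 h b" "raise2 h (r *\<^sub>R a) = r *\<^sub>R
    raise2 h a"
  "raise2 h (- a) = - raise2 h a" "raise2 h (a - b) = raise2 h a - raise2 h b"  "raise2 h 0 = 0"
  by (simp_all add: raise2_def matrix_mult_distribs)

lemma form_inner_linear [simp]:
  "form_inner h (a + b) c = form_inner h a c + form_inner h b c" "form_inner h c (a + b) =
      form_inner h c a + form_inner h c b"
  "form_inner h (a - b) c = form_inner h a c - form_inner h b c" "form_inner h c (a - b) =
      form_inner h c a - form_inner h c b"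
  "form_inner h (r *\<^sub>R a) c = r * form_inner h a c" "form_inner h c (r *\<^sub>R a) = r * form_inner h c a"
  "form_inner h (- a) c = - form_inner h a c" "form_inner h c (- a) = - form_inner h c a"
  "form_inner h 0 c = 0" "form_inner h c 0 = 0"
  by (simp_all add: form_inner_def sum.distrib sum_subtractf sum_negf algebra_simps sum_distrib_left)

lemma form_inner_trace: "form_inner h \<omega> \<eta> = (1/2) * trace (raise2 h \<omega> ** transpose \<eta>)"
  by (simp add: form_inner_def trace_def matrix_matrix_mult_def transpose_def)

lemma form_inner_commute:
  assumes "metric_matrix h" shows "form_inner h \<omega> \<eta> = form_inner h \<eta> \<omega>"
proof -
  have "trace (raise2 h \<omega> ** transpose \<eta>) = trace (transpose (raise2 h \<omega> ** transpose \<eta>))"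
    by (simp add: trace_def transpose_def)
  also have "\<dots> = trace ((\<eta> ** matrix_inv h) ** (transpose \<omega> ** matrix_inv h))"
    by (simp add: raise2_eq assms transpose_distribs metric_inverse matrix_mul_assoc)
  also have "\<dots> = trace ((matrix_inv h ** \<eta> ** matrix_inv h) ** transpose \<omega>)"
    using trace_mul_sym[of "matrix_inv h" "\<eta> ** matrix_inv h ** transpose \<omega>"] by (simp add:
        matrix_mul_assoc)
  finally show ?thesis by (simp add: form_inner_trace raise2_eq assms)
qed

lemma form_inner_pos:
  assumes h: "metric_matrix h" and "\<omega> \<noteq> 0" shows "form_inner h \<omega> \<omega> > 0"
proof -
  obtain P Q :: "real^4^4" where PQ: "P ** Q = mat 1" "Q ** P = mat 1" and X: "matrix_inv h = Q **
      transpose Q"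
    by (rule metric_frame_inverse[OF h]) blast
  let ?e = "transpose Q ** \<omega> ** Q"
  have "trace (raise2 h \<omega> ** transpose \<omega>) = trace (Q ** (transpose Q ** \<omega> ** Q ** transpose Q **
      transpose \<omega>))"
    by (simp add: raise2_eq h X matrix_mul_assoc)
  also have "\<dots> = trace (?e ** transpose ?e)"
    by (subst trace_mul_sym) (simp add: transpose_distribs matrix_mul_assoc)
  also have "\<dots> = (\<Sum>i\<in>UNIV. \<Sum>j\<in>UNIV. (?e $ i $ j)\<^sup>2)"
    by (simp add: trace_def matrix_matrix_mult_def[of ?e] transpose_def[of ?e] power2_eq_square)
  finally have eq: "form_inner h \<omega> \<omega> = (1/2) * (\<Sum>i\<in>UNIV. \<Sum>j\<in>UNIV. (?e $ i $ j)\<^sup>2)"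
    by (simp add: form_inner_trace)
  have "transpose P ** ?e ** P = transpose (Q ** P) ** \<omega> ** (Q ** P)" by (simp add:
      transpose_distribs matrix_mul_assoc)
  then have "transpose P ** ?e ** P = \<omega>" by (simp add: PQ)
  then have "?e \<noteq> 0" using \<open>\<omega> \<noteq> 0\<close> by (auto simp: matrix_mult_distribs)
  then obtain i j where ij: "?e $ i $ j \<noteq> 0" by (auto simp: vec_eq_iff)
  have "0 < (\<Sum>j\<in>UNIV. (?e $ i $ j)\<^sup>2)"
    by (rule sum_pos2[of _ j]) (use ij in auto)
  then have "0 < (\<Sum>i\<in>UNIV. \<Sum>j\<in>UNIV. (?e $ i $ j)\<^sup>2)"
    by (intro sum_pos2[of UNIV i "\<lambda>i. \<Sum>j\<in>UNIV. (?e $ i $ j)\<^sup>2"] sum_nonneg) simp_all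
  then show ?thesis using eq by simp
qed

lemma subspace_self_dual: "subspace (self_dual \<sigma> h)"
  using subspace_forms2 by (auto simp: subspace_def self_dual_def algebra_simps)

lemma self_dual_forms2: "\<omega> \<in> self_dual \<sigma> h \<Longrightarrow> \<omega> \<in> forms2"
  by (simp add: self_dual_def)

text \<open>The condition defining self-duality pairs \<open>\<omega>\<close> with all two-forms; non-degeneracy of the
  Euclidean pairing turns it into an equation of matrices.\<close>

lemma self_dual_iff:
  assumes "\<omega> \<in> forms2" and h: "metric_matrix h"
  shows "\<omega> \<in> self_dual \<sigma> h \<longleftrightarrow> wedge_dual \<omega> = (\<sigma> * sqrt (det h)) *\<^sub>R raise2 h \<omega>"
proof -
  let ?d = "wedge_dual \<omega> - (\<sigma> * sqrt (det h)) *\<^sub>R raise2 h \<omega>"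
  have eq: "wedge22 \<eta> \<omega> - \<sigma> * sqrt (det h) * form_inner h \<eta> \<omega> = (1/2) * (\<Sum>k\<in>UNIV. \<Sum>l\<in>UNIV. ?d $ k
      $ l * \<eta> $ k $ l)"
    if "\<eta> \<in> forms2" for \<eta>
    unfolding form_inner_commute[OF h, of \<eta> \<omega>] unfolding wedge22_eq_sum[OF that] form_inner_def
    by (simp add: algebra_simps sum_subtractf sum_distrib_left)
  have d: "?d \<in> forms2"
    by (intro subspace_diff subspace_scale subspace_forms2 wedge_dual_forms2 raise2_forms2 assms)
  show ?thesis
  proof
    assume "\<omega> \<in> self_dual \<sigma> h"
    then have "(\<Sum>k\<in>UNIV. \<Sum>l\<in>UNIV. ?d $ k $ l * ?d $ k $ l) = 0"
      using eq[OF d] d by (simp add: self_dual_def)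
    then have "?d $ k $ l = 0" for k l
      by (simp add: sum_nonneg_eq_0_iff sum_nonneg)
    then have "?d = 0" by (simp only: vec_eq_iff zero_index) simp
    then show "wedge_dual \<omega> = (\<sigma> * sqrt (det h)) *\<^sub>R raise2 h \<omega>" by simp
  next
    assume "wedge_dual \<omega> = (\<sigma> * sqrt (det h)) *\<^sub>R raise2 h \<omega>"
    then show "\<omega> \<in> self_dual \<sigma> h"
      using eq assms(1) by (simp add: self_dual_def)
  qed
qed

lemma wedge22_self_dual:
  "\<omega> \<in> self_dual \<sigma> h \<Longrightarrow> \<eta> \<in> forms2 \<Longrightarrow> wedge22 \<eta> \<omega> = \<sigma> * sqrt (det h) * form_inner h \<eta> \<omega>"
  by (simp add: self_dual_def)

section \<open>Bases of three-dimensional spaces\<close>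

lemma representation_combination:
  fixes b :: "3 \<Rightarrow> 'v::real_vector"
  assumes "inj b" "independent (range b)"
  shows "representation (range b) (\<Sum>i\<in>UNIV. x i *\<^sub>R b i) (b j) = x j"
proof -
  have "representation (range b) (\<Sum>i\<in>UNIV. x i *\<^sub>R b i) (b j) = (\<Sum>i\<in>UNIV. representation (range b)
      (x i *\<^sub>R b i) (b j))"
    by (subst representation_sum[OF assms(2)]) (auto intro: span_base span_scale)
  also have "\<dots> = (\<Sum>i\<in>UNIV. if i = j then x i else 0)"
  proof (rule sum.cong[OF refl])
    fix i
    have "representation (range b) (x i *\<^sub>R b i) = (\<lambda>w. x i * representation (range b) (b i) w)"
      by (subst representation_scale[OF assms(2)]) (auto intro: span_base)
    then show "representation (range b) (x i *\<^sub>R b i) (b j) = (if i = j then x i else 0)"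
      using assms by (simp add: representation_basis inj_eq)
  qed
  finally show ?thesis by simp
qed

lemma basis3_representation:
  "basis3 V b \<Longrightarrow> representation (range b) (\<Sum>i\<in>UNIV. x i *\<^sub>R b i) (b j) = x j"
  by (rule representation_combination) (simp_all add: basis3_def)

lemma basis3_independent:
  assumes "basis3 V b" "(\<Sum>i\<in>UNIV. x i *\<^sub>R b i) = 0" shows "x j = 0"
  using basis3_representation[OF assms(1), of x j] by (simp add: assms(2) representation_zero)

lemma basis3_mem: "basis3 V b \<Longrightarrow> (\<Sum>i\<in>UNIV. x i *\<^sub>R b i) \<in> V"
  by (auto simp: basis3_def intro!: span_sum span_scale intro: span_base)

lemma basis3_expand:
  assumes "basis3 V b" "v \<in> V"
  obtains x where "v = (\<Sum>i\<in>UNIV. x i *\<^sub>R b i)"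
proof -
  have "v \<in> span (range b)" using assms by (simp add: basis3_def)
  then obtain u where "v = (\<Sum>w\<in>range b. u w *\<^sub>R w)" by (auto simp: span_finite)
  also have "\<dots> = (\<Sum>i\<in>UNIV. u (b i) *\<^sub>R b i)"
    using assms(1) by (simp add: basis3_def sum.reindex)
  finally show ?thesis by (rule that)
qed

lemma basis3_basis_mem: "basis3 V b \<Longrightarrow> b i \<in> V"
  by (auto simp: basis3_def intro: span_base)

lemma basis3_representation_expand:
  assumes "basis3 V b" "v \<in> V"
  shows "v = (\<Sum>i\<in>UNIV. representation (range b) v (b i) *\<^sub>R b i)"
proof -
  obtain x where x: "v = (\<Sum>i\<in>UNIV. x i *\<^sub>R b i)" by (rule basis3_expand[OF assms])
  then show ?thesis using basis3_representation[OF assms(1), of x] by simp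
qed

text \<open>Linear relations indexed by the type \<open>3\<close> instead of the image of \<open>b\<close> make the criterion
  directly applicable to explicit families.\<close>

lemma basis3I:
  fixes b :: "3 \<Rightarrow> 'v::real_vector"
  assumes ind: "\<And>x. (\<Sum>i\<in>UNIV. x i *\<^sub>R b i) = 0 \<Longrightarrow> \<forall>i. x i = 0"
    and V: "\<And>v. v \<in> V \<longleftrightarrow> (\<exists>x. v = (\<Sum>i\<in>UNIV. x i *\<^sub>R b i))"
  shows "basis3 V b"
proof -
  have inj: "inj b"
  proof (rule injI, rule ccontr)
    fix i j assume ij: "b i = b j" "i \<noteq> j"
    have "(\<Sum>k\<in>UNIV. (if k = i then 1 else if k = j then - 1 else 0) *\<^sub>R b k) = (\<Sum>k\<in>UNIV. if k = i
        then b i else 0) - (\<Sum>k\<in>UNIV. if k = j then b j else 0)"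
      unfolding sum_subtractf[symmetric] using ij by (intro sum.cong) auto
    also have "\<dots> = 0" using ij by simp
    finally have "\<forall>k. (if k = i then 1 else if k = j then - 1 else 0 :: real) = 0" by (rule ind)
    then show False by (metis zero_neq_one)
  qed
  have "independent (range b)"
    unfolding dependent_finite[OF finite_imageI[OF finite]]
  proof safe
    fix u i assume u: "(\<Sum>v\<in>range b. u v *\<^sub>R v) = 0" "u (b i) \<noteq> 0"
    then have "(\<Sum>i\<in>UNIV. u (b i) *\<^sub>R b i) = 0" using inj by (simp add: sum.reindex)
    from ind[OF this] u show False by simp
  qed
  moreover have "span (range b) = V"
  proof safe
    fix v assume "v \<in> span (range b)"
    then obtain u where "v = (\<Sum>w\<in>range b. u w *\<^sub>R w)" by (auto simp: span_finite)
    also have "\<dots> = (\<Sum>i\<in>UNIV. u (b i) *\<^sub>R b i)" using inj by (simp add: sum.reindex)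
    finally show "v \<in> V" unfolding V by (rule exI[of _ "\<lambda>i. u (b i)"])
  next
    fix v assume "v \<in> V"
    then obtain x where x: "v = (\<Sum>i\<in>UNIV. x i *\<^sub>R b i)" using V[of v] by blast
    show "v \<in> span (range b)" unfolding x by (intro span_sum span_scale span_base rangeI)
  qed
  ultimately show ?thesis using inj by (simp add: basis3_def)
qed

lemma basis3_dim: "basis3 V b \<Longrightarrow> dim V = 3"
  by (auto simp: basis3_def dim_span dim_eq_card_independent card_image)

lemma det_in_basis_eq:
  assumes "basis3 V b" "\<And>j. w j = (\<Sum>i\<in>UNIV. A i j *\<^sub>R b i)"
  shows "det_in_basis b w = det (\<chi> i j. A i j)"
  unfolding det_in_basis_def assms(2) basis3_representation[OF assms(1)] ..

section \<open>The cubic form of a triple of two-forms\<close>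

text \<open>The cubic form \<open>v \<mapsto> v\<^sup>T a b' c v\<close>, in which \<open>b'\<close> is the dual of \<open>b\<close>. Up to a factor it is
  Urbantke's expression \<open>i\<^sub>v a \<and> i\<^sub>v b \<and> c\<close> for the conformal metric determined by a triple of
  two-forms. For fixed \<open>v\<close> it is an alternating trilinear form in the triple, so its sign is an
  orientation of the span of the triple, and this orientation is described without reference to a
  metric.\<close>

definition triple_form :: "real^4 \<Rightarrow> real^4^4 \<Rightarrow> real^4^4 \<Rightarrow> real^4^4 \<Rightarrow> real" where
  "triple_form v a b c = v \<bullet> ((a ** wedge_dual b ** c) *v v)"

lemma triple_form_linear:
  "triple_form v (a + a') b c = triple_form v a b c + triple_form v a' b c"
  "triple_form v a (b + b') c = triple_form v a b c + triple_form v a b' c"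
  "triple_form v a b (c + c') = triple_form v a b c + triple_form v a b c'"
  "triple_form v (r *\<^sub>R a) b c = r * triple_form v a b c"
  "triple_form v a (r *\<^sub>R b) c = r * triple_form v a b c"
  "triple_form v a b (r *\<^sub>R c) = r * triple_form v a b c"
  by (simp_all add: triple_form_def matrix_mult_distribs matrix_vector_mult_add_rdistrib inner_add_right
     scaleR_matrix_vector_assoc[symmetric])

lemma inner_matrix_transpose: "v \<bullet> (A *v w) = (transpose A *v v) \<bullet> (w :: real^'n)"
  by (simp add: dot_lmul_matrix[symmetric] vector_transpose_matrix)

lemma matrix_vector_scale:
  fixes A :: "real^'n^'m"
  shows "(r *\<^sub>R A) *v v = r *\<^sub>R (A *v v)" "(- A) *v v = - (A *v v)"
  by (simp_all add: vec_eq_iff matrix_vector_mult_def sum_distrib_left sum_negf mult.assoc)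

lemma transpose_mult_rows: "transpose N *v x = (\<Sum>i\<in>UNIV. x $ i *\<^sub>R (N $ i))" for N :: "real^'n^'m"
  by (simp add: vec_eq_iff matrix_vector_mult_def transpose_def mult.commute)

lemma skew_inner: "a \<in> forms2 \<Longrightarrow> v \<bullet> (a *v w) = - ((a *v v) \<bullet> w)"
  by (simp add: inner_matrix_transpose forms2_transpose matrix_vector_scale)

lemma skew_inner_self: "a \<in> forms2 \<Longrightarrow> v \<bullet> (a *v v) = 0"
  using skew_inner[of a v v] by (simp add: inner_commute)

text \<open>Two equal neighbours can be removed by the Clifford relation, which leaves the value of a skew
  form on \<open>(v, v)\<close>; with equal outer entries the whole product is skew.\<close>

lemma triple_form_alternating:
  assumes "a \<in> forms2" "b \<in> forms2"
  shows "triple_form v a a b = 0" "triple_form v a b b = 0" "triple_form v a b a = 0"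
proof -
  show "triple_form v a a b = 0"
    by (simp add: triple_form_def clifford_square assms matrix_mult_distribs matrix_vector_scale
        skew_inner_self)
  show "triple_form v a b b = 0"
    by (simp add: triple_form_def clifford_square assms matrix_mult_distribs matrix_vector_scale
        skew_inner_self
       matrix_mul_assoc[symmetric])
  have "a ** wedge_dual b ** a \<in> forms2"
    using assms wedge_dual_forms2[of b] by (simp add: forms2_def matrix_ring)
  then show "triple_form v a b a = 0" by (simp add: triple_form_def skew_inner_self)
qed

lemma triple_form_swap:
  assumes "a \<in> forms2" "b \<in> forms2" "c \<in> forms2"
  shows "triple_form v b a c = - triple_form v a b c" "triple_form v a c b = - triple_form v a b c"
    "triple_form v c b a = - triple_form v a b c"
proof -
  note s = subspace_add[OF subspace_forms2]
  show "triple_form v b a c = - triple_form v a b c"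
    using triple_form_alternating(1)[OF s[OF assms(1,2)] assms(3), of v]
    by (simp add: triple_form_linear triple_form_alternating assms)
  show "triple_form v a c b = - triple_form v a b c"
    using triple_form_alternating(2)[OF assms(1) s[OF assms(2,3)], of v]
    by (simp add: triple_form_linear triple_form_alternating assms)
  show "triple_form v c b a = - triple_form v a b c"
    using triple_form_alternating(3)[OF s[OF assms(1,3)] assms(2), of v]
    by (simp add: triple_form_linear triple_form_alternating assms)
qed

lemma triple_form_change:
  assumes b: "\<And>i. b i \<in> forms2" and w: "\<And>j. w j = (\<Sum>i\<in>UNIV. A i j *\<^sub>R b i)"
  shows "triple_form v (w 1) (w 2) (w 3) = det (\<chi> i j. A i j :: real^3^3) * triple_form v (b 1) (b
      2) (b (3::3))"
proof -
  have perm: "triple_form v (b 2) (b 1) (b 3) = - triple_form v (b 1) (b 2) (b 3)"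
    "triple_form v (b 1) (b 3) (b 2) = - triple_form v (b 1) (b 2) (b 3)"
    "triple_form v (b 3) (b 2) (b 1) = - triple_form v (b 1) (b 2) (b 3)"
    "triple_form v (b 2) (b 3) (b 1) = triple_form v (b 1) (b 2) (b 3)"
    "triple_form v (b 3) (b 1) (b 2) = triple_form v (b 1) (b 2) (b 3)"
    using triple_form_swap(1)[OF b[of 1] b[of 2] b[of 3], of v] triple_form_swap(2)[OF b[of 1]
        b[of 2] b[of 3], of v]
      triple_form_swap(3)[OF b[of 1] b[of 2] b[of 3], of v] triple_form_swap(2)[OF b[of 2] b[of 1]
          b[of 3], of v]
      triple_form_swap(1)[OF b[of 1] b[of 3] b[of 2], of v]
    by linarith+
  show ?thesis
    unfolding w sum_3 triple_form_linear triple_form_alternating[OF b b] perm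
    by (simp add: det_3 algebra_simps)
qed

text \<open>Linear independence is part of this notion: a nontrivial combination is nonzero.\<close>

definition definite_triple :: "real \<Rightarrow> (3 \<Rightarrow> real^4^4) \<Rightarrow> bool" where
  "definite_triple \<sigma> w \<longleftrightarrow> (\<forall>i. w i \<in> forms2) \<and>
     (\<forall>x. (\<exists>i. x i \<noteq> 0) \<longrightarrow> \<sigma> * wedge22 (\<Sum>i\<in>UNIV. x i *\<^sub>R w i) (\<Sum>i\<in>UNIV. x i *\<^sub>R w i) > 0)"

lemma wedge22_nonzero_inj:
  assumes "\<omega> \<in> forms2" "wedge22 \<omega> \<omega> \<noteq> 0" "\<omega> *v v = 0" shows "v = 0"
proof -
  have "(wedge_dual \<omega> ** \<omega>) *v v = 0" by (simp add: matrix_vector_mul_assoc[symmetric] assms)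
  then show ?thesis using assms by (simp add: clifford_square matrix_vector_scale)
qed

text \<open>The covectors \<open>w i *v v\<close> are independent, because a vector in the kernel of a combination
  \<open>\<omega>\<close> with \<open>\<omega> \<and> \<omega> \<noteq> 0\<close> is zero, and they annihilate \<open>v\<close>. If the cubic form vanished at \<open>v\<close>,
  the vector obtained from \<open>w 3 *v v\<close> by the dual of \<open>w 2\<close> would be annihilated by all three and
  so be a multiple of \<open>v\<close>. Applying \<open>w 2\<close> would make \<open>w 3 *v v\<close> a multiple of \<open>w 2 *v v\<close>.\<close>

lemma triple_form_nonzero:
  assumes w: "definite_triple \<sigma> w" and v: "v \<noteq> 0"
  shows "triple_form v (w 1) (w 2) (w 3) \<noteq> 0"
proof
  assume T: "triple_form v (w 1) (w 2) (w 3) = 0"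
  have f: "w i \<in> forms2" for i using w by (simp add: definite_triple_def)
  have ind: "x i = 0" if "(\<Sum>i\<in>UNIV. x i *\<^sub>R (w i *v v)) = 0" for x :: "3 \<Rightarrow> real" and i
  proof (rule ccontr)
    assume "x i \<noteq> 0"
    then have "wedge22 (\<Sum>i\<in>UNIV. x i *\<^sub>R w i) (\<Sum>i\<in>UNIV. x i *\<^sub>R w i) \<noteq> 0"
      using w unfolding definite_triple_def by fastforce
    moreover have "(\<Sum>i\<in>UNIV. x i *\<^sub>R w i) *v v = 0"
      using that by (simp add: sum_3 matrix_vector_mult_add_rdistrib scaleR_matrix_vector_assoc)
    moreover have "(\<Sum>i\<in>UNIV. x i *\<^sub>R w i) \<in> forms2"
      by (intro subspace_sum subspace_scale subspace_forms2 f)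
    ultimately show False using wedge22_nonzero_inj v by blast
  qed
  define u where "u = wedge_dual (w 2) *v (w 3 *v v)"
  have u: "(w 1 *v v) \<bullet> u = 0" "(w 2 *v v) \<bullet> u = 0" "(w 3 *v v) \<bullet> u = 0"
  proof -
    show "(w 1 *v v) \<bullet> u = 0"
      using T skew_inner[OF f, of v 1 u] by (simp add: triple_form_def u_def
          matrix_vector_mul_assoc[symmetric])
    have "w 2 *v u = (- (wedge22 (w 2) (w 2) / 2)) *\<^sub>R (w 3 *v v)"
      by (simp add: u_def matrix_vector_mul_assoc clifford_square(1)[OF f] matrix_mul_assoc
          matrix_mult_distribs
          matrix_vector_scale)
    then show "(w 2 *v v) \<bullet> u = 0"
      using skew_inner[OF f, of v 2 u] by (simp add: skew_inner_self[OF f])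
    show "(w 3 *v v) \<bullet> u = 0" unfolding u_def by (rule skew_inner_self[OF wedge_dual_forms2])
  qed
  define k where "k = (v \<bullet> u) / (v \<bullet> v)"
  \<comment> \<open>The part of \<open>u\<close> orthogonal to \<open>v\<close> is orthogonal to four independent vectors, the rows of \<open>N\<close>.\<close>
  define z where "z = u - k *\<^sub>R v"
  have z: "(w 1 *v v) \<bullet> z = 0" "(w 2 *v v) \<bullet> z = 0" "(w 3 *v v) \<bullet> z = 0" "v \<bullet> z = 0"
  proof -
    have "(w i *v v) \<bullet> v = 0" for i using skew_inner_self[OF f, of v i] by (simp add: inner_commute)
    then show "(w 1 *v v) \<bullet> z = 0" "(w 2 *v v) \<bullet> z = 0" "(w 3 *v v) \<bullet> z = 0"
      using u by (simp_all add: z_def inner_diff_right)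
    show "v \<bullet> z = 0" using v by (simp add: z_def inner_diff_right k_def)
  qed
  define N :: "real^4^4" where "N = (\<chi> i. if i = 1 then w 1 *v v else if i = 2 then w 2 *v v else
      if i = 3 then w 3 *v v else v)"
  have Nz: "N *v z = 0" using z by (simp add: matrix_mult_dot N_def vec_eq_iff)
  have "x = 0" if "transpose N *v x = 0" for x
  proof -
    have s: "x$1 *\<^sub>R (w 1 *v v) + x$2 *\<^sub>R (w 2 *v v) + x$3 *\<^sub>R (w 3 *v v) + x$4 *\<^sub>R v = 0"
      using that unfolding transpose_mult_rows sum_4 by (simp add: N_def)
    from arg_cong[OF this, of "\<lambda>y. v \<bullet> y"] have "x $ 4 = 0"
      using v by (simp add: inner_add_right skew_inner_self[OF f])
    with s have "(\<Sum>i\<in>UNIV. (if i = 1 then x$1 else if i = 2 then x$2 else x$3) *\<^sub>R (w (i::3) *v v)) = 0"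
      by (simp add: sum_3)
    from ind[OF this, of 1] ind[OF this, of 2] ind[OF this, of 3] \<open>x $ 4 = 0\<close> show "x = 0"
      by (simp add: vec_eq_iff forall_4)
  qed
  then have "invertible (transpose N)"
    using invertible_left_inverse matrix_left_invertible_ker by blast
  then have "invertible N" using transpose_invertible transpose_transpose by metis
  then have "z = 0" using Nz matrix_left_invertible_ker invertible_left_inverse by metis
  then have "u = k *\<^sub>R v" by (simp add: z_def)
  then have "w 2 *v u = k *\<^sub>R (w 2 *v v)" by (simp add: matrix_vector_mult_scaleR)
  moreover have "w 2 *v u = (- (wedge22 (w 2) (w 2) / 2)) *\<^sub>R (w 3 *v v)"
    by (simp add: u_def matrix_vector_mul_assoc clifford_square(1)[OF f] matrix_mul_assoc
        matrix_mult_distribs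
          matrix_vector_scale)
  ultimately have "k *\<^sub>R (w 2 *v v) = (- (wedge22 (w 2) (w 2) / 2)) *\<^sub>R (w 3 *v v)" by simp
  then have "(\<Sum>i\<in>UNIV. (if i = 1 then 0 else if i = 2 then k else wedge22 (w 2) (w 2) / 2) *\<^sub>R (w
      (i::3) *v v)) = 0"
    by (simp add: sum_3)
  from ind[OF this, of 3] have "wedge22 (w 2) (w 2) = 0" by simp
  moreover have "\<sigma> * wedge22 (w 2) (w 2) > 0"
    using w[unfolded definite_triple_def, THEN conjunct2, rule_format, of "\<lambda>i. if i = 2 then 1
        else 0"] by (simp add: sum_3)
  ultimately show False by simp
qed

lemma metric_inverse_pos:
  assumes h: "metric_matrix h" and "w \<noteq> 0" shows "w \<bullet> (matrix_inv h *v w) > 0"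
proof -
  define u where "u = matrix_inv h *v w"
  have w: "w = h *v u" by (simp add: u_def matrix_vector_mul_assoc metric_inverse[OF h])
  then have "u \<noteq> 0" using \<open>w \<noteq> 0\<close> by auto
  then have "u \<bullet> (h *v u) > 0" using h by (simp add: metric_matrix_def)
  then show ?thesis unfolding u_def[symmetric] by (subst w) (simp add: inner_commute)
qed

lemma self_dual_wedge_nonzero:
  assumes h: "metric_matrix h" and \<sigma>: "\<sigma> \<in> {1, - 1}" and "\<omega> \<in> self_dual \<sigma> h" "\<omega> \<noteq> 0"
  shows "\<sigma> * wedge22 \<omega> \<omega> > 0"
proof -
  have "\<sigma> * wedge22 \<omega> \<omega> = (\<sigma> * \<sigma>) * sqrt (det h) * form_inner h \<omega> \<omega>"
    using wedge22_self_dual[OF assms(3) self_dual_forms2[OF assms(3)]] by simp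
  moreover have "\<sigma> * \<sigma> = 1" using \<sigma> by auto
  ultimately show ?thesis using form_inner_pos[OF h assms(4)] det_metric_pos[OF h] by simp
qed

text \<open>For self-dual forms the dual is a multiple of raising both indices, so the commutator part of
  \<open>a ** wedge_dual b\<close> is the Lie bracket and its anticommutator part is scalar by the Clifford
  relation. The scalar part contributes the skew form \<open>c\<close> at \<open>(v, v)\<close>, that is nothing, and the
  bracket leaves \<open>- \<sigma> * \<kappa>\<close> times the squared length of \<open>c *v v\<close>, up to a positive factor.\<close>

lemma sgn_triple_form_bracket:
  assumes h: "metric_matrix h" and \<sigma>: "\<sigma> \<in> {1, - 1}" and v: "v \<noteq> 0"
    and abc: "a \<in> self_dual \<sigma> h" "b \<in> self_dual \<sigma> h" "c \<in> self_dual \<sigma> h"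
    and br: "form_bracket h a b = \<kappa> *\<^sub>R c" and c0: "c \<noteq> 0"
  shows "sgn (triple_form v a b c) = - \<sigma> * sgn \<kappa>"
proof -
  let ?X = "matrix_inv h" and ?\<delta> = "\<sigma> * sqrt (det h)"
  have f: "a \<in> forms2" "b \<in> forms2" "c \<in> forms2" using abc self_dual_forms2 by blast+
  have dual: "wedge_dual a = ?\<delta> *\<^sub>R (?X ** a ** ?X)" "wedge_dual b = ?\<delta> *\<^sub>R (?X ** b ** ?X)"
    using abc f h by (simp_all add: self_dual_iff raise2_eq)
  have "a ** wedge_dual b - b ** wedge_dual a = ?\<delta> *\<^sub>R (form_bracket h a b ** ?X)"
    unfolding dual form_bracket_def by (simp add: matrix_ring algebra_simps)
  also have "\<dots> = (?\<delta> * \<kappa>) *\<^sub>R (c ** ?X)" by (simp add: br matrix_mult_distribs)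
  finally have "(a ** wedge_dual b + b ** wedge_dual a) + (a ** wedge_dual b - b ** wedge_dual a) =
     - wedge22 a b *\<^sub>R mat 1 + (?\<delta> * \<kappa>) *\<^sub>R (c ** ?X)"
    by (simp only: clifford[OF f(1,2)])
  then have "2 *\<^sub>R (a ** wedge_dual b) = - wedge22 a b *\<^sub>R mat 1 + (?\<delta> * \<kappa>) *\<^sub>R (c ** ?X)"
    by (simp add: scaleR_2)
  from arg_cong[OF this, of "\<lambda>M. v \<bullet> ((M ** c) *v v)"]
  have "2 * triple_form v a b c = - wedge22 a b * (v \<bullet> (c *v v)) + ?\<delta> * \<kappa> * (v \<bullet> (c *v (?X *v (c
      *v v))))"
    by (simp add: triple_form_def matrix_mult_distribs matrix_vector_scale
        matrix_vector_mult_add_rdistrib inner_add_right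
      matrix_vector_mul_assoc[symmetric] matrix_vector_mult_diff_rdistrib inner_diff_right)
  then have T: "2 * triple_form v a b c = - \<sigma> * \<kappa> * (sqrt (det h) * ((c *v v) \<bullet> (?X *v (c *v v))))"
    by (simp add: skew_inner_self f skew_inner[OF f(3), of v "?X *v (c *v v)"])
  have "wedge22 c c \<noteq> 0" using self_dual_wedge_nonzero[OF h \<sigma> abc(3) c0] by auto
  then have "c *v v \<noteq> 0" using wedge22_nonzero_inj[OF f(3)] v by blast
  then have "sqrt (det h) * ((c *v v) \<bullet> (?X *v (c *v v))) > 0"
    using metric_inverse_pos[OF h] det_metric_pos[OF h] by simp
  then obtain q where "q > 0" "2 * triple_form v a b c = - \<sigma> * \<kappa> * q" using T by blast
  then have "sgn (2 * triple_form v a b c) = - \<sigma> * sgn \<kappa>"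
    using \<sigma> by (auto simp: sgn_mult)
  then show ?thesis by (simp add: sgn_mult)
qed

text \<open>The metric-free description of the orientation of \<open>\<Lambda>\<^sup>\<plusminus>\<close>: whichever basis with the \<open>so(3)\<close>
  relations is chosen, the cubic form has sign \<open>- \<sigma>\<close> on it. This removes the dependence of the
  signs below on the choices of bases and of a metric in the conformal class.\<close>

lemma sgn_det_in_so3_basis:
  assumes h: "metric_matrix h" and \<sigma>: "\<sigma> \<in> {1, - 1}" and v: "v \<noteq> 0"
    and b: "so3_basis (form_bracket h) (self_dual \<sigma> h) b" and w: "\<And>j. w j \<in> self_dual \<sigma> h"
  shows "sgn (det_in_basis b w) = - \<sigma> * sgn (triple_form v (w 1) (w 2) (w 3))"
proof -
  have B: "basis3 (self_dual \<sigma> h) b" and br: "form_bracket h (b 1) (b 2) = 1 *\<^sub>R b 3"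
    using b by (simp_all add: so3_basis_def)
  note mem = basis3_basis_mem[OF B]
  have "b 3 \<noteq> 0"
    using B dependent_zero unfolding basis3_def by (metis rangeI)
  from sgn_triple_form_bracket[OF h \<sigma> v mem mem mem br this]
  have T: "sgn (triple_form v (b 1) (b 2) (b 3)) = - \<sigma>" by simp
  let ?A = "\<lambda>i j. representation (range b) (w j) (b i)"
  have w': "w j = (\<Sum>i\<in>UNIV. ?A i j *\<^sub>R b i)" for j by (rule basis3_representation_expand[OF B w])
  have "det_in_basis b w = det (\<chi> i j. ?A i j)" by (rule det_in_basis_eq[OF B w'])
  moreover have "triple_form v (w 1) (w 2) (w 3) = det (\<chi> i j. ?A i j) * triple_form v (b 1) (b 2)
      (b 3)"
    by (rule triple_form_change[OF self_dual_forms2[OF mem] w'])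
  ultimately show ?thesis using \<sigma> by (auto simp: sgn_mult T)
qed

section \<open>Metrics with prescribed self-dual forms\<close>

lemma det_forms2: "\<omega> \<in> forms2 \<Longrightarrow> det \<omega> = (wedge22 \<omega> \<omega> / 2)\<^sup>2"
  by (simp add: det_4 wedge22_def forms2_lower power2_eq_square algebra_simps)

lemma wedge22_wedge_dual: "wedge22 (wedge_dual \<omega>) (wedge_dual \<omega>) = wedge22 \<omega> \<omega>"
  by (simp add: wedge22_def wedge_dual_nth algebra_simps)

text \<open>The candidate is the symmetric matrix \<open>H\<close> of the cubic form. Its symmetry, and the
  self-duality of the \<open>w i\<close> with respect to \<open>\<plusminus>H\<close>, are computations in the Clifford relations. It
  is definite because the cubic form has no zero away from the origin and the punctured space is
  connected.\<close>

lemma metric_of_orthonormal_triple: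
  fixes w :: "3 \<Rightarrow> real^4^4"
  assumes \<sigma>: "\<sigma> \<in> {1, - 1}" and f: "\<And>i. w i \<in> forms2"
    and on: "\<And>i j. wedge22 (w i) (w j) = (if i = j then 2 * \<sigma> else 0)"
  obtains h where "metric_matrix h" "\<And>i. w i \<in> self_dual \<sigma> h"
proof -
  have \<sigma>2: "\<sigma> * \<sigma> = 1" using \<sigma> by auto
  define H where "H = w 1 ** wedge_dual (w 2) ** w 3"
  have def: "definite_triple \<sigma> w"
    unfolding definite_triple_def
  proof (intro conjI allI impI f)
    fix x :: "3 \<Rightarrow> real" assume "\<exists>i. x i \<noteq> 0"
    then obtain i where "0 < (x i)\<^sup>2" by auto
    also have "(x i)\<^sup>2 \<le> (x 1)\<^sup>2 + (x 2)\<^sup>2 + (x 3)\<^sup>2"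
      using exhaust_3[of i] by auto
    finally show "\<sigma> * wedge22 (\<Sum>i\<in>UNIV. x i *\<^sub>R w i) (\<Sum>i\<in>UNIV. x i *\<^sub>R w i) > 0"
      using \<sigma> by (auto simp: sum_3 on power2_eq_square algebra_simps)
  qed
  have anti: "w i ** wedge_dual (w j) = - (w j ** wedge_dual (w i))" "wedge_dual (w i) ** w j = -
      (wedge_dual (w j) ** w i)" if "i \<noteq> j" for i j
    using clifford[OF f f, of i j] clifford_dual[OF f f, of i j] on[of i j] that by (simp_all add:
        eq_neg_iff_add_eq_0)
  have sq: "w i ** wedge_dual (w i) = - \<sigma> *\<^sub>R mat 1" "wedge_dual (w i) ** w i = - \<sigma> *\<^sub>R mat 1" for i
    using clifford_square[OF f, of i] on[of i i] by simp_all
  \<comment> \<open>The expression for \<open>H\<close> is invariant under cyclic permutations.\<close>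
  have H2: "H = w 2 ** wedge_dual (w 3) ** w 1"
  proof -
    have "H = - (w 2 ** (wedge_dual (w 1) ** w 3))" by (simp add: H_def anti(1)[of 1 2] matrix_ring)
    also have "\<dots> = w 2 ** (wedge_dual (w 3) ** w 1)" by (simp add: anti(2)[of 1 3] matrix_mult_distribs)
    finally show ?thesis by (simp add: matrix_mul_assoc)
  qed
  have H3: "H = w 3 ** wedge_dual (w 1) ** w 2"
  proof -
    have "H = - (w 1 ** (wedge_dual (w 3) ** w 2))" by (simp add: H_def anti(2)[of 2 3]
        matrix_ring flip: matrix_mul_assoc)
    also have "\<dots> = - ((w 1 ** wedge_dual (w 3)) ** w 2)" by (simp add: matrix_mul_assoc)
    also have "\<dots> = w 3 ** wedge_dual (w 1) ** w 2" by (simp add: anti(1)[of 1 3] matrix_mult_distribs)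
    finally show ?thesis .
  qed
  have sym: "transpose H = H"
  proof -
    have "transpose H = - (w 3 ** wedge_dual (w 2) ** w 1)"
      unfolding H_def by (simp add: transpose_distribs forms2_transpose f wedge_dual_forms2 matrix_ring)
    also have "\<dots> = H" unfolding H2 by (simp add: anti(1)[of 3 2] matrix_mult_distribs)
    finally show ?thesis .
  qed
  have HwH: "H ** wedge_dual (w i) ** H = \<sigma> *\<^sub>R w i" for i
  proof -
    have *: "(a ** b' ** c) ** a' ** (a ** b' ** c) = \<sigma> *\<^sub>R a"
      if "a' ** a = - \<sigma> *\<^sub>R mat 1" "c ** b' = - (b ** c')" "b' ** b = - \<sigma> *\<^sub>R mat 1" "c' ** c = - \<sigma>
          *\<^sub>R mat 1"
      for a b c a' b' c' :: "real^4^4"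
    proof -
      have "(a ** b' ** c) ** a' ** (a ** b' ** c) = a ** b' ** c ** (a' ** a) ** b' ** c" by
          (simp add: matrix_mul_assoc)
      also have "\<dots> = - \<sigma> *\<^sub>R (a ** b' ** (c ** b') ** c)" by (simp add: that(1)
          matrix_mult_distribs matrix_mul_assoc)
      also have "\<dots> = \<sigma> *\<^sub>R (a ** (b' ** b) ** (c' ** c))" by (simp add: that(2)
          matrix_mult_distribs matrix_mul_assoc)
      also have "\<dots> = \<sigma> *\<^sub>R a" by (simp add: that(3,4) matrix_mult_distribs \<sigma>2)
      finally show ?thesis .
    qed
    have "i = 1 \<or> i = 2 \<or> i = 3" by (rule exhaust_3)
    then show ?thesis
    proof (elim disjE)
      assume i: "i = 1" show ?thesis unfolding i H_def by (rule *[where b = "w 2" and c' =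
          "wedge_dual (w 3)"]) (auto simp: sq intro: anti)
    next
      assume i: "i = 2" show ?thesis unfolding i H2 by (rule *[where b = "w 3" and c' =
          "wedge_dual (w 1)"]) (auto simp: sq intro: anti)
    next
      assume i: "i = 3" show ?thesis unfolding i H3 by (rule *[where b = "w 1" and c' =
          "wedge_dual (w 2)"]) (auto simp: sq intro: anti)
    qed
  qed
  have H0: "v \<bullet> (H *v v) \<noteq> 0" if "v \<noteq> 0" for v
    using triple_form_nonzero[OF def that] by (simp add: triple_form_def H_def)
  obtain s :: real where s: "s \<in> {1, - 1}" "\<And>v. v \<noteq> 0 \<Longrightarrow> s * (v \<bullet> (H *v v)) > 0"
  proof -
    let ?q = "\<lambda>v. v \<bullet> (H *v v)"
    have "connected (?q ` (- {0}))"
      by (intro connected_continuous_image connected_punctured_universe continuous_intros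
         matrix_vector_mul_linear linear_continuous_on) (auto simp: linear_conv_bounded_linear)
    then have "is_interval (?q ` (- {0}))" by (simp add: is_interval_connected_1)
    moreover have "0 \<notin> ?q ` (- {0})" using H0 by force
    ultimately have no: "\<not> (a < 0 \<and> 0 < b)" if "a \<in> ?q ` (- {0})" "b \<in> ?q ` (- {0})" for a b
      unfolding is_interval_1 using that less_imp_le by blast
    have "\<not> (?q v < 0 \<and> 0 < ?q w)" if "v \<noteq> 0" "w \<noteq> 0" for v w
      by (rule no) (use that in auto)
    then have "(\<forall>v. v \<noteq> 0 \<longrightarrow> ?q v > 0) \<or> (\<forall>v. v \<noteq> 0 \<longrightarrow> ?q v < 0)"
      using H0 by (meson linorder_neqE_linordered_idom)
    then show ?thesis using that[of 1] that[of "- 1"] by auto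
  qed
  have s2: "s * s = 1" using s(1) by auto
  define h where "h = s *\<^sub>R H"
  have h: "metric_matrix h"
    using s(2) sym by (simp add: metric_matrix_def h_def transpose_distribs matrix_vector_scale)
  have hwh: "h ** wedge_dual (w i) ** h = \<sigma> *\<^sub>R w i" for i
    by (simp add: h_def matrix_mult_distribs s2 HwH)
  have "det h * det h = 1"
  proof -
    have "det (\<sigma> *\<^sub>R w 1) = 1"
      using \<sigma> by (subst det_forms2) (auto intro: subspace_scale[OF subspace_forms2 f] simp: on)
    moreover have "det (wedge_dual (w 1)) = 1"
      using \<sigma> by (subst det_forms2[OF wedge_dual_forms2]) (auto simp: on wedge22_wedge_dual)
    ultimately show ?thesis using arg_cong[OF hwh[of 1], of det] by (simp add: det_mul)
  qed
  then have det: "det h = 1" using det_metric_pos[OF h] by (metis abs_of_pos abs_mult_self_eq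
      abs_1 mult_1 power2_eq_1_iff power2_eq_square real_sqrt_abs real_sqrt_one)
  have "w i \<in> self_dual \<sigma> h" for i
  proof -
    let ?X = "matrix_inv h"
    have "wedge_dual (w i) = (?X ** h) ** wedge_dual (w i) ** (h ** ?X)" by (simp add:
        metric_inverse[OF h])
    also have "\<dots> = ?X ** (h ** wedge_dual (w i) ** h) ** ?X" by (simp add: matrix_mul_assoc)
    also have "\<dots> = \<sigma> *\<^sub>R raise2 h (w i)" by (simp add: hwh raise2_eq[OF h] matrix_mult_distribs)
    finally show ?thesis by (simp add: self_dual_iff[OF f h] det)
  qed
  then show ?thesis using that h by blast
qed

lemma basis3I_coefficients:
  assumes ind: "\<And>x. (\<Sum>i\<in>UNIV. x i *\<^sub>R b i) = 0 \<Longrightarrow> \<forall>i. x i = 0"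
    and mem: "\<And>x. (\<Sum>i\<in>UNIV. x i *\<^sub>R b i) \<in> V"
    and c: "\<And>v. v \<in> V \<Longrightarrow> v = (\<Sum>i\<in>UNIV. c v i *\<^sub>R b i)"
  shows "basis3 V b"
proof (rule basis3I[OF ind])
  fix v show "v \<in> V \<longleftrightarrow> (\<exists>x. v = (\<Sum>i\<in>UNIV. x i *\<^sub>R b i))"
  proof
    assume "v \<in> V"
    then show "\<exists>x. v = (\<Sum>i\<in>UNIV. x i *\<^sub>R b i)" using c by (intro exI[of _ "c v"])
  next
    assume "\<exists>x. v = (\<Sum>i\<in>UNIV. x i *\<^sub>R b i)"
    then obtain x where x: "v = (\<Sum>i\<in>UNIV. x i *\<^sub>R b i)" ..
    show "v \<in> V" unfolding x by (rule mem)
  qed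
qed

text \<open>Gram-Schmidt for the wedge product; the normalisation gives every member the Pfaffian \<open>\<sigma>\<close>.\<close>

lemma wedge_orthonormal_family:
  assumes \<sigma>: "\<sigma> \<in> {1, - 1}" and V: "subspace V" and b: "basis3 V b"
    and pos: "\<And>\<omega>. \<omega> \<in> V \<Longrightarrow> \<omega> \<noteq> 0 \<Longrightarrow> \<sigma> * wedge22 \<omega> \<omega> > 0"
  obtains w :: "3 \<Rightarrow> real^4^4" where "\<And>i. w i \<in> V" "\<And>i j. wedge22 (w i) (w j) = (if i = j then 2 *
      \<sigma> else 0)"
proof -
  have \<sigma>2: "\<sigma> * \<sigma> = 1" using \<sigma> by auto
  have ind: "x = 0 \<and> y = 0 \<and> z = 0" if "x *\<^sub>R b 1 + y *\<^sub>R b 2 + z *\<^sub>R b 3 = 0" for x y z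
  proof -
    have "(if i = 1 then x else if i = 2 then y else z) = 0" for i :: 3
      by (rule basis3_independent[OF b]) (use that in \<open>simp add: sum_3\<close>)
    from this[of 1] this[of 2] this[of 3] show ?thesis by simp
  qed
  have bV: "b i \<in> V" for i using b by (rule basis3_basis_mem)
  define p where "p x y = wedge22 x y / wedge22 y y" for x y :: "real^4^4"
  define u1 where "u1 = b 1"
  define u2 where "u2 = b 2 - p (b 2) u1 *\<^sub>R u1"
  define u3 where "u3 = b 3 - p (b 3) u1 *\<^sub>R u1 - p (b 3) u2 *\<^sub>R u2"
  have uV: "u1 \<in> V" "u2 \<in> V" "u3 \<in> V"
    unfolding u3_def u2_def u1_def by (intro subspace_diff subspace_scale V bV)+
  have "u1 \<noteq> 0" using ind[of 1 0 0] by (auto simp: u1_def)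
  moreover have "u2 \<noteq> 0" using ind[of "- p (b 2) u1" 1 0] by (auto simp: u1_def u2_def)
  moreover have "u3 \<noteq> 0" using ind[of "- p (b 3) u1 + p (b 3) u2 * p (b 2) u1" "- p (b 3) u2" 1]
    by (auto simp: u1_def u2_def u3_def algebra_simps)
  ultimately have P: "\<sigma> * wedge22 u1 u1 > 0" "\<sigma> * wedge22 u2 u2 > 0" "\<sigma> * wedge22 u3 u3 > 0"
    using pos uV by blast+
  then have nz: "wedge22 u1 u1 \<noteq> 0" "wedge22 u2 u2 \<noteq> 0" by auto
  have sub: "wedge22 (x - y) z = wedge22 x z - wedge22 y z" for x y z
    using wedge22_linear(1)[of "x - y" y z] by simp
  have p: "wedge22 x y - p x y * wedge22 y y = 0" if "wedge22 y y \<noteq> 0" for x y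
    using that by (simp add: p_def)
  have o12: "wedge22 u2 u1 = 0" using p[OF nz(1), of "b 2"] by (simp add: u2_def sub)
  have o13: "wedge22 u3 u1 = 0" using p[OF nz(1), of "b 3"] by (simp add: u3_def sub o12)
  have o23: "wedge22 u3 u2 = 0" using p[OF nz(2), of "b 3"] o12 by (simp add: u3_def sub
      wedge22_commute[of u1 u2])
  define u :: "3 \<Rightarrow> real^4^4" where "u i = (if i = 1 then u1 else if i = 2 then u2 else u3)" for i
  define w where "w i = sqrt (2 / (\<sigma> * wedge22 (u i) (u i))) *\<^sub>R u i" for i
  have u: "u i \<in> V" "\<sigma> * wedge22 (u i) (u i) > 0" for i using uV P by (simp_all add: u_def)
  have o: "wedge22 (u i) (u j) = 0" if "i \<noteq> j" for i j
    using that o12 o13 o23 exhaust_3[of i] exhaust_3[of j] by (auto simp: u_def wedge22_commute)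
  have "wedge22 (w i) (w j) = (if i = j then 2 * \<sigma> else 0)" for i j
  proof (cases "i = j")
    case True
    have "wedge22 (w i) (w i) = 2 / (\<sigma> * wedge22 (u i) (u i)) * wedge22 (u i) (u i)"
      using u(2)[of i] by (simp add: w_def real_sqrt_mult_self flip: mult.assoc)
    also have "\<dots> = 2 * \<sigma>" using u(2)[of i] \<sigma> by auto
    finally show ?thesis using True by simp
  qed (simp add: w_def o)
  moreover have "w i \<in> V" for i unfolding w_def by (intro subspace_scale V u)
  ultimately show ?thesis using that by blast
qed

section \<open>Bases of the self-dual forms\<close>

lemma metric_mat1: "metric_matrix (mat 1)"
  by (simp add: metric_matrix_def)

lemma matrix_inv_mat1: "matrix_inv (mat 1 :: real^4^4) = mat 1"
  using metric_inverse(1)[OF metric_mat1] by simp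

lemma self_dual_mat1:
  assumes "\<sigma> \<in> {1, - 1}"
  shows "\<omega> \<in> self_dual \<sigma> (mat 1) \<longleftrightarrow> \<omega> \<in> forms2 \<and>
    \<omega>$3$4 = \<sigma> * \<omega>$1$2 \<and> \<omega>$2$4 = - \<sigma> * \<omega>$1$3 \<and> \<omega>$2$3 = \<sigma> * \<omega>$1$4"
proof (cases "\<omega> \<in> forms2")
  case True
  show ?thesis
    unfolding self_dual_iff[OF True metric_mat1]
    using assms True by (auto simp: raise2_eq metric_mat1 matrix_inv_mat1 vec_eq_iff forall_4
        wedge_dual_nth
      forms2_lower[OF wedge_dual_forms2] forms2_lower[OF True])
qed (auto dest: self_dual_forms2)

text \<open>The bracket of two of the forms \<open>e\<^sub>1 \<and> e\<^sub>j \<plusminus> e\<^sub>k \<and> e\<^sub>l\<close> is \<open>- 2 * \<sigma>\<close> times the third one, which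
  explains the factor \<open>- \<sigma> / 2\<close>.\<close>

definition std_basis :: "real \<Rightarrow> 3 \<Rightarrow> real^4^4" where
  "std_basis \<sigma> i = (- \<sigma> / 2) *\<^sub>R
     (if i = 1 then wedge11 (axis 1 1) (axis 2 1) + \<sigma> *\<^sub>R wedge11 (axis 3 1) (axis 4 1)
      else if i = 2 then wedge11 (axis 1 1) (axis 3 1) - \<sigma> *\<^sub>R wedge11 (axis 2 1) (axis 4 1)
      else wedge11 (axis 1 1) (axis 4 1) + \<sigma> *\<^sub>R wedge11 (axis 2 1) (axis 3 1))"

lemma std_basis_forms2: "std_basis \<sigma> i \<in> forms2"
  unfolding std_basis_def
  by (rule subspace_scale[OF subspace_forms2]) (auto intro!: subspace_scale subspace_add
      subspace_diff subspace_forms2 wedge11_forms2)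

lemma std_basis_nth:
  "std_basis \<sigma> 1 $ 1 $ 2 = - \<sigma> / 2" "std_basis \<sigma> 1 $ 1 $ 3 = 0" "std_basis \<sigma> 1 $ 1 $ 4 = 0"
  "std_basis \<sigma> 2 $ 1 $ 2 = 0" "std_basis \<sigma> 2 $ 1 $ 3 = - \<sigma> / 2" "std_basis \<sigma> 2 $ 1 $ 4 = 0"
  "std_basis \<sigma> 3 $ 1 $ 2 = 0" "std_basis \<sigma> 3 $ 1 $ 3 = 0" "std_basis \<sigma> 3 $ 1 $ 4 = - \<sigma> / 2"
  "std_basis \<sigma> 1 $ 3 $ 4 = - \<sigma> * \<sigma> / 2" "std_basis \<sigma> 1 $ 2 $ 4 = 0" "std_basis \<sigma> 1 $ 2 $ 3 = 0"
  "std_basis \<sigma> 2 $ 3 $ 4 = 0" "std_basis \<sigma> 2 $ 2 $ 4 = \<sigma> * \<sigma> / 2" "std_basis \<sigma> 2 $ 2 $ 3 = 0"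
  "std_basis \<sigma> 3 $ 3 $ 4 = 0" "std_basis \<sigma> 3 $ 2 $ 4 = 0" "std_basis \<sigma> 3 $ 2 $ 3 = - \<sigma> * \<sigma> / 2"
  by (simp_all add: std_basis_def wedge11_def axis_def)

lemma form_bracket_mat1: "form_bracket (mat 1) a b = a ** b - b ** a"
  by (simp add: form_bracket_def matrix_inv_mat1)

lemma so3_basis_std:
  assumes \<sigma>: "\<sigma> \<in> {1, - 1}"
  shows "so3_basis (form_bracket (mat 1)) (self_dual \<sigma> (mat 1)) (std_basis \<sigma>)"
  unfolding so3_basis_def
proof (intro conjI)
  show "basis3 (self_dual \<sigma> (mat 1)) (std_basis \<sigma>)"
  proof (rule basis3I_coefficients)
    fix x :: "3 \<Rightarrow> real" assume "(\<Sum>i\<in>UNIV. x i *\<^sub>R std_basis \<sigma> i) = 0"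
    then have "(\<Sum>i\<in>UNIV. x i *\<^sub>R std_basis \<sigma> i) $ 1 $ j = 0" for j by simp
    from this[of 2] this[of 3] this[of 4] show "\<forall>i. x i = 0"
      using \<sigma> by (auto simp: sum_3 std_basis_nth forall_3)
  next
    fix v :: "real^4^4" assume "v \<in> self_dual \<sigma> (mat 1)"
    then show "v = (\<Sum>i\<in>UNIV. (if i = 1 then - 2 * \<sigma> * v$1$2 else if i = 2 then - 2 * \<sigma> * v$1$3
        else - 2 * \<sigma> * v$1$4) *\<^sub>R std_basis \<sigma> i)"
      using \<sigma> unfolding self_dual_mat1[OF \<sigma>]
      by (auto simp: vec_eq_iff forall_4 sum_3 std_basis_nth forms2_lower[OF std_basis_forms2]
          forms2_lower)
  next
    fix x
    show "(\<Sum>i\<in>UNIV. x i *\<^sub>R std_basis \<sigma> i) \<in> self_dual \<sigma> (mat 1)"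
    proof (intro subspace_sum subspace_scale subspace_self_dual)
      fix i show "std_basis \<sigma> i \<in> self_dual \<sigma> (mat 1)"
        using \<sigma> exhaust_3[of i] unfolding self_dual_mat1[OF \<sigma>] by (auto simp: std_basis_forms2
            std_basis_nth)
    qed
  qed
  show "form_bracket (mat 1) (std_basis \<sigma> 1) (std_basis \<sigma> 2) = std_basis \<sigma> 3"
    "form_bracket (mat 1) (std_basis \<sigma> 2) (std_basis \<sigma> 3) = std_basis \<sigma> 1"
    "form_bracket (mat 1) (std_basis \<sigma> 3) (std_basis \<sigma> 1) = std_basis \<sigma> 2"
    using \<sigma> by (auto simp: form_bracket_mat1 vec_eq_iff forall_4 matrix_matrix_mult_def sum_4
      std_basis_nth forms2_lower[OF std_basis_forms2])
qed

lemma form_inner_std_basis: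
  assumes \<sigma>: "\<sigma> \<in> {1, - 1}"
  shows "form_inner (mat 1) (std_basis \<sigma> i) (std_basis \<sigma> j) = (if i = j then 1/2 else 0)"
  using \<sigma> exhaust_3[of i] exhaust_3[of j]
  by (auto simp: form_inner_def raise2_eq metric_mat1 matrix_inv_mat1 sum_4 std_basis_nth
      forms2_lower[OF std_basis_forms2])

text \<open>A positively oriented orthonormal coframe, formed by the rows of \<open>P\<close>. Congruence by \<open>P\<close>
  carries the Euclidean inner product, bracket and star to those of \<open>h\<close>.\<close>

locale metric_frame =
  fixes h P Q :: "real^4^4"
  assumes h: "metric_matrix h" and det_pos: "det P > 0" and hP: "h = transpose P ** P"
    and PQ: "P ** Q = mat 1" "Q ** P = mat 1" and inv: "matrix_inv h = Q ** transpose Q"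
begin

abbreviation pull :: "real^4^4 \<Rightarrow> real^4^4" where "pull E \<equiv> transpose P ** E ** P"

lemma PQt: "transpose Q ** transpose P = mat 1" "transpose P ** transpose Q = mat 1"
  by (simp_all only: PQ transpose_mat flip: transpose_distribs(5))

lemma cancel: "A ** P ** Q = A" "A ** Q ** P = A" "A ** transpose Q ** transpose P = A" "A **
    transpose P ** transpose Q = A"
  by (simp_all add: PQ PQt flip: matrix_mul_assoc)

lemma pull_forms2: "E \<in> forms2 \<Longrightarrow> pull E \<in> forms2"
  by (simp add: forms2_def matrix_ring)

lemma pull_surj: "\<omega> = pull (transpose Q ** \<omega> ** Q)"
  by (simp add: matrix_mul_assoc PQt cancel)

lemma push_forms2: "\<omega> \<in> forms2 \<Longrightarrow> transpose Q ** \<omega> ** Q \<in> forms2"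
  by (simp add: forms2_def matrix_ring)

lemma raise2_pull: "raise2 h (pull E) = Q ** E ** transpose Q"
  by (simp add: raise2_eq[OF h] inv matrix_mul_assoc cancel)

lemma form_inner_pull: "form_inner h (pull A) (pull B) = form_inner (mat 1) A B"
proof -
  have "trace (raise2 h (pull A) ** transpose (pull B)) = trace (Q ** (A ** transpose B ** P))"
    by (simp add: raise2_pull transpose_distribs matrix_mul_assoc cancel)
  also have "\<dots> = trace (A ** transpose B ** P ** Q)" by (rule trace_mul_sym)
  finally show ?thesis by (simp add: form_inner_trace raise2_eq metric_mat1 matrix_inv_mat1 cancel)
qed

lemma sqrt_det: "sqrt (det h) = det P"
  using det_pos by (simp add: hP det_mul)

lemma self_dual_pull: 
  assumes "E \<in> forms2" shows "pull E \<in> self_dual \<sigma> h \<longleftrightarrow> E \<in> self_dual \<sigma> (mat 1)"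
proof -
  have all: "(\<forall>\<eta>\<in>forms2. F \<eta>) \<longleftrightarrow> (\<forall>\<eta>\<in>forms2. F (pull \<eta>))" for F
    using pull_surj push_forms2 pull_forms2 by metis
  show ?thesis
    unfolding self_dual_def mem_Collect_eq all[of "\<lambda>\<eta>. wedge22 \<eta> (pull E) = _ \<eta>"]
    using det_pos assms by (auto simp: pull_forms2 form_inner_pull sqrt_det wedge22_congruence)
qed

lemma form_bracket_pull: "form_bracket h (pull A) (pull B) = pull (form_bracket (mat 1) A B)"
  by (simp add: form_bracket_def inv matrix_inv_mat1 matrix_ring cancel)

lemma pull_sum: "(\<Sum>i\<in>UNIV. x i *\<^sub>R pull (b i)) = pull (\<Sum>i\<in>UNIV. x i *\<^sub>R b (i::3))"
  by (simp add: sum_3 matrix_mult_distribs)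

lemma so3_basis_pull:
  assumes "so3_basis (form_bracket (mat 1)) (self_dual \<sigma> (mat 1)) b"
  shows "so3_basis (form_bracket h) (self_dual \<sigma> h) (\<lambda>i. pull (b i))"
proof -
  have b: "basis3 (self_dual \<sigma> (mat 1)) b" using assms by (simp add: so3_basis_def)
  have "basis3 (self_dual \<sigma> h) (\<lambda>i. pull (b i))"
  proof (rule basis3I)
    fix x assume "(\<Sum>i\<in>UNIV. x i *\<^sub>R pull (b i)) = 0"
    then have "transpose Q ** pull (\<Sum>i\<in>UNIV. x i *\<^sub>R b i) ** Q = 0" by (simp add: pull_sum
        matrix_mult_distribs)
    then have "(\<Sum>i\<in>UNIV. x i *\<^sub>R b i) = 0" by (simp add: matrix_mul_assoc PQt cancel)
    then show "\<forall>i. x i = 0" using basis3_independent[OF b] by blast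
  next
    fix v
    show "v \<in> self_dual \<sigma> h \<longleftrightarrow> (\<exists>x. v = (\<Sum>i\<in>UNIV. x i *\<^sub>R pull (b i)))"
    proof
      assume v: "v \<in> self_dual \<sigma> h"
      define E where "E = transpose Q ** v ** Q"
      have E: "v = pull E" unfolding E_def by (rule pull_surj)
      have "E \<in> self_dual \<sigma> (mat 1)"
        using self_dual_pull[of E \<sigma>] v push_forms2[OF self_dual_forms2[OF v]] E unfolding E_def by simp
      then obtain x where "E = (\<Sum>i\<in>UNIV. x i *\<^sub>R b i)" by (rule basis3_expand[OF b])
      then show "\<exists>x. v = (\<Sum>i\<in>UNIV. x i *\<^sub>R pull (b i))" using E by (auto simp: pull_sum)
    next
      assume "\<exists>x. v = (\<Sum>i\<in>UNIV. x i *\<^sub>R pull (b i))"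
      then obtain x where "v = pull (\<Sum>i\<in>UNIV. x i *\<^sub>R b i)" by (auto simp: pull_sum)
      then show "v \<in> self_dual \<sigma> h"
        using basis3_mem[OF b, of x] self_dual_pull[OF self_dual_forms2] by blast
    qed
  qed
  then show ?thesis using assms by (simp add: so3_basis_def form_bracket_pull)
qed

end

lemma metric_frame_exists:
  assumes "metric_matrix h" obtains P Q where "metric_frame h P Q"
  by (rule metric_frame_inverse[OF assms]) (use assms that in \<open>auto simp: metric_frame_def\<close>)

lemma so3_basis_exists:
  assumes h: "metric_matrix h" and \<sigma>: "\<sigma> \<in> {1, - 1}"
  obtains b where "so3_basis (form_bracket h) (self_dual \<sigma> h) b"
    "\<And>i j. form_inner h (b i) (b j) = (if i = j then 1/2 else 0)"
proof -
  obtain P Q where "metric_frame h P Q" using metric_frame_exists[OF h] .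
  then interpret metric_frame h P Q .
  show ?thesis
    using that[OF so3_basis_pull[OF so3_basis_std[OF \<sigma>]]] form_inner_pull form_inner_std_basis[OF
        \<sigma>] by simp
qed

lemma oriented_basis:
  assumes "metric_matrix h" "\<sigma> \<in> {1, - 1}"
  shows "so3_basis (form_bracket h) (self_dual \<sigma> h) (oriented_basis \<sigma> h)"
proof -
  obtain b where "so3_basis (form_bracket h) (self_dual \<sigma> h) b" by (rule so3_basis_exists[OF assms])
  then show ?thesis unfolding oriented_basis_def by (rule someI[of "so3_basis (form_bracket h)
      (self_dual \<sigma> h)" b])
qed

lemma dim_self_dual:
  assumes "metric_matrix h" "\<sigma> \<in> {1, - 1}" shows "dim (self_dual \<sigma> h) = 3"
  using oriented_basis[OF assms] basis3_dim by (auto simp: so3_basis_def)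

lemma form_frame:
  assumes h: "metric_matrix h"
  shows "basis3 (self_dual 1 h) (form_frame h)"
    "form_inner h (form_frame h i) (form_frame h j) = (if i = j then 1 else 0)"
proof -
  obtain b where b: "so3_basis (form_bracket h) (self_dual 1 h) b"
    "\<And>i j. form_inner h (b i) (b j) = (if i = j then 1/2 else 0)"
    using so3_basis_exists[OF h, of 1] by auto
  then have B: "basis3 (self_dual 1 h) b" by (simp add: so3_basis_def)
  let ?f = "\<lambda>i. sqrt 2 *\<^sub>R b i"
  have "basis3 (self_dual 1 h) ?f"
  proof (rule basis3I_coefficients)
    fix x assume "(\<Sum>i\<in>UNIV. x i *\<^sub>R ?f i) = 0"
    then show "\<forall>i. x i = 0" using basis3_independent[OF B, of "\<lambda>i. x i * sqrt 2"] by simp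
  next
    fix v assume "v \<in> self_dual 1 h"
    from basis3_representation_expand[OF B this]
    show "v = (\<Sum>i\<in>UNIV. (representation (range b) v (b i) / sqrt 2) *\<^sub>R ?f i)" by simp
  next
    fix x show "(\<Sum>i\<in>UNIV. x i *\<^sub>R ?f i) \<in> self_dual 1 h"
      using basis3_mem[OF B, of "\<lambda>i. x i * sqrt 2"] by simp
  qed
  moreover have "form_inner h (?f i) (?f j) = (if i = j then 1 else 0)" for i j by (simp add: b)
  ultimately have "\<exists>f. basis3 (self_dual 1 h) f \<and> (\<forall>i j. form_inner h (f i) (f j) = (if i = j then
      1 else 0))"
    by (intro exI[of _ ?f]) simp
  from someI_ex[OF this] show "basis3 (self_dual 1 h) (form_frame h)"
    "form_inner h (form_frame h i) (form_frame h j) = (if i = j then 1 else 0)"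
    unfolding form_frame_def by blast+
qed

section \<open>The conformal structure of a definite space of two-forms\<close>

text \<open>This provides the conformal structure induced by a definite connection.\<close>

lemma metric_of_definite_space:
  assumes \<sigma>: "\<sigma> \<in> {1, - 1}" and V: "subspace V" "V \<subseteq> forms2" and b: "basis3 V b"
    and pos: "\<And>\<omega>. \<omega> \<in> V \<Longrightarrow> \<omega> \<noteq> 0 \<Longrightarrow> \<sigma> * wedge22 \<omega> \<omega> > 0"
  obtains h where "metric_matrix h" "self_dual \<sigma> h = V"
proof -
  obtain w :: "3 \<Rightarrow> real^4^4" where w: "\<And>i. w i \<in> V" "\<And>i j. wedge22 (w i) (w j) = (if i = j then 2
      * \<sigma> else 0)"
    using wedge_orthonormal_family[OF \<sigma> V(1) b pos] by blast
  obtain h where h: "metric_matrix h" "\<And>i. w i \<in> self_dual \<sigma> h"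
    using metric_of_orthonormal_triple[OF \<sigma> _ w(2)] w(1) V(2) by blast
  have "basis3 (span (range w)) w"
  proof (rule basis3I)
    fix x assume 0: "(\<Sum>i\<in>UNIV. x i *\<^sub>R w i) = 0"
    have "x j * (2 * \<sigma>) = wedge22 (\<Sum>i\<in>UNIV. x i *\<^sub>R w i) (w j)" for j
      using exhaust_3[of j] by (auto simp: sum_3 w(2))
    then show "\<forall>i. x i = 0" using \<sigma> by (auto simp: 0)
  next
    fix v
    have "span (range w) = {\<Sum>i\<in>UNIV. x i *\<^sub>R w i | x. True}"
    proof safe
      fix v assume "v \<in> span (range w)"
      then show "\<exists>x. v = (\<Sum>i\<in>UNIV. x i *\<^sub>R w i) \<and> True"
      proof (induction rule: span_induct_alt)
        case base show ?case by (rule exI[of _ "\<lambda>_. 0"]) simp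
      next
        case (step c y z)
        then obtain i x where "y = w i" "z = (\<Sum>i\<in>UNIV. x i *\<^sub>R w i)" by auto
        then show ?case
          by (intro exI[of _ "\<lambda>j. (if j = i then c else 0) + x j"])
            (simp add: scaleR_add_left sum.distrib if_distrib[of "\<lambda>r. r *\<^sub>R _"] cong: if_cong)
      qed
    qed (auto intro!: span_sum span_scale intro: span_base)
    then show "v \<in> span (range w) \<longleftrightarrow> (\<exists>x. v = (\<Sum>i\<in>UNIV. x i *\<^sub>R w i))" by auto
  qed
  then have d: "dim (span (range w)) = 3" by (rule basis3_dim)
  have sub: "span (range w) \<subseteq> V" "span (range w) \<subseteq> self_dual \<sigma> h"
    by (rule span_minimal[OF _ V(1)], use w(1) in blast) (rule span_minimal[OF _
        subspace_self_dual], use h(2) in blast)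
  have "span (range w) = V"
    by (rule subspace_dim_equal) (use d basis3_dim[OF b] V(1) sub(1) in simp_all)
  moreover have "span (range w) = self_dual \<sigma> h"
    by (rule subspace_dim_equal) (use d dim_self_dual[OF h(1) \<sigma>] subspace_self_dual sub(2) in simp_all)
  ultimately show ?thesis using that h(1) by simp
qed

text \<open>The wedge product is symmetric, but it equals the inner product times the volume when the
  self-dual factor is used to evaluate it, and minus that when the anti-self-dual one is used.\<close>

lemma self_dual_orthogonal:
  assumes h: "metric_matrix h" and "\<omega> \<in> self_dual 1 h" "\<eta> \<in> self_dual (- 1) h"
  shows "wedge22 \<omega> \<eta> = 0" "form_inner h \<omega> \<eta> = 0"
proof -
  have "wedge22 \<omega> \<eta> = - sqrt (det h) * form_inner h \<omega> \<eta>" "wedge22 \<eta> \<omega> = sqrt (det h) * form_inner h \<eta> \<omega>"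
    using assms wedge22_self_dual self_dual_forms2 by force+
  then show "wedge22 \<omega> \<eta> = 0" "form_inner h \<omega> \<eta> = 0"
    using wedge22_commute[of \<omega> \<eta>] form_inner_commute[OF h, of \<omega> \<eta>] det_metric_pos[OF h] by auto
qed

section \<open>The Lie algebra of rotations\<close>

text \<open>Rotation generators: the matrix of the cross product with a unit vector.\<close>

definition so3_gen :: "3 \<Rightarrow> real^3^3" where
  "so3_gen i = (\<chi> a b. cross3 (axis i 1) (axis b 1) $ a)"

lemma so3_gen_combination: "(\<Sum>i\<in>UNIV. x $ i *\<^sub>R so3_gen i) = matrix (cross3 x)"
  by (simp add: so3_gen_def matrix_def vec_eq_iff forall_3 sum_3 cross3_def axis_def)

lemma commutator_so3_gen:
  "commutator (\<Sum>i\<in>UNIV. x $ i *\<^sub>R so3_gen i) (\<Sum>i\<in>UNIV. y $ i *\<^sub>R so3_gen i) = (\<Sum>i\<in>UNIV. cross3 x y $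
      i *\<^sub>R so3_gen i)"
proof -
  have lin: "linear (cross3 z)" for z
    by (rule linearI) (simp_all add: cross_add_right cross_mult_right)
  have "cross3 x (cross3 y z) - cross3 y (cross3 x z) = cross3 (cross3 x y) z" for z
    by (simp add: cross3_def vec_eq_iff forall_3) (simp add: algebra_simps)
  then have "commutator (matrix (cross3 x)) (matrix (cross3 y)) *v z = matrix (cross3 (cross3 x
      y)) *v z" for z
    by (simp add: commutator_def matrix_vector_mult_diff_rdistrib
        matrix_vector_mul_assoc[symmetric] matrix_works lin)
  then show ?thesis unfolding so3_gen_combination by (simp add: matrix_eq)
qed

lemma so3_sum_gen:
  assumes "M \<in> so3"
  shows "M = M$3$2 *\<^sub>R so3_gen 1 + M$1$3 *\<^sub>R so3_gen 2 + M$2$1 *\<^sub>R so3_gen 3"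
proof -
  have *: "M $ i $ j = - M $ j $ i" for i j
    using arg_cong[OF assms[unfolded so3_def mem_Collect_eq], of "\<lambda>A. A $ j $ i"] by (simp add:
        transpose_def)
  have "M $ i $ i = 0" for i using *[of i i] by simp
  with *[of 1 2] *[of 2 3] *[of 3 1] show ?thesis
    by (simp add: so3_gen_def vec_eq_iff forall_3 cross3_def axis_def)
qed

lemma basis3_so3_gen: "basis3 so3 so3_gen"
proof (rule basis3I_coefficients)
  fix x assume "(\<Sum>i\<in>UNIV. x i *\<^sub>R so3_gen i) = 0"
  then show "\<forall>i. x i = 0"
    by (simp add: so3_gen_def vec_eq_iff forall_3 sum_3 cross3_def axis_def)
next
  fix v assume "v \<in> so3"
  then show "v = (\<Sum>i\<in>UNIV. (if i = 1 then v$3$2 else if i = 2 then v$1$3 else v$2$1) *\<^sub>R so3_gen i)"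
    using so3_sum_gen[of v] by (simp add: sum_3)
next
  fix x show "(\<Sum>i\<in>UNIV. x i *\<^sub>R so3_gen i) \<in> so3"
    by (simp add: so3_def so3_gen_def vec_eq_iff forall_3 sum_3 cross3_def axis_def transpose_def)
qed

lemma so3_basis_so3_gen: "so3_basis commutator so3 so3_gen"
  unfolding so3_basis_def
  by (simp add: basis3_so3_gen)
    (simp add: commutator_def so3_gen_def vec_eq_iff forall_3 sum_3 matrix_matrix_mult_def
        cross3_def axis_def)

text \<open>In the coordinates given by \<open>so3_gen\<close> the bracket is the cross product, so the coordinate
  vectors of \<open>e\<close> satisfy \<open>n 3 = n 1 \<times> n 2\<close> and have determinant \<open>|n 3|\<^sup>2\<close>; the matrix in question
  is the inverse.\<close>

lemma so3_basis_orientation: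
  assumes e: "so3_basis commutator so3 e"
  shows "det (\<chi> i j. representation (range e) (so3_gen j) (e i) :: real^3^3) > 0"
proof -
  have E: "basis3 so3 e" and br: "commutator (e 1) (e 2) = e 3" using e by (simp_all add: so3_basis_def)
  define n where "n j = (\<chi> i. representation (range so3_gen) (e j) (so3_gen i))" for j
  have n: "e j = (\<Sum>i\<in>UNIV. n j $ i *\<^sub>R so3_gen i)" for j
    using basis3_representation_expand[OF basis3_so3_gen basis3_basis_mem[OF E]] by (simp add: n_def)
  let ?M = "\<chi> i j. representation (range e) (so3_gen j) (e i) :: real^3^3"
  let ?N = "\<chi> i j. n j $ i :: real^3^3"
  have "(\<Sum>i\<in>UNIV. (n 3 $ i - cross3 (n 1) (n 2) $ i) *\<^sub>R so3_gen i) = 0"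
    using br commutator_so3_gen[of "n 1" "n 2"] n by (simp add: scaleR_diff_left sum_subtractf)
  from basis3_independent[OF basis3_so3_gen this] have n3: "n 3 = cross3 (n 1) (n 2)" by (simp
      add: vec_eq_iff)
  have "e 3 \<noteq> 0" using E dependent_zero unfolding basis3_def by (metis rangeI)
  then have "n 3 \<noteq> 0" using n[of 3] by auto
  moreover have "det ?N = n 3 \<bullet> cross3 (n 1) (n 2)"
    by (simp add: det_3 cross3_simps)
  ultimately have N: "det ?N > 0" using n3 by simp
  have M: "so3_gen j = (\<Sum>i\<in>UNIV. ?M $ i $ j *\<^sub>R e i)" for j
    using basis3_representation_expand[OF E basis3_basis_mem[OF basis3_so3_gen]] by simp
  have "?M ** ?N = mat 1"
  proof -
    have "(?M ** ?N) $ k $ j = (if k = j then 1 else 0)" for k j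
    proof -
      have "(\<Sum>i\<in>UNIV. ((?M ** ?N) $ i $ j - (if i = j then 1 else 0)) *\<^sub>R e i) = (\<Sum>i\<in>UNIV. (?M **
          ?N) $ i $ j *\<^sub>R e i) - e j"
        by (simp add: scaleR_diff_left sum_subtractf if_distrib[of "\<lambda>r. r *\<^sub>R _"] cong: if_cong)
      also have "(\<Sum>i\<in>UNIV. (?M ** ?N) $ i $ j *\<^sub>R e i) = (\<Sum>l\<in>UNIV. n j $ l *\<^sub>R (\<Sum>i\<in>UNIV. ?M $ i $ l
          *\<^sub>R e i))"
        by (simp add: matrix_matrix_mult_def sum_3 algebra_simps)
      also have "\<dots> = e j" by (simp only: M[symmetric] n[symmetric])
      finally show ?thesis using basis3_independent[OF E] by force
    qed
    then show ?thesis by (simp add: vec_eq_iff mat_def)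
  qed
  then have "det ?M * det ?N = 1" by (metis det_I det_mul)
  then show ?thesis using N by (metis zero_less_mult_pos2 zero_less_one)
qed

section \<open>The curvature operator and its blocks\<close>

text \<open>The derivative, at the identity, of the transformation law of \<open>wedge_dual\<close> under congruence.\<close>

lemma wedge_dual_derivation:
  assumes "\<omega> \<in> forms2"
  shows "wedge_dual (S ** \<omega> + \<omega> ** transpose S) = trace S *\<^sub>R wedge_dual \<omega> - transpose S **
      wedge_dual \<omega> - wedge_dual \<omega> ** S"
  by (simp add: vec_eq_iff forall_4 matrix_matrix_mult_def sum_4 transpose_def trace_def wedge_dual_nth
     forms2_lower[OF assms] forms2_lower[OF wedge_dual_forms2] algebra_simps)

text \<open>The curvature operator, given by the matrices \<open>K c d\<close> which are its values on
  \<open>e\<^sub>c \<and> e\<^sub>d\<close>, preserves self-dual forms up to the Ricci term. In an orthonormal frame this is a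
  linear identity in the components, of which the simplest instance is
  \<open>K\<^sub>1\<^sub>2\<^sub>1\<^sub>2 - K\<^sub>3\<^sub>4\<^sub>3\<^sub>4 = (N\<^sub>1\<^sub>1 + N\<^sub>2\<^sub>2 - N\<^sub>3\<^sub>3 - N\<^sub>4\<^sub>4) / 2\<close>.\<close>

lemma weyl_part_self_dual:
  assumes K: "\<And>c d. K c d \<in> forms2" and skew: "\<And>c d. K d c = - K c d"
    and pair: "\<And>a b c d. K c d $ a $ b = K a b $ c $ d"
    and N: "N = (\<chi> b d. \<Sum>a\<in>UNIV. K a d $ a $ b)"
    and E: "E \<in> self_dual 1 (mat 1)"
  shows "(1/2) *\<^sub>R (\<Sum>c\<in>UNIV. \<Sum>d\<in>UNIV. E $ c $ d *\<^sub>R K c d) - ((1/2) *\<^sub>R (N ** E + E ** N) - (trace N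
      / 4) *\<^sub>R E)
    \<in> self_dual 1 (mat 1)"
proof -
  have Ef: "E \<in> forms2" and E': "E$3$4 = E$1$2" "E$2$4 = - E$1$3" "E$2$3 = E$1$4"
    using E by (simp_all add: self_dual_mat1)
  have K0: "K c c = 0" for c
  proof -
    have "K c c $ i $ j = 0" for i j using arg_cong[OF skew[of c c], of "\<lambda>A. A $ i $ j"] by simp
    then show ?thesis by (simp add: vec_eq_iff)
  qed
  have Kl: "K 2 1 = - K 1 2" "K 3 1 = - K 1 3" "K 4 1 = - K 1 4" "K 3 2 = - K 2 3" "K 4 2 = - K 2
      4" "K 4 3 = - K 3 4"
    by (rule skew)+
  have p: "K 1 3 $ 1 $ 2 = K 1 2 $ 1 $ 3" "K 1 4 $ 1 $ 2 = K 1 2 $ 1 $ 4" "K 2 3 $ 1 $ 2 = K 1 2 $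
      2 $ 3"
    "K 2 4 $ 1 $ 2 = K 1 2 $ 2 $ 4" "K 3 4 $ 1 $ 2 = K 1 2 $ 3 $ 4" "K 1 4 $ 1 $ 3 = K 1 3 $ 1 $ 4"
    "K 2 3 $ 1 $ 3 = K 1 3 $ 2 $ 3" "K 2 4 $ 1 $ 3 = K 1 3 $ 2 $ 4" "K 3 4 $ 1 $ 3 = K 1 3 $ 3 $ 4"
    "K 2 3 $ 1 $ 4 = K 1 4 $ 2 $ 3" "K 2 4 $ 1 $ 4 = K 1 4 $ 2 $ 4" "K 3 4 $ 1 $ 4 = K 1 4 $ 3 $ 4"
    "K 2 4 $ 2 $ 3 = K 2 3 $ 2 $ 4" "K 3 4 $ 2 $ 3 = K 2 3 $ 3 $ 4" "K 3 4 $ 2 $ 4 = K 2 4 $ 3 $ 4"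
    by (rule pair)+
  have Nt: "transpose N = N"
  proof -
    have "(\<Sum>a\<in>UNIV. K a b $ a $ d) = (\<Sum>a\<in>UNIV. K a d $ a $ b)" for b d
      by (rule sum.cong[OF refl], rule pair)
    then show ?thesis by (simp add: N vec_eq_iff transpose_def)
  qed
  have "(1/2) *\<^sub>R (\<Sum>c\<in>UNIV. \<Sum>d\<in>UNIV. E $ c $ d *\<^sub>R K c d) \<in> forms2"
    by (intro subspace_scale subspace_sum subspace_forms2 K)
  moreover have "N ** E + E ** N \<in> forms2"
    using forms2_transpose[OF Ef] by (simp add: forms2_def transpose_distribs Nt matrix_mult_distribs)
  ultimately have f: "(1/2) *\<^sub>R (\<Sum>c\<in>UNIV. \<Sum>d\<in>UNIV. E $ c $ d *\<^sub>R K c d) - ((1/2) *\<^sub>R (N ** E + E **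
      N) - (trace N / 4) *\<^sub>R E) \<in> forms2"
    by (intro subspace_diff[OF subspace_forms2] subspace_scale[OF subspace_forms2, of "N ** E + E ** N"]
        subspace_scale[OF subspace_forms2 Ef])
  show ?thesis
    unfolding self_dual_mat1[of 1, simplified]
    by (intro conjI f; simp add: sum_4 Kl K0 matrix_matrix_mult_def trace_def N forms2_lower[OF K]
        p forms2_lower[OF Ef] E' field_simps)
qed

lemma form_inner_wedge_axis:
  "\<eta> \<in> forms2 \<Longrightarrow> form_inner (mat 1) (wedge11 (axis a 1) (axis b 1)) \<eta> = \<eta> $ a $ b"
  using exhaust_4[of a] exhaust_4[of b]
  by (auto simp: form_inner_def raise2_eq metric_mat1 matrix_inv_mat1 sum_4 wedge11_def axis_def
      forms2_lower)

lemma mat_scaleR: "mat r = r *\<^sub>R (mat 1 :: real^'n^'n)"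
  by (simp add: mat_def vec_eq_iff)

text \<open>The algebraic properties of the Riemann tensor at a point: \<open>\<rho> k l $ i $ j\<close> is \<open>R\<^sub>i\<^sub>j\<^sub>k\<^sub>l\<close>.\<close>

locale curvature_tensor =
  fixes h :: "real^4^4" and \<rho> :: "4 \<Rightarrow> 4 \<Rightarrow> real^4^4"
  assumes h: "metric_matrix h"
    and rho_forms2: "\<rho> k l \<in> forms2"
    and rho_skew: "\<rho> l k = - \<rho> k l"
    and rho_bianchi: "\<rho> k l $ i $ j + \<rho> l j $ i $ k + \<rho> j k $ i $ l = 0"
begin

text \<open>The octahedron argument: the four cyclic sums, taken with suitable signs, leave twice the
  difference of the two sides.\<close>

lemma rho_pair: "\<rho> k l $ i $ j = \<rho> i j $ k $ l"
proof -
  have s1: "\<rho> a b $ d $ c = - \<rho> a b $ c $ d" for a b c d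
    using rho_forms2[of a b] unfolding forms2_iff by blast
  have s2: "\<rho> b a $ c $ d = - \<rho> a b $ c $ d" for a b c d
    using rho_skew[of b a] by simp
  show ?thesis
    using rho_bianchi[of k l i j] rho_bianchi[of l i j k] rho_bianchi[of i j k l] rho_bianchi[of j
        k l i]
      s1[of k l i j] s1[of j l k i] s2[of j l i k] s1[of l i k j] s1[of j k l i] s1[of k i l j]
          s2[of k i j l] s1[of i j l k]
    by linarith
qed

definition Rm :: "real^4^4 \<Rightarrow> real^4^4" where
  "Rm \<omega> = (\<chi> i j. form_inner h \<omega> (\<rho> i j))"

lemma Rm_nth: "Rm \<omega> $ i $ j = (1/2) * (\<Sum>k\<in>UNIV. \<Sum>l\<in>UNIV. \<rho> k l $ i $ j * raise2 h \<omega> $ k $ l)"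
  by (simp add: Rm_def form_inner_def rho_pair[of i j] mult.commute)

lemma Rm_linear: "Rm (a + b) = Rm a + Rm b" "Rm (r *\<^sub>R a) = r *\<^sub>R Rm a"
  by (simp_all add: Rm_def vec_eq_iff)

lemma Rm_forms2: "Rm \<omega> \<in> forms2"
  unfolding forms2_iff
proof (intro allI)
  fix i j show "Rm \<omega> $ j $ i = - Rm \<omega> $ i $ j"
    unfolding Rm_def by (simp add: rho_skew[of j i])
qed

lemma Rm_sum: "Rm \<eta> = (1/2) *\<^sub>R (\<Sum>i\<in>UNIV. \<Sum>j\<in>UNIV. raise2 h \<eta> $ i $ j *\<^sub>R \<rho> i j)"
  by (simp add: vec_eq_iff Rm_nth mult.commute)

lemma Rm_symmetric: "form_inner h (Rm \<omega>) \<eta> = form_inner h \<omega> (Rm \<eta>)"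
proof -
  have lin: "linear (form_inner h \<omega>)" by (rule linearI) simp_all
  have "form_inner h (Rm \<omega>) \<eta> = form_inner h \<eta> (Rm \<omega>)" by (rule form_inner_commute[OF h])
  also have "\<dots> = (1/2) * (\<Sum>i\<in>UNIV. \<Sum>j\<in>UNIV. raise2 h \<eta> $ i $ j * form_inner h \<omega> (\<rho> i j))"
    by (simp add: form_inner_def[of h \<eta>] Rm_def)
  also have "\<dots> = form_inner h \<omega> (Rm \<eta>)"
    by (simp add: Rm_sum linear_sum[OF lin])
  finally show ?thesis .
qed

definition ric :: "real^4^4" where
  "ric = (\<chi> j l. \<Sum>i\<in>UNIV. (matrix_inv h ** \<rho> i l) $ i $ j)"

lemma ric_symmetric: "transpose ric = ric"
proof -
  have X: "matrix_inv h $ i $ m = matrix_inv h $ m $ i" for i m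
    using arg_cong[OF metric_inverse(3)[OF h], of "\<lambda>A. A $ m $ i"] by (simp add: transpose_def)
  have "ric $ j $ l = ric $ l $ j" for j l
  proof -
    have "ric $ j $ l = (\<Sum>i\<in>UNIV. \<Sum>m\<in>UNIV. matrix_inv h $ i $ m * \<rho> i l $ m $ j)"
      by (simp add: ric_def matrix_matrix_mult_def)
    also have "\<dots> = (\<Sum>i\<in>UNIV. \<Sum>m\<in>UNIV. matrix_inv h $ m $ i * \<rho> m j $ i $ l)"
      by (simp only: X rho_pair[of _ l])
    also have "\<dots> = (\<Sum>m\<in>UNIV. \<Sum>i\<in>UNIV. matrix_inv h $ m $ i * \<rho> m j $ i $ l)"
      by (rule sum.swap)
    also have "\<dots> = ric $ l $ j" by (simp add: ric_def matrix_matrix_mult_def)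
    finally show ?thesis .
  qed
  then show ?thesis by (simp add: vec_eq_iff transpose_def)
qed

definition scal :: real where "scal = trace (matrix_inv h ** ric)"

text \<open>\<open>S0\<close> is the trace-free Ricci endomorphism of covectors and \<open>B\<close> the induced operator on
  two-forms. On self-dual forms \<open>A\<close> is \<open>W\<^sup>+ + s/12\<close>; it is introduced as the difference
  \<open>Rm - B\<close> because the curvature operator, unlike the Weyl tensor, has a short description.\<close>

definition S0 :: "real^4^4" where "S0 = ric ** matrix_inv h - mat (scal / 4)"

definition B :: "real^4^4 \<Rightarrow> real^4^4" where "B \<omega> = (1/2) *\<^sub>R (S0 ** \<omega> + \<omega> ** transpose S0)"

definition A :: "real^4^4 \<Rightarrow> real^4^4" where "A \<omega> = Rm \<omega> - B \<omega>"

lemma B_linear: "B (a + b) = B a + B b" "B (r *\<^sub>R a) = r *\<^sub>R B a"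
  by (simp_all add: B_def matrix_mult_distribs algebra_simps)

lemma A_linear: "A (a + b) = A a + A b" "A (r *\<^sub>R a) = r *\<^sub>R A a"
  by (simp_all add: A_def Rm_linear B_linear algebra_simps)

lemma Rm_eq: "Rm \<omega> = A \<omega> + B \<omega>" by (simp add: A_def)

lemma trace_mat: "trace (mat r :: real^4^4) = 4 * r"
  by (simp add: trace_def mat_def)

lemma trace_S0: "trace S0 = 0"
  using trace_mul_sym[of ric "matrix_inv h"] trace_sub[of "ric ** matrix_inv h" "mat (scal / 4)"]
  by (simp add: S0_def trace_mat scal_def)

text \<open>\<open>S0\<close> is symmetric with respect to \<open>h\<close>.\<close>

lemma S0_adjoint: "transpose S0 ** matrix_inv h = matrix_inv h ** S0"
  by (simp add: S0_def matrix_ring ric_symmetric metric_inverse[OF h] mat_scaleR[of "scal / 4"])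

lemma B_forms2: "\<omega> \<in> forms2 \<Longrightarrow> B \<omega> \<in> forms2"
  unfolding B_def
  by (rule subspace_scale[OF subspace_forms2]) (simp add: forms2_def transpose_distribs
      matrix_mult_distribs)

lemma A_forms2: "\<omega> \<in> forms2 \<Longrightarrow> A \<omega> \<in> forms2"
  unfolding A_def by (intro subspace_diff subspace_forms2 Rm_forms2 B_forms2)

text \<open>The derivation given by a trace-free symmetric endomorphism anticommutes with the star.\<close>

lemma B_self_dual:
  assumes w: "\<omega> \<in> self_dual \<sigma> h" shows "B \<omega> \<in> self_dual (- \<sigma>) h"
proof -
  let ?X = "matrix_inv h" and ?\<delta> = "\<sigma> * sqrt (det h)"
  have f: "\<omega> \<in> forms2" by (rule self_dual_forms2[OF w])
  have d: "wedge_dual \<omega> = ?\<delta> *\<^sub>R (?X ** \<omega> ** ?X)"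
    using w by (simp add: self_dual_iff[OF f h] raise2_eq[OF h])
  have "transpose S0 ** (?X ** \<omega> ** ?X) = ?X ** (S0 ** \<omega>) ** ?X"
    by (simp add: matrix_mul_assoc S0_adjoint)
  moreover have "(?X ** \<omega> ** ?X) ** S0 = ?X ** (\<omega> ** transpose S0) ** ?X"
    by (simp add: S0_adjoint flip: matrix_mul_assoc)
  ultimately have "wedge_dual (B \<omega>) = (- ?\<delta> / 2) *\<^sub>R (?X ** (S0 ** \<omega>) ** ?X + ?X ** (\<omega> ** transpose
      S0) ** ?X)"
    using wedge_dual_derivation[OF f, of S0]
    by (simp only: B_def wedge_dual_linear(2) trace_S0 d matrix_mult_distribs) (simp add: algebra_simps)
  then show ?thesis
    unfolding self_dual_iff[OF B_forms2[OF f] h] raise2_eq[OF h]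
    by (simp add: B_def matrix_mult_distribs algebra_simps)
qed

text \<open>Transport to an orthonormal frame reduces this to the component computation in
  \<open>weyl_part_self_dual\<close>. What has to be checked is that the Ricci matrix of the transported
  operator \<open>K\<close> is the transported Ricci matrix, which amounts to \<open>matrix_inv h = Q Q\<^sup>T\<close>.\<close>

lemma A_self_dual:
  assumes w: "\<omega> \<in> self_dual 1 h" shows "A \<omega> \<in> self_dual 1 h"
proof -
  obtain P Q where "metric_frame h P Q" using metric_frame_exists[OF h] .
  then interpret metric_frame h P Q .
  let ?e = "\<lambda>c d. wedge11 (axis c 1) (axis d 1 :: real^4)"
  define K where "K c d = transpose Q ** Rm (pull (?e c d)) ** Q" for c d
  define E where "E = transpose Q ** \<omega> ** Q"
  have E: "\<omega> = pull E" unfolding E_def by (rule pull_surj)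
  have Ef: "E \<in> forms2" unfolding E_def by (rule push_forms2[OF self_dual_forms2[OF w]])
  have Esd: "E \<in> self_dual 1 (mat 1)" using w self_dual_pull[OF Ef] E by simp
  have Kf: "K c d \<in> forms2" for c d unfolding K_def by (rule push_forms2[OF Rm_forms2])
  have e_skew: "?e d c = (- 1) *\<^sub>R ?e c d" for c d by (simp add: wedge11_def vec_eq_iff)
  have K_skew: "K d c = - K c d" for c d
    unfolding K_def by (subst e_skew) (simp only: matrix_mult_distribs Rm_linear, simp)
  have pullK: "pull (K c d) = Rm (pull (?e c d))" for c d
    unfolding K_def by (rule pull_surj[symmetric])
  have "K c d $ a $ b = form_inner h (pull (?e a b)) (Rm (pull (?e c d)))" for a b c d
    using form_inner_wedge_axis[OF Kf, of a b c d] by (simp only: form_inner_pull[symmetric] pullK)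
  then have K_pair: "K c d $ a $ b = K a b $ c $ d" for a b c d
    by (metis Rm_symmetric form_inner_commute[OF h])
  let ?N = "transpose Q ** ric ** Q"
  have N: "?N = (\<chi> b d. \<Sum>a\<in>UNIV. K a d $ a $ b)"
  proof -
    have "Rm (pull (?e a d)) = (\<Sum>k\<in>UNIV. \<Sum>l\<in>UNIV. (Q$k$a * Q$l$d) *\<^sub>R \<rho> k l)" for a d
    proof -
      have q: "(Q ** ?e a d ** transpose Q) $ k $ l = Q$k$a * Q$l$d - Q$k$d * Q$l$a" for k l
        using exhaust_4[of a] exhaust_4[of d]
        by (auto simp: matrix_matrix_mult_def sum_4 wedge11_def axis_def transpose_def)
      have "Rm (pull (?e a d)) = (1/2) *\<^sub>R ((\<Sum>k\<in>UNIV. \<Sum>l\<in>UNIV. (Q$k$a * Q$l$d) *\<^sub>R \<rho> k l) -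
          (\<Sum>k\<in>UNIV. \<Sum>l\<in>UNIV. (Q$k$d * Q$l$a) *\<^sub>R \<rho> k l))"
        by (simp add: Rm_sum raise2_pull q scaleR_diff_left sum_subtractf)
      also have "(\<Sum>k\<in>UNIV. \<Sum>l\<in>UNIV. (Q$k$d * Q$l$a) *\<^sub>R \<rho> k l) = (\<Sum>l\<in>UNIV. \<Sum>k\<in>UNIV. (Q$k$d * Q$l$a)
          *\<^sub>R \<rho> k l)"
        by (rule sum.swap)
      also have "\<dots> = - (\<Sum>k\<in>UNIV. \<Sum>l\<in>UNIV. (Q$k$a * Q$l$d) *\<^sub>R \<rho> k l)"
      proof -
        have "(Q$j$d * Q$i$a) *\<^sub>R \<rho> j i = - ((Q$i$a * Q$j$d) *\<^sub>R \<rho> i j)" for i j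
          by (simp add: rho_skew[of j i] mult.commute)
        then show ?thesis by (simp only: sum_negf)
      qed
      finally show ?thesis by (simp only: diff_minus_eq_add scaleR_half_double)
    qed
    then have "K a d = (\<Sum>k\<in>UNIV. \<Sum>l\<in>UNIV. (Q$k$a * Q$l$d) *\<^sub>R (transpose Q ** \<rho> k l ** Q))" for a d
      by (simp add: K_def sum_4 matrix_mult_distribs)
    then have "(\<Sum>a\<in>UNIV. K a d $ a $ b) = (\<Sum>a\<in>UNIV. \<Sum>k\<in>UNIV. \<Sum>l\<in>UNIV. (Q$k$a * Q$l$d) * (transpose
        Q ** \<rho> k l ** Q) $ a $ b)" for b d
      by simp
    also have "\<dots> b d = (\<Sum>k\<in>UNIV. \<Sum>a\<in>UNIV. \<Sum>l\<in>UNIV. (Q$k$a * Q$l$d) * (transpose Q ** \<rho> k l ** Q) $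
        a $ b)" for b d
      by (rule sum.swap)
    also have "\<dots> b d = (\<Sum>k\<in>UNIV. \<Sum>l\<in>UNIV. \<Sum>a\<in>UNIV. (Q$k$a * Q$l$d) * (transpose Q ** \<rho> k l ** Q) $
        a $ b)" for b d
      by (rule sum.cong[OF refl], rule sum.swap)
    also have "\<dots> b d = (\<Sum>k\<in>UNIV. \<Sum>l\<in>UNIV. Q$l$d * (matrix_inv h ** \<rho> k l ** Q) $ k $ b)" for b d
    proof (intro sum.cong refl)
      fix k l
      have "(matrix_inv h ** \<rho> k l ** Q) $ k $ b = (Q ** (transpose Q ** \<rho> k l ** Q)) $ k $ b"
        by (simp add: inv matrix_mul_assoc)
      also have "\<dots> = (\<Sum>a\<in>UNIV. Q$k$a * (transpose Q ** \<rho> k l ** Q) $ a $ b)"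
        by (simp add: matrix_matrix_mult_def[of Q])
      finally show "(\<Sum>a\<in>UNIV. (Q$k$a * Q$l$d) * (transpose Q ** \<rho> k l ** Q) $ a $ b) = Q$l$d *
          (matrix_inv h ** \<rho> k l ** Q) $ k $ b"
        by (simp add: sum_distrib_left mult_ac)
    qed
    also have "\<dots> b d = (\<Sum>k\<in>UNIV. \<Sum>l\<in>UNIV. \<Sum>j\<in>UNIV. Q$l$d * ((matrix_inv h ** \<rho> k l) $ k $ j * Q $
        j $ b))" for b d
      by (simp add: matrix_matrix_mult_def[of _ Q] sum_distrib_left)
    also have "\<dots> b d = (\<Sum>l\<in>UNIV. \<Sum>k\<in>UNIV. \<Sum>j\<in>UNIV. Q$l$d * ((matrix_inv h ** \<rho> k l) $ k $ j * Q $
        j $ b))" for b d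
      by (rule sum.swap)
    also have "\<dots> b d = (\<Sum>l\<in>UNIV. \<Sum>j\<in>UNIV. \<Sum>k\<in>UNIV. Q$l$d * ((matrix_inv h ** \<rho> k l) $ k $ j * Q $
        j $ b))" for b d
      by (rule sum.cong[OF refl], rule sum.swap)
    also have "\<dots> b d = (\<Sum>l\<in>UNIV. \<Sum>j\<in>UNIV. Q$j$b * ric $ j $ l * Q$l$d)" for b d
      by (intro sum.cong refl) (simp add: ric_def sum_distrib_left sum_distrib_right mult_ac)
    also have "\<dots> b d = ?N $ b $ d" for b d
      by (simp add: matrix_matrix_mult_def transpose_def sum_distrib_right)
    finally show ?thesis by (simp add: vec_eq_iff)
  qed
  have trN: "trace ?N = scal"
    using trace_mul_sym[of "transpose Q ** ric" Q] by (simp add: scal_def inv matrix_mul_assoc)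
  have Nt: "pull (?N ** E) = ric ** matrix_inv h ** \<omega>" "pull (E ** ?N) = \<omega> ** matrix_inv h ** ric"
    by (simp_all add: E inv matrix_mul_assoc PQt cancel)
  have half: "(1/2) *\<^sub>R ((a - r *\<^sub>R w) + (b - r *\<^sub>R w)) = (1/2) *\<^sub>R (a + b) - r *\<^sub>R w" for a b w ::
      "real^4^4" and r
    by (simp add: vec_eq_iff field_simps)
  have Bw: "B \<omega> = pull ((1/2) *\<^sub>R (?N ** E + E ** ?N) - (trace ?N / 4) *\<^sub>R E)"
    unfolding matrix_mult_distribs Nt trN E[symmetric]
    using half[of "ric ** matrix_inv h ** \<omega>" "scal / 4" \<omega> "\<omega> ** matrix_inv h ** ric"]
    by (simp add: B_def S0_def matrix_ring ric_symmetric metric_inverse[OF h] mat_scaleR[of "scal / 4"])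
  have Eexp: "E = (1/2) *\<^sub>R (\<Sum>c\<in>UNIV. \<Sum>d\<in>UNIV. E $ c $ d *\<^sub>R ?e c d)"
    by (simp add: vec_eq_iff forall_4 sum_4 wedge11_def axis_def forms2_lower[OF Ef])
  have Rw: "Rm \<omega> = pull ((1/2) *\<^sub>R (\<Sum>c\<in>UNIV. \<Sum>d\<in>UNIV. E $ c $ d *\<^sub>R K c d))"
  proof -
    have "Rm \<omega> = Rm (pull ((1/2) *\<^sub>R (\<Sum>c\<in>UNIV. \<Sum>d\<in>UNIV. E $ c $ d *\<^sub>R ?e c d)))"
      unfolding E by (rule arg_cong[of E _ "\<lambda>E. Rm (pull E)", OF Eexp])
    also have "\<dots> = (1/2) *\<^sub>R (\<Sum>c\<in>UNIV. \<Sum>d\<in>UNIV. E $ c $ d *\<^sub>R pull (K c d))"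
      by (simp only: sum_4 matrix_mult_distribs Rm_linear pullK)
    finally show ?thesis by (simp only: sum_4 matrix_mult_distribs)
  qed
  note W = weyl_part_self_dual[OF Kf K_skew K_pair N Esd]
  have eq: "A \<omega> = pull ((1/2) *\<^sub>R (\<Sum>c\<in>UNIV. \<Sum>d\<in>UNIV. E $ c $ d *\<^sub>R K c d) - ((1/2) *\<^sub>R (?N ** E + E
      ** ?N) - (trace ?N / 4) *\<^sub>R E))"
    unfolding A_def Rw Bw by (simp only: matrix_mult_distribs)
  show ?thesis unfolding eq by (rule iffD2[OF self_dual_pull[OF self_dual_forms2[OF W]] W])
qed

text \<open>\<open>Rm\<close> is symmetric, and \<open>B\<close> maps into the orthogonal complement.\<close>

lemma A_symmetric:
  assumes "\<omega> \<in> self_dual 1 h" "\<eta> \<in> self_dual 1 h"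
  shows "form_inner h (A \<omega>) \<eta> = form_inner h \<omega> (A \<eta>)"
proof -
  have "form_inner h (B \<omega>) \<eta> = 0" "form_inner h \<omega> (B \<eta>) = 0"
    using self_dual_orthogonal(2)[OF h] B_self_dual assms form_inner_commute[OF h] by metis+
  then show ?thesis using Rm_symmetric[of \<omega> \<eta>] by (simp add: A_def)
qed

end

section \<open>The bracket on two-forms\<close>

lemma form_bracket_linear:
  "form_bracket h (a + b) c = form_bracket h a c + form_bracket h b c"
  "form_bracket h c (a + b) = form_bracket h c a + form_bracket h c b"
  "form_bracket h (r *\<^sub>R a) c = r *\<^sub>R form_bracket h a c"
  "form_bracket h c (r *\<^sub>R a) = r *\<^sub>R form_bracket h c a"
  by (simp_all add: form_bracket_def matrix_mult_distribs algebra_simps)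

lemma form_bracket_skew: "form_bracket h b a = - form_bracket h a b" "form_bracket h a a = 0"
  by (simp_all add: form_bracket_def)

lemma form_bracket_forms2:
  assumes h: "metric_matrix h" and "a \<in> forms2" "b \<in> forms2"
  shows "form_bracket h a b \<in> forms2"
  using assms(2,3) by (simp add: forms2_def form_bracket_def matrix_ring metric_inverse[OF h])

text \<open>Invariance of the trace form under the adjoint representation.\<close>

lemma form_inner_invariant:
  assumes h: "metric_matrix h" and f: "a \<in> forms2" "b \<in> forms2" "c \<in> forms2"
  shows "form_inner h (form_bracket h a b) c = form_inner h a (form_bracket h b c)"
proof -
  let ?X = "matrix_inv h"
  have tr: "form_inner h u w = - (1/2) * trace (?X ** u ** ?X ** w)" if "w \<in> forms2" for u w
    using that by (simp add: form_inner_trace raise2_eq[OF h] forms2_transpose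
        matrix_mult_distribs trace_def sum_negf)
  have "trace (?X ** (form_bracket h a b) ** ?X ** c) = trace (?X ** a ** ?X ** b ** ?X ** c) -
      trace (?X ** b ** ?X ** a ** ?X ** c)"
    by (simp add: form_bracket_def matrix_ring trace_sub)
  also have "trace (?X ** b ** ?X ** a ** ?X ** c) = trace (?X ** a ** ?X ** c ** ?X ** b)"
    using trace_mul_sym[of "?X ** b" "?X ** a ** ?X ** c"] by (simp add: matrix_mul_assoc)
  also have "trace (?X ** a ** ?X ** b ** ?X ** c) - \<dots> = trace (?X ** a ** ?X ** form_bracket h b c)"
    by (simp add: form_bracket_def matrix_ring trace_sub)
  finally show ?thesis using f form_bracket_forms2[OF h] by (simp add: tr)
qed

lemma form_bracket_self_dual:
  assumes h: "metric_matrix h" and \<sigma>: "\<sigma> \<in> {1, - 1}" and u: "u \<in> self_dual \<sigma> h" "w \<in> self_dual \<sigma> h"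
  shows "form_bracket h u w \<in> self_dual \<sigma> h"
proof -
  obtain b where b: "so3_basis (form_bracket h) (self_dual \<sigma> h) b" by (rule so3_basis_exists[OF h \<sigma>])
  then have B: "basis3 (self_dual \<sigma> h) b" and br: "form_bracket h (b 1) (b 2) = b 3" "form_bracket
      h (b 2) (b 3) = b 1" "form_bracket h (b 3) (b 1) = b 2"
    by (simp_all add: so3_basis_def)
  note S = subspace_self_dual[of \<sigma> h]
  have "form_bracket h (b i) (b j) \<in> self_dual \<sigma> h" for i j
    using exhaust_3[of i] exhaust_3[of j] basis3_basis_mem[OF B] subspace_0[OF S] subspace_neg[OF S]
      form_bracket_skew(1)[of h "b 2" "b 1"] form_bracket_skew(1)[of h "b 3" "b 2"]
          form_bracket_skew(1)[of h "b 1" "b 3"]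
    by (auto simp: br form_bracket_skew(2))
  moreover obtain x where "u = (\<Sum>i\<in>UNIV. x i *\<^sub>R b i)" by (rule basis3_expand[OF B u(1)])
  moreover obtain y where "w = (\<Sum>i\<in>UNIV. y i *\<^sub>R b i)" by (rule basis3_expand[OF B u(2)])
  ultimately show ?thesis
    by (simp add: sum_3 form_bracket_linear) (intro subspace_add[OF S] subspace_scale[OF S])
qed

lemma definite_triple_self_dual:
  assumes h: "metric_matrix h" and \<sigma>: "\<sigma> \<in> {1, - 1}" and b: "basis3 (self_dual \<sigma> h) b"
  shows "definite_triple \<sigma> b"
  unfolding definite_triple_def
proof (intro conjI allI impI)
  show "b i \<in> forms2" for i using self_dual_forms2 basis3_basis_mem[OF b] by blast
  fix x :: "3 \<Rightarrow> real" assume "\<exists>i. x i \<noteq> 0"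
  then have "(\<Sum>i\<in>UNIV. x i *\<^sub>R b i) \<noteq> 0" using basis3_independent[OF b] by blast
  then show "\<sigma> * wedge22 (\<Sum>i\<in>UNIV. x i *\<^sub>R b i) (\<Sum>i\<in>UNIV. x i *\<^sub>R b i) > 0"
    by (rule self_dual_wedge_nonzero[OF h \<sigma> basis3_mem[OF b]])
qed

text \<open>An orthonormal frame of \<open>\<Lambda>\<^sup>+\<close> satisfies the relations of \<open>so(3)\<close> up to a common factor, by
  invariance of the inner product; the sign of \<open>\<kappa>\<close> says whether the frame is positively
  oriented.\<close>

lemma form_frame_bracket:
  assumes h: "metric_matrix h" and v: "v \<noteq> 0"
  obtains \<kappa> where "\<kappa> \<noteq> 0"
    "form_bracket h (form_frame h 1) (form_frame h 2) = \<kappa> *\<^sub>R form_frame h 3"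
    "form_bracket h (form_frame h 2) (form_frame h 3) = \<kappa> *\<^sub>R form_frame h 1"
    "form_bracket h (form_frame h 3) (form_frame h 1) = \<kappa> *\<^sub>R form_frame h 2"
    "sgn (triple_form v (form_frame h 1) (form_frame h 2) (form_frame h 3)) = - sgn \<kappa>"
proof -
  define f where "f = form_frame h"
  have F: "basis3 (self_dual 1 h) f" and on: "form_inner h (f i) (f j) = (if i = j then 1 else 0)"
      for i j
    using form_frame[OF h] by (simp_all add: f_def)
  note mem = basis3_basis_mem[OF F]
  have ff: "f i \<in> forms2" for i using mem self_dual_forms2 by blast
  have expand: "w = (\<Sum>i\<in>UNIV. form_inner h w (f i) *\<^sub>R f i)" if w: "w \<in> self_dual 1 h" for w
  proof -
    obtain x where x: "w = (\<Sum>i\<in>UNIV. x i *\<^sub>R f i)" by (rule basis3_expand[OF F w])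
    have "form_inner h w (f j) = x j" for j
      using exhaust_3[of j] by (auto simp: x sum_3 on)
    then show ?thesis using x by simp
  qed
  let ?t = "\<lambda>i j k. form_inner h (form_bracket h (f i) (f j)) (f k)"
  have cyc: "?t i j k = ?t j k i" for i j k
    using form_inner_invariant[OF h ff ff ff, of i j k] form_inner_commute[OF h] by metis
  have zero: "?t i j i = 0" "?t i j j = 0" for i j
    using cyc[of i i j] cyc[of j j i] cyc[of i j i] cyc[of j i j] cyc[of i j j] by (simp_all add:
        form_bracket_skew(2))
  define \<kappa> where "\<kappa> = ?t 1 2 3"
  have br: "form_bracket h (f 1) (f 2) = \<kappa> *\<^sub>R f 3" "form_bracket h (f 2) (f 3) = \<kappa> *\<^sub>R f 1"
      "form_bracket h (f 3) (f 1) = \<kappa> *\<^sub>R f 2"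
  proof -
    have k: "?t 1 2 3 = \<kappa>" "?t 2 3 1 = \<kappa>" "?t 3 1 2 = \<kappa>"
      using cyc[of 1 2 3] cyc[of 2 3 1] by (simp_all only: \<kappa>_def)
    note e = expand[OF form_bracket_self_dual[OF h _ mem mem]]
    show "form_bracket h (f 1) (f 2) = \<kappa> *\<^sub>R f 3" by (subst e) (simp_all add: sum_3 zero k)
    show "form_bracket h (f 2) (f 3) = \<kappa> *\<^sub>R f 1" by (subst e) (simp_all add: sum_3 zero k)
    show "form_bracket h (f 3) (f 1) = \<kappa> *\<^sub>R f 2" by (subst e) (simp_all add: sum_3 zero k)
  qed
  have "f 3 \<noteq> 0" using on[of 3 3] by auto
  from sgn_triple_form_bracket[OF h _ v mem mem mem br(1) this]
  have s: "sgn (triple_form v (f 1) (f 2) (f 3)) = - sgn \<kappa>" by simp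
  have "triple_form v (f 1) (f 2) (f 3) \<noteq> 0"
    by (rule triple_form_nonzero[OF definite_triple_self_dual[OF h _ F] v]) simp
  then have "\<kappa> \<noteq> 0" using s by (auto simp: sgn_zero_iff)
  then show ?thesis using that br s by (simp add: f_def)
qed

section \<open>Image and sign of a definite connection\<close>

text \<open>In the basis of \<open>so(3)\<^sup>*\<close> dual to \<open>so3_gen\<close>, the curvature map takes the values
  \<open>\<kappa> *\<^sub>R F c\<close>.\<close>

lemma curvature_image_combinations:
  assumes \<Omega>: "\<And>k l. \<Omega> k l = (\<Sum>c\<in>UNIV. (\<kappa> * F c $ k $ l) *\<^sub>R so3_gen c)" and \<kappa>: "\<kappa> \<noteq> 0"
  shows "curvature_image \<Omega> = {\<Sum>c\<in>UNIV. x c *\<^sub>R F c | x. True}"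
proof safe
  fix w assume "w \<in> curvature_image \<Omega>"
  then obtain \<phi> where \<phi>: "linear \<phi>" "w = curvature_map \<Omega> \<phi>" by (auto simp: curvature_image_def)
  have "w = (\<Sum>c\<in>UNIV. (\<kappa> * \<phi> (so3_gen c)) *\<^sub>R F c)"
    by (simp add: \<phi>(2) curvature_map_def \<Omega> vec_eq_iff linear_sum[OF \<phi>(1)] linear_cmul[OF \<phi>(1)] mult_ac)
  then show "\<exists>x. w = (\<Sum>c\<in>UNIV. x c *\<^sub>R F c) \<and> True" by (intro exI[of _ "\<lambda>c. \<kappa> * \<phi> (so3_gen c)"]) simp
next
  fix x :: "3 \<Rightarrow> real"
  define \<phi> :: "real^3^3 \<Rightarrow> real" where "\<phi> M = (x 1 * M$3$2 + x 2 * M$1$3 + x 3 * M$2$1) / \<kappa>" for M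
  have lin: "linear \<phi>" by (rule linearI) (simp_all add: \<phi>_def add_divide_distrib algebra_simps)
  have "\<phi> (so3_gen c) = x c / \<kappa>" for c
    using exhaust_3[of c] by (auto simp: \<phi>_def so3_gen_def cross3_def axis_def)
  then have "(\<Sum>c\<in>UNIV. x c *\<^sub>R F c) = curvature_map \<Omega> \<phi>"
    using \<kappa> by (simp add: curvature_map_def \<Omega> vec_eq_iff linear_sum[OF lin] linear_cmul[OF lin]
        mult.commute)
  then show "(\<Sum>c\<in>UNIV. x c *\<^sub>R F c) \<in> curvature_image \<Omega>"
    using lin by (auto simp: curvature_image_def)
qed

lemma definite_triple_basis3:
  assumes "definite_triple \<sigma> F" shows "basis3 {\<Sum>c\<in>UNIV. x c *\<^sub>R F c | x. True} F"
proof (rule basis3I)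
  fix x :: "3 \<Rightarrow> real" assume "(\<Sum>c\<in>UNIV. x c *\<^sub>R F c) = 0"
  then show "\<forall>i. x i = 0" using assms by (force simp: definite_triple_def)
qed auto

text \<open>The induced orientation is determined by the sign of the wedge product on the image, so the
  one chosen in the definition is \<open>\<sigma>\<close>; by \<open>sgn_det_in_so3_basis\<close> the chosen metric does not matter
  either. The factor \<open>\<kappa>\<close> enters cubed, hence through its sign.\<close>

lemma connection_sign_eq:
  assumes \<Omega>: "\<And>k l. \<Omega> k l = (\<Sum>c\<in>UNIV. (\<kappa> * F c $ k $ l) *\<^sub>R so3_gen c)" and \<kappa>: "\<kappa> \<noteq> 0"
    and \<sigma>: "\<sigma> \<in> {1, - 1}" and F: "definite_triple \<sigma> F" and v: "v \<noteq> 0"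
  shows "induces_orientation \<Omega> \<sigma>"
    "connection_sign \<Omega> = - \<sigma> * sgn \<kappa> * sgn (triple_form v (F 1) (F 2) (F 3))"
proof -
  let ?V = "curvature_image \<Omega>"
  have V: "?V = {\<Sum>c\<in>UNIV. x c *\<^sub>R F c | x. True}" by (rule curvature_image_combinations[OF \<Omega> \<kappa>])
  have basis: "basis3 ?V F" unfolding V by (rule definite_triple_basis3[OF F])
  then have sub: "subspace ?V" using subspace_span unfolding basis3_def by metis
  have Ff: "F c \<in> forms2" for c using F by (simp add: definite_triple_def)
  have Vf: "?V \<subseteq> forms2"
    unfolding V by (auto intro!: subspace_sum subspace_scale subspace_forms2 Ff)
  have pos: "\<sigma> * wedge22 w w > 0" if w: "w \<in> ?V" "w \<noteq> 0" for w
  proof -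
    obtain x where x: "w = (\<Sum>c\<in>UNIV. x c *\<^sub>R F c)" using w(1) unfolding V by blast
    have "\<exists>i. x i \<noteq> 0" by (rule ccontr) (use w(2) x in simp)
    then show ?thesis using F x by (simp add: definite_triple_def)
  qed
  then show or: "induces_orientation \<Omega> \<sigma>" by (simp add: induces_orientation_def)
  obtain h0 where h0: "metric_matrix h0" "self_dual \<sigma> h0 = ?V"
    using metric_of_definite_space[OF \<sigma> sub Vf basis pos] by blast
  define p where "p = (SOME (\<sigma>, h). induced_structure \<Omega> \<sigma> h)"
  obtain \<sigma>' h where p: "p = (\<sigma>', h)" by (cases p)
  have "case p of (\<sigma>, h) \<Rightarrow> induced_structure \<Omega> \<sigma> h"
    unfolding p_def by (rule someI[of _ "(\<sigma>, h0)"]) (use \<sigma> or h0 in \<open>simp add: induced_structure_def\<close>)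
  then have ind: "induced_structure \<Omega> \<sigma>' h" by (simp add: p)
  then have h: "metric_matrix h" and sd: "self_dual \<sigma>' h = ?V" and \<sigma>': "\<sigma>' \<in> {1, - 1}" and or':
      "induces_orientation \<Omega> \<sigma>'"
    by (simp_all add: induced_structure_def)
  have F1: "F 1 \<in> ?V" "F 1 \<noteq> 0"
    using basis3_basis_mem[OF basis] basis3_independent[OF basis, of "\<lambda>i. if i = 1 then 1 else 0"
        1] by (auto simp: sum_3)
  have "\<sigma>' * wedge22 (F 1) (F 1) > 0" "\<sigma> * wedge22 (F 1) (F 1) > 0"
    using or' or F1 by (auto simp: induces_orientation_def)
  then have eq: "\<sigma>' = \<sigma>" using \<sigma> \<sigma>' by auto
  define e where "e = (SOME \<epsilon>. so3_basis commutator so3 \<epsilon>)"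
  have e: "so3_basis commutator so3 e" unfolding e_def by (rule someI[of "so3_basis commutator
      so3", OF so3_basis_so3_gen])
  then have E: "basis3 so3 e" by (simp add: so3_basis_def)
  define M where "M j c = representation (range e) (so3_gen c) (e j)" for j c
  define w where "w j = curvature_map \<Omega> (\<lambda>M. representation (range e) M (e j))" for j
  have gen: "so3_gen c = (\<Sum>j\<in>UNIV. M j c *\<^sub>R e j)" for c
    unfolding M_def by (rule basis3_representation_expand[OF E basis3_basis_mem[OF basis3_so3_gen]])
  have "\<Omega> k l = (\<Sum>j\<in>UNIV. (\<Sum>c\<in>UNIV. \<kappa> * F c $ k $ l * M j c) *\<^sub>R e j)" for k l
    unfolding \<Omega> gen by (simp add: sum_3 algebra_simps)
  then have "representation (range e) (\<Omega> k l) (e j) = (\<Sum>c\<in>UNIV. \<kappa> * F c $ k $ l * M j c)" for k l j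
    by (simp only: basis3_representation[OF E])
  then have w: "w j = (\<Sum>c\<in>UNIV. (\<kappa> * M j c) *\<^sub>R F c)" for j
    by (simp add: w_def curvature_map_def vec_eq_iff mult_ac)
  have wV: "w j \<in> self_dual \<sigma>' h" for j
    unfolding sd w by (rule basis3_mem[OF basis])
  have "connection_sign \<Omega> = sgn (det_in_basis (oriented_basis \<sigma>' h) w)"
    by (simp add: connection_sign_def Let_def p_def[symmetric] p e_def[symmetric] w_def[abs_def])
  also have "\<dots> = - \<sigma>' * sgn (triple_form v (w 1) (w 2) (w 3))"
    by (rule sgn_det_in_so3_basis[OF h \<sigma>' v oriented_basis[OF h \<sigma>'] wV])
  also have "triple_form v (w 1) (w 2) (w 3) = det (\<chi> c j. \<kappa> * M j c :: real^3^3) * triple_form v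
      (F 1) (F 2) (F 3)"
    by (rule triple_form_change[OF Ff w])
  also have "det (\<chi> c j. \<kappa> * M j c :: real^3^3) = \<kappa> ^ 3 * det (\<chi> j c. M j c :: real^3^3)"
    by (simp add: det_3 power3_eq_cube algebra_simps)
  also have "sgn (\<kappa> ^ 3 * det (\<chi> j c. M j c :: real^3^3) * triple_form v (F 1) (F 2) (F 3)) = sgn
      \<kappa> * sgn (triple_form v (F 1) (F 2) (F 3))"
  proof -
    have "sgn (det (\<chi> j c. M j c :: real^3^3)) = 1" using so3_basis_orientation[OF e] by (simp
        add: M_def)
    moreover have "sgn \<kappa> * (sgn \<kappa> * sgn \<kappa>) = sgn \<kappa>" by (simp add: sgn_if)
    ultimately show ?thesis by (simp add: sgn_mult power3_eq_cube)
  qed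
  finally show "connection_sign \<Omega> = - \<sigma> * sgn \<kappa> * sgn (triple_form v (F 1) (F 2) (F 3))"
    by (simp add: eq)
qed

text \<open>The cubic form is continuous along the segment and vanishes nowhere on it.\<close>

lemma triple_form_sgn_homotopy:
  assumes def: "\<And>t. 0 \<le> t \<Longrightarrow> t \<le> 1 \<Longrightarrow> definite_triple \<sigma> (\<lambda>c. F c + t *\<^sub>R G c)" and v: "v \<noteq> 0"
  shows "sgn (triple_form v (F 1) (F 2) (F 3)) = sgn (triple_form v (F 1 + G 1) (F 2 + G 2) (F 3 +
      G 3))"
proof -
  let ?T = "\<lambda>t::real. triple_form v (F 1 + t *\<^sub>R G 1) (F 2 + t *\<^sub>R G 2) (F 3 + t *\<^sub>R G 3)"
  have c: "isCont ?T t" for t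
    unfolding triple_form_linear by (intro continuous_intros)
  have nz: "?T t \<noteq> 0" if "0 \<le> t" "t \<le> 1" for t
    using triple_form_nonzero[OF def[OF that] v] by simp
  have "\<not> (?T 0 < 0 \<and> 0 < ?T 1)"
  proof
    assume "?T 0 < 0 \<and> 0 < ?T 1"
    then obtain t where "0 \<le> t" "t \<le> 1" "?T t = 0" using IVT[of ?T 0 0 1] c by auto
    then show False using nz by blast
  qed
  moreover have "\<not> (0 < ?T 0 \<and> ?T 1 < 0)"
  proof
    assume "0 < ?T 0 \<and> ?T 1 < 0"
    then obtain t where "0 \<le> t" "t \<le> 1" "?T t = 0" using IVT2[of ?T 1 0 0] c by auto
    then show False using nz by blast
  qed
  ultimately have "sgn (?T 0) = sgn (?T 1)" using nz[of 0] nz[of 1] by (auto simp: sgn_if)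
  then show ?thesis by simp
qed

section \<open>Definiteness and sign of the curvature operator\<close>

context curvature_tensor
begin

lemma A_sum: "(\<Sum>c\<in>UNIV. x c *\<^sub>R A (b (c::3))) = A (\<Sum>c\<in>UNIV. x c *\<^sub>R b c)"
  by (simp add: sum_3 A_linear)

lemma B_sum: "(\<Sum>c\<in>UNIV. x c *\<^sub>R B (b (c::3))) = B (\<Sum>c\<in>UNIV. x c *\<^sub>R b c)"
  by (simp add: sum_3 B_linear)

lemma Rm_sum3: "(\<Sum>c\<in>UNIV. x c *\<^sub>R Rm (b (c::3))) = Rm (\<Sum>c\<in>UNIV. x c *\<^sub>R b c)"
  by (simp add: sum_3 Rm_linear)

text \<open>\<open>A \<omega>\<close> is self-dual and \<open>B \<omega>\<close> anti-self-dual, so the two summands are orthogonal for the wedge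
  product, which is positive on the first and negative on the second.\<close>

lemma wedge22_block:
  assumes w: "\<omega> \<in> self_dual 1 h"
  shows "wedge22 (r *\<^sub>R A \<omega> + t *\<^sub>R B \<omega>) (r *\<^sub>R A \<omega> + t *\<^sub>R B \<omega>) =
    sqrt (det h) * (r\<^sup>2 * form_inner h (A \<omega>) (A \<omega>) - t\<^sup>2 * form_inner h (B \<omega>) (B \<omega>))"
proof -
  have a: "A \<omega> \<in> self_dual 1 h" and b: "B \<omega> \<in> self_dual (- 1) h"
    using A_self_dual[OF w] B_self_dual[OF w] by simp_all
  have "wedge22 (A \<omega>) (A \<omega>) = sqrt (det h) * form_inner h (A \<omega>) (A \<omega>)"
    using wedge22_self_dual[OF a self_dual_forms2[OF a]] by simp
  moreover have "wedge22 (B \<omega>) (B \<omega>) = - sqrt (det h) * form_inner h (B \<omega>) (B \<omega>)"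
    using wedge22_self_dual[OF b self_dual_forms2[OF b]] by simp
  moreover have "wedge22 (A \<omega>) (B \<omega>) = 0" by (rule self_dual_orthogonal(1)[OF h a b])
  ultimately show ?thesis
    by (simp add: wedge22_commute[of "B \<omega>" "A \<omega>"] power2_eq_square algebra_simps)
qed

text \<open>The quadratic form of \<open>D_op\<close>.\<close>

definition D_form :: "real^4^4 \<Rightarrow> real" where
  "D_form \<omega> = form_inner h (A \<omega>) (A \<omega>) - form_inner h (B \<omega>) (B \<omega>)"

lemma wedge22_Rm: "\<omega> \<in> self_dual 1 h \<Longrightarrow> wedge22 (Rm \<omega>) (Rm \<omega>) = sqrt (det h) * D_form \<omega>"
  using wedge22_block[of \<omega> 1 1] by (simp add: Rm_eq D_form_def)

lemma definite_triple_block: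
  assumes b: "basis3 (self_dual 1 h) b"
    and pos: "\<And>\<omega>. \<omega> \<in> self_dual 1 h \<Longrightarrow> \<omega> \<noteq> 0 \<Longrightarrow>
      \<sigma> * (r\<^sup>2 * form_inner h (A \<omega>) (A \<omega>) - t\<^sup>2 * form_inner h (B \<omega>) (B \<omega>)) > 0"
  shows "definite_triple \<sigma> (\<lambda>c. r *\<^sub>R A (b c) + t *\<^sub>R B (b c))"
  unfolding definite_triple_def
proof (intro conjI allI impI)
  fix i
  have "b i \<in> forms2" using basis3_basis_mem[OF b] self_dual_forms2 by blast
  then show "r *\<^sub>R A (b i) + t *\<^sub>R B (b i) \<in> forms2"
    by (intro subspace_add subspace_scale subspace_forms2 A_forms2 B_forms2)
next
  fix x :: "3 \<Rightarrow> real" assume "\<exists>i. x i \<noteq> 0"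
  define \<omega> where "\<omega> = (\<Sum>c\<in>UNIV. x c *\<^sub>R b c)"
  have w: "\<omega> \<in> self_dual 1 h" "\<omega> \<noteq> 0"
    using basis3_mem[OF b] basis3_independent[OF b] \<open>\<exists>i. x i \<noteq> 0\<close> by (auto simp: \<omega>_def)
  have eq: "(\<Sum>c\<in>UNIV. x c *\<^sub>R (r *\<^sub>R A (b c) + t *\<^sub>R B (b c))) = r *\<^sub>R A \<omega> + t *\<^sub>R B \<omega>"
    unfolding \<omega>_def A_sum[symmetric] B_sum[symmetric] by (simp add: sum_3 algebra_simps)
  have "\<sigma> * wedge22 (r *\<^sub>R A \<omega> + t *\<^sub>R B \<omega>) (r *\<^sub>R A \<omega> + t *\<^sub>R B \<omega>) =
    sqrt (det h) * (\<sigma> * (r\<^sup>2 * form_inner h (A \<omega>) (A \<omega>) - t\<^sup>2 * form_inner h (B \<omega>) (B \<omega>)))"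
    unfolding wedge22_block[OF w(1)] by (rule mult.left_commute)
  also have "\<dots> > 0" using pos[OF w] det_metric_pos[OF h] by simp
  finally show "\<sigma> * wedge22 (\<Sum>c\<in>UNIV. x c *\<^sub>R (r *\<^sub>R A (b c) + t *\<^sub>R B (b c))) (\<Sum>c\<in>UNIV. x c *\<^sub>R (r *\<^sub>R
      A (b c) + t *\<^sub>R B (b c))) > 0"
    by (simp only: eq)
qed

lemma definite_triple_Rm:
  assumes b: "basis3 (self_dual 1 h) b" and pos: "\<And>\<omega>. \<omega> \<in> self_dual 1 h \<Longrightarrow> \<omega> \<noteq> 0 \<Longrightarrow> \<sigma> * D_form \<omega> > 0"
  shows "definite_triple \<sigma> (\<lambda>c. Rm (b c))"
  using definite_triple_block[OF b, of \<sigma> 1 1] pos by (simp add: Rm_eq D_form_def)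

text \<open>The curvature of \<open>\<Lambda>\<^sup>+\<close>: the endomorphism \<open>R(\<partial>\<^sub>k, \<partial>\<^sub>l)\<close> acts on two-forms through the
  bracket with the two-form \<open>\<rho> k l\<close>.\<close>

definition frame_curvature :: "4 \<Rightarrow> 4 \<Rightarrow> real^3^3" where
  "frame_curvature k l = (\<chi> a b. form_inner h (form_frame h a) (form_bracket h (\<rho> k l) (form_frame
      h b)))"

text \<open>By invariance the matrix entries of the bracket with \<open>\<rho> k l\<close> are the inner products of
  \<open>\<rho> k l\<close> with brackets of frame elements, and those are the components of \<open>Rm\<close>.\<close>

lemma frame_curvature_eq:
  assumes br: "form_bracket h (form_frame h 1) (form_frame h 2) = \<kappa> *\<^sub>R form_frame h 3"
    "form_bracket h (form_frame h 2) (form_frame h 3) = \<kappa> *\<^sub>R form_frame h 1"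
    "form_bracket h (form_frame h 3) (form_frame h 1) = \<kappa> *\<^sub>R form_frame h 2"
  shows "frame_curvature k l = (\<Sum>c\<in>UNIV. (\<kappa> * Rm (form_frame h c) $ k $ l) *\<^sub>R so3_gen c)"
proof -
  let ?f = "form_frame h"
  have f: "?f a \<in> forms2" for a
    using basis3_basis_mem[OF form_frame(1)[OF h]] self_dual_forms2 by blast
  have "frame_curvature k l $ a $ b = form_inner h (form_bracket h (?f b) (?f a)) (\<rho> k l)" for a b
    using form_inner_invariant[OF h rho_forms2 f f, of k l b a] form_inner_commute[OF h]
    by (simp add: frame_curvature_def)
  moreover have "form_bracket h (?f 2) (?f 1) = - (\<kappa> *\<^sub>R ?f 3)" "form_bracket h (?f 3) (?f 2) = -
      (\<kappa> *\<^sub>R ?f 1)"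
    "form_bracket h (?f 1) (?f 3) = - (\<kappa> *\<^sub>R ?f 2)"
    using br form_bracket_skew(1)[of h "?f 2" "?f 1"] form_bracket_skew(1)[of h "?f 3" "?f 2"]
        form_bracket_skew(1)[of h "?f 1" "?f 3"]
    by simp_all
  ultimately have "frame_curvature k l $ a $ b = (\<Sum>c\<in>UNIV. (\<kappa> * Rm (form_frame h c) $ k $ l) *\<^sub>R
      so3_gen c) $ a $ b" for a b
    using exhaust_3[of a] exhaust_3[of b]
    by (auto simp: br sum_3 form_bracket_skew(2) Rm_def so3_gen_def cross3_def axis_def)
  then show ?thesis by (simp only: vec_eq_iff) simp
qed

text \<open>The orthonormal frame in which the curvature is written need not be positively oriented, but
  its orientation enters twice, through \<open>\<kappa>\<close> and through the passage to the oriented basis \<open>b\<close>, and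
  cancels.\<close>

lemma frame_curvature_sign:
  assumes v: "v \<noteq> 0" and \<sigma>: "\<sigma> \<in> {1, - 1}"
    and pos: "\<And>\<omega>. \<omega> \<in> self_dual 1 h \<Longrightarrow> \<omega> \<noteq> 0 \<Longrightarrow> \<sigma> * D_form \<omega> > 0"
  defines "b \<equiv> oriented_basis 1 h"
  shows "induces_orientation frame_curvature \<sigma>" "dim (curvature_image frame_curvature) = 3"
    "connection_sign frame_curvature = - \<sigma> * sgn (triple_form v (Rm (b 1)) (Rm (b 2)) (Rm (b 3)))"
proof -
  let ?f = "form_frame h"
  obtain \<kappa> where \<kappa>: "\<kappa> \<noteq> 0" and br: "form_bracket h (?f 1) (?f 2) = \<kappa> *\<^sub>R ?f 3"
    "form_bracket h (?f 2) (?f 3) = \<kappa> *\<^sub>R ?f 1" "form_bracket h (?f 3) (?f 1) = \<kappa> *\<^sub>R ?f 2"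
    and s: "sgn (triple_form v (?f 1) (?f 2) (?f 3)) = - sgn \<kappa>"
    by (rule form_frame_bracket[OF h v])
  have F: "basis3 (self_dual 1 h) ?f" by (rule form_frame(1)[OF h])
  note def = definite_triple_Rm[OF F pos]
  note eq = frame_curvature_eq[OF br]
  show "induces_orientation frame_curvature \<sigma>"
    by (rule connection_sign_eq(1)[OF eq \<kappa> \<sigma> def v])
  show "dim (curvature_image frame_curvature) = 3"
    unfolding curvature_image_combinations[OF eq \<kappa>] by (rule basis3_dim[OF
        definite_triple_basis3[OF def]])
  have sign: "connection_sign frame_curvature = - \<sigma> * sgn \<kappa> * sgn (triple_form v (Rm (?f 1)) (Rm
      (?f 2)) (Rm (?f 3)))"
    by (rule connection_sign_eq(2)[OF eq \<kappa> \<sigma> def v])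
  have b: "so3_basis (form_bracket h) (self_dual 1 h) b"
    unfolding b_def by (rule oriented_basis[OF h]) simp
  then have B: "basis3 (self_dual 1 h) b" by (simp add: so3_basis_def)
  let ?M = "\<lambda>i j. representation (range b) (?f j) (b i)"
  have M: "?f j = (\<Sum>i\<in>UNIV. ?M i j *\<^sub>R b i)" for j
    by (rule basis3_representation_expand[OF B basis3_basis_mem[OF F]])
  have "sgn (det_in_basis b ?f) = sgn \<kappa>"
    using sgn_det_in_so3_basis[OF h _ v b basis3_basis_mem[OF F]] s by simp
  then have dM: "sgn (det (\<chi> i j. ?M i j)) = sgn \<kappa>"
    using det_in_basis_eq[OF B M] by simp
  have "triple_form v (Rm (?f 1)) (Rm (?f 2)) (Rm (?f 3)) = det (\<chi> i j. ?M i j) * triple_form v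
      (Rm (b 1)) (Rm (b 2)) (Rm (b 3))"
  proof (rule triple_form_change)
    show "Rm (b i) \<in> forms2" for i by (rule Rm_forms2)
    show "Rm (?f j) = (\<Sum>i\<in>UNIV. ?M i j *\<^sub>R Rm (b i))" for j
      unfolding Rm_sum3 by (rule arg_cong[of _ _ Rm, OF M])
  qed
  moreover have "sgn \<kappa> * sgn \<kappa> = 1" using \<kappa> by (simp add: sgn_if)
  ultimately show "connection_sign frame_curvature = - \<sigma> * sgn (triple_form v (Rm (b 1)) (Rm (b
      2)) (Rm (b 3)))"
    using sign by (simp add: sgn_mult dM)
qed

text \<open>When \<open>|A \<omega>| > |B \<omega>|\<close>, all the operators \<open>A + t *\<^sub>R B\<close> with \<open>0 \<le> t \<le> 1\<close> have a positive definite
  image, so \<open>Rm = A + B\<close> and \<open>A\<close> induce the same orientation.\<close>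

lemma connection_sign_pos:
  assumes pos: "\<And>\<omega>. \<omega> \<in> self_dual 1 h \<Longrightarrow> \<omega> \<noteq> 0 \<Longrightarrow> D_form \<omega> > 0"
  shows "connection_sign frame_curvature = sgn (form_det h 1 1 A)"
proof -
  define b where "b = oriented_basis 1 h"
  have b: "so3_basis (form_bracket h) (self_dual 1 h) b"
    unfolding b_def by (rule oriented_basis[OF h]) simp
  then have bb: "basis3 (self_dual 1 h) b" by (simp add: so3_basis_def)
  define v :: "real^4" where "v = axis 1 1"
  have v: "v \<noteq> 0" by (simp add: v_def axis_eq_0_iff)
  have "definite_triple 1 (\<lambda>c. A (b c) + t *\<^sub>R B (b c))" if t: "0 \<le> t" "t \<le> 1" for t
  proof -
    have "0 < 1 * (1\<^sup>2 * form_inner h (A \<omega>) (A \<omega>) - t\<^sup>2 * form_inner h (B \<omega>) (B \<omega>))" if "\<omega> \<in>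
        self_dual 1 h" "\<omega> \<noteq> 0" for \<omega>
    proof -
      have "form_inner h (B \<omega>) (B \<omega>) \<ge> 0" using form_inner_pos[OF h, of "B \<omega>"] by (cases "B \<omega> = 0") auto
      then have "t\<^sup>2 * form_inner h (B \<omega>) (B \<omega>) \<le> 1 * form_inner h (B \<omega>) (B \<omega>)"
        using t by (intro mult_right_mono) (simp_all add: power_le_one)
      then show ?thesis using pos[OF that] by (simp add: D_form_def)
    qed
    from definite_triple_block[OF bb this] show ?thesis by simp
  qed
  from triple_form_sgn_homotopy[OF this v]
  have "sgn (triple_form v (A (b 1)) (A (b 2)) (A (b 3))) = sgn (triple_form v (Rm (b 1)) (Rm (b
      2)) (Rm (b 3)))"
    by (simp add: Rm_eq)
  moreover have "sgn (form_det h 1 1 A) = - 1 * sgn (triple_form v (A (b 1)) (A (b 2)) (A (b 3)))"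
    unfolding form_det_def b_def[symmetric]
    by (rule sgn_det_in_so3_basis[OF h _ v b]) (auto intro: A_self_dual basis3_basis_mem[OF bb])
  ultimately show ?thesis
    using frame_curvature_sign(3)[OF v, of 1] pos by (simp add: b_def)
qed

text \<open>As before, with the roles of \<open>A\<close> and \<open>B\<close> exchanged: now \<open>B\<close> dominates, and the images are
  negative definite.\<close>

lemma connection_sign_neg:
  assumes neg: "\<And>\<omega>. \<omega> \<in> self_dual 1 h \<Longrightarrow> \<omega> \<noteq> 0 \<Longrightarrow> D_form \<omega> < 0"
  shows "connection_sign frame_curvature = sgn (form_det h 1 (- 1) B)"
proof -
  define b where "b = oriented_basis 1 h"
  have "so3_basis (form_bracket h) (self_dual 1 h) b"
    unfolding b_def by (rule oriented_basis[OF h]) simp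
  then have bb: "basis3 (self_dual 1 h) b" by (simp add: so3_basis_def)
  define v :: "real^4" where "v = axis 1 1"
  have v: "v \<noteq> 0" by (simp add: v_def axis_eq_0_iff)
  have "definite_triple (- 1) (\<lambda>c. B (b c) + t *\<^sub>R A (b c))" if t: "0 \<le> t" "t \<le> 1" for t
  proof -
    have "0 < - 1 * (t\<^sup>2 * form_inner h (A \<omega>) (A \<omega>) - 1\<^sup>2 * form_inner h (B \<omega>) (B \<omega>))" if "\<omega> \<in>
        self_dual 1 h" "\<omega> \<noteq> 0" for \<omega>
    proof -
      have "form_inner h (A \<omega>) (A \<omega>) \<ge> 0" using form_inner_pos[OF h, of "A \<omega>"] by (cases "A \<omega> = 0") auto
      then have "t\<^sup>2 * form_inner h (A \<omega>) (A \<omega>) \<le> 1 * form_inner h (A \<omega>) (A \<omega>)"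
        using t by (intro mult_right_mono) (simp_all add: power_le_one)
      then show ?thesis using neg[OF that] by (simp add: D_form_def)
    qed
    from definite_triple_block[OF bb this] show ?thesis by (simp add: add.commute)
  qed
  from triple_form_sgn_homotopy[OF this v]
  have "sgn (triple_form v (B (b 1)) (B (b 2)) (B (b 3))) = sgn (triple_form v (Rm (b 1)) (Rm (b
      2)) (Rm (b 3)))"
    by (simp add: Rm_eq add.commute)
  moreover have "sgn (form_det h 1 (- 1) B) = - (- 1) * sgn (triple_form v (B (b 1)) (B (b 2)) (B
      (b 3)))"
    unfolding form_det_def b_def[symmetric]
    by (rule sgn_det_in_so3_basis[OF h _ v oriented_basis[OF h]]) (auto intro: B_self_dual
        basis3_basis_mem[OF bb])
  ultimately show ?thesis
    using frame_curvature_sign(3)[OF v, of "- 1"] neg by (simp add: b_def)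
qed

text \<open>If the image is three-dimensional then \<open>Rm\<close> is injective on \<open>\<Lambda>\<^sup>+\<close>, so a nonzero form has a
  nonzero image, on which the wedge product is \<open>D_form\<close> up to a positive factor.\<close>

lemma definite_curvature_iff:
  "definite_curvature frame_curvature \<longleftrightarrow>
    (\<forall>\<omega>\<in>self_dual 1 h. \<omega> \<noteq> 0 \<longrightarrow> D_form \<omega> > 0) \<or> (\<forall>\<omega>\<in>self_dual 1 h. \<omega> \<noteq> 0 \<longrightarrow> D_form \<omega> < 0)"
proof -
  define v :: "real^4" where "v = axis 1 1"
  have v: "v \<noteq> 0" by (simp add: v_def axis_eq_0_iff)
  let ?f = "form_frame h"
  obtain \<kappa> where \<kappa>: "\<kappa> \<noteq> 0" and br: "form_bracket h (?f 1) (?f 2) = \<kappa> *\<^sub>R ?f 3"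
    "form_bracket h (?f 2) (?f 3) = \<kappa> *\<^sub>R ?f 1" "form_bracket h (?f 3) (?f 1) = \<kappa> *\<^sub>R ?f 2"
    by (rule form_frame_bracket[OF h v])
  note img = curvature_image_combinations[OF frame_curvature_eq[OF br] \<kappa>]
  have F: "basis3 (self_dual 1 h) ?f" by (rule form_frame(1)[OF h])
  have *: "\<forall>\<omega>\<in>self_dual 1 h. \<omega> \<noteq> 0 \<longrightarrow> \<sigma> * D_form \<omega> > 0"
    if dim: "dim (curvature_image frame_curvature) = 3" and or: "induces_orientation
        frame_curvature \<sigma>" for \<sigma>
  proof (intro ballI impI)
    fix \<omega> assume w: "\<omega> \<in> self_dual 1 h" "\<omega> \<noteq> 0"
    let ?F = "\<lambda>c. Rm (?f c)"
    have card: "card (range ?F) \<le> 3" using card_image_le[of UNIV ?F] by simp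
    have "curvature_image frame_curvature \<subseteq> span (range ?F)"
      unfolding img by (auto intro!: span_sum span_scale intro: span_base)
    then have "3 \<le> dim (range ?F)" using dim_subset dim dim_span by metis
    moreover have "dim (range ?F) \<le> card (range ?F)" by (rule dim_le_card') simp
    ultimately have c: "card (range ?F) = 3" "dim (range ?F) = 3" using card by linarith+
    have "inj ?F" by (rule eq_card_imp_inj_on) (use c in simp_all)
    moreover have "independent (range ?F)"
      using card_eq_dim[of "range ?F" "range ?F"] c span_superset[of "range ?F"] by simp
    ultimately have bF: "basis3 (span (range ?F)) ?F" by (simp add: basis3_def)
    obtain x where x: "\<omega> = (\<Sum>c\<in>UNIV. x c *\<^sub>R ?f c)" by (rule basis3_expand[OF F w(1)])
    have Rx: "Rm \<omega> = (\<Sum>c\<in>UNIV. x c *\<^sub>R ?F c)" unfolding Rm_sum3 x ..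
    have "Rm \<omega> \<noteq> 0"
    proof
      assume "Rm \<omega> = 0"
      then have "(\<Sum>c\<in>UNIV. x c *\<^sub>R ?F c) = 0" using Rx by simp
      then have "x c = 0" for c by (rule basis3_independent[OF bF, of x])
      then show False using w(2) x by simp
    qed
    moreover have "Rm \<omega> \<in> curvature_image frame_curvature" unfolding img using Rx by blast
    ultimately have "\<sigma> * wedge22 (Rm \<omega>) (Rm \<omega>) > 0" using or by (simp add: induces_orientation_def)
    then have "sqrt (det h) * (\<sigma> * D_form \<omega>) > 0" by (simp add: wedge22_Rm[OF w(1)] mult_ac)
    then show "\<sigma> * D_form \<omega> > 0" using det_metric_pos[OF h] by (simp add: zero_less_mult_iff)
  qed
  show ?thesis
  proof
    assume "definite_curvature frame_curvature"
    then show "(\<forall>\<omega>\<in>self_dual 1 h. \<omega> \<noteq> 0 \<longrightarrow> D_form \<omega> > 0) \<or> (\<forall>\<omega>\<in>self_dual 1 h. \<omega> \<noteq> 0 \<longrightarrow> D_form \<omega> < 0)"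
      using *[of 1] *[of "- 1"] by (auto simp: definite_curvature_def)
  next
    assume "(\<forall>\<omega>\<in>self_dual 1 h. \<omega> \<noteq> 0 \<longrightarrow> D_form \<omega> > 0) \<or> (\<forall>\<omega>\<in>self_dual 1 h. \<omega> \<noteq> 0 \<longrightarrow> D_form \<omega> < 0)"
    then show "definite_curvature frame_curvature"
    proof
      assume "\<forall>\<omega>\<in>self_dual 1 h. \<omega> \<noteq> 0 \<longrightarrow> D_form \<omega> > 0"
      then show ?thesis using frame_curvature_sign(1,2)[OF v, of 1] by (simp add:
          definite_curvature_def)
    next
      assume "\<forall>\<omega>\<in>self_dual 1 h. \<omega> \<noteq> 0 \<longrightarrow> D_form \<omega> < 0"
      then show ?thesis using frame_curvature_sign(1,2)[OF v, of "- 1"] by (simp add: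
          definite_curvature_def)
    qed
  qed
qed

end

section \<open>The Levi-Civita connection on self-dual forms\<close>

context local_metric
begin

lemma riemann_up_skew: "x \<in> U \<Longrightarrow> riemann_up g x l k = - riemann_up g x k l"
  by (simp add: riemann_up_eq)

lemma riemann_curvature_tensor:
  assumes x: "x \<in> U"
  shows "curvature_tensor (g x) (\<lambda>k l. g x ** riemann_up g x k l)"
proof
  fix i j k l
  show "metric_matrix (g x)" by (rule metric[OF x])
  show "g x ** riemann_up g x k l \<in> forms2"
    using riemann_skew12[OF x] by (simp add: forms2_def)
  show "g x ** riemann_up g x l k = - (g x ** riemann_up g x k l)"
    using riemann_up_skew[OF x, of k l] by (simp add: matrix_mult_distribs)
  have col: "(M ** N) $ a $ b = (M *v (N *v axis b 1)) $ a" for M N :: "real^4^4" and a b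
    by (simp add: matrix_vector_mul_assoc) (simp add: matrix_vector_mult_basis column_def)
  have "(g x *v (riemann_up g x k l *v axis j 1 + riemann_up g x l j *v axis k 1 + riemann_up g x
      j k *v axis l 1)) $ i = 0"
    unfolding bianchi[OF x] by simp
  then show "(g x ** riemann_up g x k l) $ i $ j + (g x ** riemann_up g x l j) $ i $ k + (g x **
      riemann_up g x j k) $ i $ l = 0"
    by (simp only: col matrix_vector_right_distrib vector_add_component)
qed

end

text \<open>It remains to recognise the operators of the statement in \<open>A\<close>, \<open>B\<close> and \<open>D_form\<close>. Contracting the
  Kulkarni-Nomizu products in the definition of the Weyl tensor with a two-form gives
  \<open>Rm = weyl_scalar_op + Ric0\<close>, and the adjoint of \<open>Ric0\<close> is found by expansion in the
  orthonormal frame.\<close>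

lemma definite_pointwise:
  assumes "local_metric g U" and x: "x \<in> U"
  shows "definite_curvature (lc_curvature g x) \<longleftrightarrow> pos_def_sd (g x) (D_op g x) \<or> neg_def_sd (g x)
      (D_op g x)" (is ?iff)
    "pos_def_sd (g x) (D_op g x) \<Longrightarrow> induces_orientation (lc_curvature g x) 1 \<and>
       connection_sign (lc_curvature g x) = sgn (form_det (g x) 1 1 (weyl_scalar_op g x))"
    "neg_def_sd (g x) (D_op g x) \<Longrightarrow> induces_orientation (lc_curvature g x) (- 1) \<and>
       connection_sign (lc_curvature g x) = sgn (form_det (g x) 1 (- 1) (Ric0 g x))"
proof -
  interpret L: local_metric g U by fact
  define h where "h = g x"
  define \<rho> where "\<rho> k l = g x ** riemann_up g x k l" for k l
  have rho: "\<rho> = (\<lambda>k l. g x ** riemann_up g x k l)" by (simp add: \<rho>_def fun_eq_iff)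
  interpret curvature_tensor h \<rho> unfolding rho h_def by (rule L.riemann_curvature_tensor[OF x])
  let ?X = "matrix_inv h"
  have rho_h: "h ** riemann_up g x k l = \<rho> k l" for k l by (simp add: \<rho>_def h_def)
  have up: "riemann_up g x k l = ?X ** \<rho> k l" for k l
    by (simp add: \<rho>_def h_def[symmetric] matrix_mul_assoc metric_inverse[OF h])
  have lc: "lc_curvature g x = frame_curvature"
  proof -
    have "form_curvature g x k l \<omega> = form_bracket h (\<rho> k l) \<omega>" for k l \<omega>
      by (simp add: L.form_curvature_riemann_up[OF x] up form_bracket_def transpose_distribs
          metric_inverse[OF h]
        forms2_transpose[OF rho_forms2] matrix_mult_distribs matrix_mul_assoc)
    then show ?thesis by (simp add: fun_eq_iff lc_curvature_def frame_curvature_def h_def[symmetric])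
  qed
  have ricci: "ricci g x = ric" by (simp add: ricci_def ric_def up)
  have scal: "scalar_curvature g x = scal" by (simp add: scalar_curvature_def scal_def ricci
      h_def[symmetric])
  have ric0: "ric0 g x = S0" by (simp add: ric0_def S0_def ricci scal h_def[symmetric])
  have B: "Ric0 g x = B" by (simp add: fun_eq_iff Ric0_def B_def ric0)
  have A: "weyl_scalar_op g x \<omega> = A \<omega>" if f: "\<omega> \<in> forms2" for \<omega>
  proof -
    let ?Y = "raise2 h \<omega>"
    have Yt: "transpose ?Y = - ?Y" by (rule forms2_transpose[OF raise2_forms2[OF f]])
    have hY: "h ** ?Y = \<omega> ** ?X" "?Y ** h = ?X ** \<omega>"
      by (simp_all add: raise2_eq[OF h] matrix_mul_assoc metric_inverse[OF h])
        (simp flip: matrix_mul_assoc add: metric_inverse[OF h])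
    have ht: "transpose h = h" and rt: "transpose ric = ric" by (simp_all add: metric_inverse[OF
        h] ric_symmetric)
    \<comment> \<open>The two index patterns in the products of the Ricci tensor with the metric.\<close>
    have s1: "(\<Sum>k\<in>UNIV. \<Sum>l\<in>UNIV. M $ i $ k * N $ j $ l * Z $ k $ l) = (M ** Z ** transpose N) $ i
        $ j" for M N Z :: "real^4^4" and i j
    proof -
      have "(M ** Z ** transpose N) $ i $ j = (\<Sum>l\<in>UNIV. \<Sum>k\<in>UNIV. M $ i $ k * N $ j $ l * Z $ k $ l)"
        by (simp add: matrix_matrix_mult_def transpose_def sum_distrib_right sum_distrib_left mult_ac)
      also have "\<dots> = (\<Sum>k\<in>UNIV. \<Sum>l\<in>UNIV. M $ i $ k * N $ j $ l * Z $ k $ l)" by (rule sum.swap)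
      finally show ?thesis by simp
    qed
    have s2: "(\<Sum>k\<in>UNIV. \<Sum>l\<in>UNIV. M $ i $ l * N $ j $ k * Z $ k $ l) = (M ** transpose Z **
        transpose N) $ i $ j" for M N Z :: "real^4^4" and i j
    proof -
      have "(M ** transpose Z ** transpose N) $ i $ j = (\<Sum>k\<in>UNIV. \<Sum>l\<in>UNIV. M $ i $ l * N $ j $ k *
          Z $ k $ l)"
        by (simp add: matrix_matrix_mult_def transpose_def sum_distrib_right sum_distrib_left mult_ac)
      then show ?thesis by simp
    qed
    have "weyl_op g x \<omega> $ i $ j = (Rm \<omega> - (1/2) *\<^sub>R (ric ** ?X ** \<omega> + \<omega> ** ?X ** ric) + (scal / 6)
        *\<^sub>R \<omega>) $ i $ j" for i j
    proof -
      have "weyl_op g x \<omega> $ i $ j = (1/2) * (\<Sum>k\<in>UNIV. \<Sum>l\<in>UNIV. \<rho> k l $ i $ j * ?Y $ k $ l)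
        - (1/4) * ((\<Sum>k\<in>UNIV. \<Sum>l\<in>UNIV. ric $ i $ k * h $ j $ l * ?Y $ k $ l) - (\<Sum>k\<in>UNIV. \<Sum>l\<in>UNIV.
            ric $ i $ l * h $ j $ k * ?Y $ k $ l)
          + (\<Sum>k\<in>UNIV. \<Sum>l\<in>UNIV. h $ i $ k * ric $ j $ l * ?Y $ k $ l) - (\<Sum>k\<in>UNIV. \<Sum>l\<in>UNIV. h $ i $
              l * ric $ j $ k * ?Y $ k $ l))
        + (scal / 12) * ((\<Sum>k\<in>UNIV. \<Sum>l\<in>UNIV. h $ i $ k * h $ j $ l * ?Y $ k $ l) - (\<Sum>k\<in>UNIV.
            \<Sum>l\<in>UNIV. h $ i $ l * h $ j $ k * ?Y $ k $ l))"
        by (simp add: weyl_op_def weyl_def riemann_def h_def[symmetric] rho_h ricci scal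
          sum_distrib_left sum_subtractf[symmetric] sum.distrib[symmetric] algebra_simps)
      also have "\<dots> = Rm \<omega> $ i $ j
        - (1/4) * ((ric ** ?Y ** h) $ i $ j + (ric ** ?Y ** h) $ i $ j + (h ** ?Y ** ric) $ i $ j
            + (h ** ?Y ** ric) $ i $ j)
        + (scal / 12) * ((h ** ?Y ** h) $ i $ j + (h ** ?Y ** h) $ i $ j)"
        unfolding s1 s2 Yt ht rt by (simp add: Rm_nth matrix_mult_distribs)
      also have "ric ** ?Y ** h = ric ** ?X ** \<omega>" by (simp add: hY flip: matrix_mul_assoc)
      also have "h ** ?Y ** ric = \<omega> ** ?X ** ric" by (simp add: hY)
      also have "h ** ?Y ** h = \<omega>" by (simp add: hY metric_inverse[OF h] flip: matrix_mul_assoc)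
      finally show ?thesis by (simp add: algebra_simps)
    qed
    then have W: "weyl_op g x \<omega> = Rm \<omega> - (1/2) *\<^sub>R (ric ** ?X ** \<omega> + \<omega> ** ?X ** ric) + (scal / 6) *\<^sub>R \<omega>"
      by (simp add: vec_eq_iff)
    have "B \<omega> = (1/2) *\<^sub>R (ric ** ?X ** \<omega> + \<omega> ** ?X ** ric) - (scal / 4) *\<^sub>R \<omega>"
      by (simp add: B_def S0_def matrix_ring ric_symmetric metric_inverse[OF h] mat_scaleR[of
          "scal / 4"])
        (simp add: vec_eq_iff field_simps)
    then show ?thesis
      unfolding weyl_scalar_op_def W A_def scal by (simp add: vec_eq_iff field_simps)
  qed
  have D: "form_inner h (D_op g x \<omega>) \<omega> = D_form \<omega>" if w: "\<omega> \<in> self_dual 1 h" for \<omega>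
  proof -
    have f: "\<omega> \<in> forms2" and Aw: "A \<omega> \<in> self_dual 1 h" using w self_dual_forms2 A_self_dual by blast+
    \<comment> \<open>The property that characterises the value of \<open>Ric0_adj\<close> in its definition.\<close>
    let ?P = "\<lambda>\<eta>. \<eta> \<in> self_dual 1 h \<and> (\<forall>\<zeta>\<in>self_dual 1 h. form_inner h \<eta> \<zeta> = form_inner h (B \<omega>) (B \<zeta>))"
    have F: "basis3 (self_dual 1 h) (form_frame h)" by (rule form_frame(1)[OF h])
    define \<eta> where "\<eta> = (\<Sum>c\<in>UNIV. form_inner h (B \<omega>) (B (form_frame h c)) *\<^sub>R form_frame h c)"
    have "?P \<eta>"
    proof (intro conjI ballI)
      show "\<eta> \<in> self_dual 1 h" unfolding \<eta>_def by (rule basis3_mem[OF F])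
      fix \<zeta> assume z: "\<zeta> \<in> self_dual 1 h"
      obtain y where y: "\<zeta> = (\<Sum>c\<in>UNIV. y c *\<^sub>R form_frame h c)" by (rule basis3_expand[OF F z])
      show "form_inner h \<eta> \<zeta> = form_inner h (B \<omega>) (B \<zeta>)"
        by (simp add: y \<eta>_def sum_3 form_frame(2)[OF h] B_linear)
    qed
    moreover have "\<theta> = \<eta>" if "?P \<theta>" for \<theta>
    proof (rule ccontr)
      assume "\<theta> \<noteq> \<eta>"
      then have "form_inner h (\<theta> - \<eta>) (\<theta> - \<eta>) > 0" by (intro form_inner_pos[OF h]) simp
      moreover have "\<theta> - \<eta> \<in> self_dual 1 h" using that \<open>?P \<eta>\<close> by (intro subspace_diff
          subspace_self_dual) auto
      ultimately show False using that \<open>?P \<eta>\<close> by (metis form_inner_linear(3) diff_self less_irrefl)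
    qed
    ultimately have "(THE \<eta>. ?P \<eta>) = \<eta>" by (rule the_equality)
    then have "Ric0_adj g x (B \<omega>) = \<eta>" by (simp add: Ric0_adj_def B h_def)
    then have "form_inner h (D_op g x \<omega>) \<omega> = form_inner h (A (A \<omega>)) \<omega> - form_inner h (B \<omega>) (B \<omega>)"
      using \<open>?P \<eta>\<close> w by (simp add: D_op_def A[OF f] A[OF self_dual_forms2[OF Aw]] B)
    then show ?thesis using A_symmetric[OF Aw w] by (simp add: D_form_def)
  qed
  have pos: "pos_def_sd (g x) (D_op g x) \<longleftrightarrow> (\<forall>\<omega>\<in>self_dual 1 h. \<omega> \<noteq> 0 \<longrightarrow> D_form \<omega> > 0)"
    and neg: "neg_def_sd (g x) (D_op g x) \<longleftrightarrow> (\<forall>\<omega>\<in>self_dual 1 h. \<omega> \<noteq> 0 \<longrightarrow> D_form \<omega> < 0)"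
    using D by (simp_all add: pos_def_sd_def neg_def_sd_def h_def)
  show ?iff unfolding pos neg lc by (rule definite_curvature_iff)
  have ob: "oriented_basis 1 h i \<in> forms2" for i
    using oriented_basis[OF h, of 1] basis3_basis_mem self_dual_forms2 by (fastforce simp:
        so3_basis_def)
  have det: "form_det (g x) 1 1 (weyl_scalar_op g x) = form_det h 1 1 A"
    by (simp add: form_det_def h_def[symmetric] A ob)
  have v: "(axis 1 1 :: real^4) \<noteq> 0" by (simp add: axis_eq_0_iff)
  show "pos_def_sd (g x) (D_op g x) \<Longrightarrow> induces_orientation (lc_curvature g x) 1 \<and>
       connection_sign (lc_curvature g x) = sgn (form_det (g x) 1 1 (weyl_scalar_op g x))"
    unfolding pos det lc using frame_curvature_sign(1)[OF v, of 1] connection_sign_pos by simp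
  show "neg_def_sd (g x) (D_op g x) \<Longrightarrow> induces_orientation (lc_curvature g x) (- 1) \<and>
       connection_sign (lc_curvature g x) = sgn (form_det (g x) 1 (- 1) (Ric0 g x))"
    unfolding neg B lc using frame_curvature_sign(1)[OF v, of "- 1"] connection_sign_neg by (simp
        add: h_def)
qed

theorem theorem3p1:
  fixes A :: "'a::{t2_space, second_countable_topology} chart set"
    and g :: "'a chart \<Rightarrow> real^4 \<Rightarrow> real^4^4"
  assumes "oriented_riemannian_4manifold A g"
  shows "(everywhere A g (\<lambda>\<gamma> x. definite_curvature (lc_curvature \<gamma> x)) \<longleftrightarrow>
          everywhere A g (\<lambda>\<gamma> x. pos_def_sd (\<gamma> x) (D_op \<gamma> x) \<or> neg_def_sd (\<gamma> x) (D_op \<gamma> x))) \<and>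
         (everywhere A g (\<lambda>\<gamma> x. pos_def_sd (\<gamma> x) (D_op \<gamma> x)) \<longrightarrow>
          everywhere A g (\<lambda>\<gamma> x. induces_orientation (lc_curvature \<gamma> x) 1 \<and>
            connection_sign (lc_curvature \<gamma> x) =
              sgn (form_det (\<gamma> x) 1 1 (weyl_scalar_op \<gamma> x)))) \<and>
         (everywhere A g (\<lambda>\<gamma> x. neg_def_sd (\<gamma> x) (D_op \<gamma> x)) \<longrightarrow>
          everywhere A g (\<lambda>\<gamma> x. induces_orientation (lc_curvature \<gamma> x) (- 1) \<and>
            connection_sign (lc_curvature \<gamma> x) =
              sgn (form_det (\<gamma> x) 1 (- 1) (Ric0 \<gamma> x))))"
proof -
  have loc: "local_metric (g c) (snd c ` fst c)" if "c \<in> A" for c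
    using assms that
    by (auto simp: local_metric_def oriented_riemannian_4manifold_def oriented_smooth_atlas_def riemannian_metric_def is_chart_def)
  note pt = definite_pointwise[OF loc imageI]
  show ?thesis
    unfolding everywhere_def using pt by blast
qed

end
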